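(* For every problem instance satisfying the Piecewise Stabilizability assumption (with constants $C_W\ge0$, $\epsilon>0$) and the Time-Homogeneous Reference Policy Stationarity assumption (with constants $\delta>0$, $C_V>0$), the policy \texttt{SSMW}, run with parameters $M,K,\delta$, guarantees $$\frac1T\,\mathbb E\left[\sum_{t=1}^T\lVert\mathbf Q_t\rVert_1\right]\le\left[3KM^2m_0+\frac{(K+1)M^2}2+(KM^2+\epsilon KM)C_W+6M^2\right]\cdot\frac{10}\epsilon$$ for any time horizon length $T\ge\frac4{C_W}+C_W$. In particular, the system is stable. Here $$m_0=\inf\left\{m:m\ge2,\ f(m')\le\frac\epsilon2\ \ \forall m'\ge m\right\}\le\left((1+C_V)MK\ln K\,\epsilon^{-1}\right)^{O(1/\delta)},$$ where $f(m)=88(1+C_V)MKm^{-\frac\delta2}(2\ln m+\ln K)$.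
   Context: Notation: $[K]=\{1,\dots,K\}$; $\Delta^{[K]}$ is the probability simplex over $[K]$; $\Delta^{[K],\beta}=\{\mathbf x\in\Delta^{[K]}:x_i\ge\beta\ \forall i\}$. In the definition of $m_0$, $m,m'$ range over integers. $4/C_W$ is read as $+\infty$ if $C_W=0$. Queueing model: $K$ job types (queues), time slots $t=1,2,\dots$. Distributions $\mathcal A_1,\mathcal A_2,\dots$ and $\mathcal S_1,\mathcal S_2,\dots$ on $[0,M]^K$ ($M>0$ a known constant) are fixed before the process starts; $\mathbf A_t\sim\mathcal A_t$ (arrivals) and $\mathbf S_t\sim\mathcal S_t$ (maximum services), all $\mathbf A_t,\mathbf S_t$ being independent; $\vec\lambda_t=\mathbb E[\mathbf A_t]$, $\vec\sigma_t=\mathbb E[\mathbf S_t]$. At the beginning of slot $t$ the scheduler, using only the past history (and its own randomization), chooses one queue $a_t\in[K]$; then $S_{t,a_t}$ is observed. Queue lengths: $\mathbf Q_0=\mathbf 0$, $Q_{t,i}=\max\{Q_{t-1,i}+A_{t,i}-S_{t,i}\mathbf 1[i=a_t],0\}$. The system is stable under a policy if $\frac1T\sum_{t=0}^{T-1}\sum_{i=1}^K\mathbb E[Q_{t,i}]=O(1)$. Piecewise Stabilizability: there exist $C_W\ge0$, $\epsilon>0$, $\vec\theta_1,\vec\theta_2,\dots\in\Delta^{[K]}$ and a partition of the positive integers into intervals $W_0,W_1,\dots$ such that $\sum_{i:\min W_i<T}(|W_i|-1)^2\le C_WT$ for all $T\ge1$, and for all $i\ge0$, $j\in[K]$: $\frac1{|W_i|}\sum_{t\in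 W_i}\theta_{t,j}\sigma_{t,j}\ge\epsilon+\frac1{|W_i|}\sum_{t\in W_i}\lambda_{t,j}$. Time-Homogeneous Reference Policy Stationarity: for the same sequence $\{\vec\theta_t\}$ there exist $\delta>0$, $C_V>0$ with $\sum_{t=T_0+1}^{T_0+T-1}\lVert\vec\theta_{t+1}-\vec\theta_t\rVert_1\le C_VT^{1-\delta}$ for all $T_0\ge0$, $T\ge1$. \texttt{EXP3.S+} (a bandit algorithm with $K$ actions and initial point $\mathbf x_1\in\Delta^{[K]}$): let $\Psi(\mathbf x)=\sum_i(x_i\ln x_i-x_i)$ and $D_\Psi(\mathbf y,\mathbf x)=\Psi(\mathbf y)-\Psi(\mathbf x)-\langle\nabla\Psi(\mathbf x),\mathbf y-\mathbf x\rangle$. At round $\tau$, given $\beta_\tau\in[0,1/K]$, $\eta_\tau>0$, $\mathbf e_\tau\in\Delta^{[K]}$, $\gamma_\tau\in[0,1/2]$: set $\mathbf p_\tau=(1-\gamma_\tau)\mathbf x_\tau+\gamma_\tau\mathbf e_\tau$; sample and output an action $a\sim\mathbf p_\tau$; receive feedback $g$ for it; let $\tilde{\mathbf g}_\tau$ have $a$-th coordinate $g/p_{\tau,a}$ and zeros elsewhere; set $\mathbf x_{\tau+1}=\arg\min_{\mathbf x'\in\Delta^{[K],\beta_\tau}}\{\langle-\eta_\tau\tilde{\mathbf g}_\tau,\mathbf x'\rangle+D_\Psi(\mathbf x',\mathbf x_\tau)\}$. \texttt{SSMW} (inputs $M,K,\delta$): repeat forever: let $T_0$ be the last slot already decided ($T_0=0$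 initially); let $m=\max\{\lceil\lVert\mathbf Q_{T_0}\rVert_\infty/(2M)\rceil,1\}$; run a fresh \texttt{EXP3.S+} instance for $m$ rounds (an epoch), with, for rounds $\tau=1,\dots,m$: $\beta_\tau=\beta=m^{-2}/K$; $\mathbf x_1$ any element of $\Delta^{[K],\beta}$; $\eta_\tau=(6M^2Km^{1+\frac\delta2})^{-1}$; $\mathbf e_\tau=\mathbf Q_{T_0+\tau-1}/\lVert\mathbf Q_{T_0+\tau-1}\rVert_1$ (arbitrary in $\Delta^{[K]}$ if the queue vector is $\mathbf 0$); $\gamma_\tau=M\eta_\tau\lVert\mathbf Q_{T_0+\tau-1}\rVert_1$. In slot $T_0+\tau$ serve the queue $a_{T_0+\tau}$ output by \texttt{EXP3.S+} and feed back $Q_{T_0+\tau-1,a_{T_0+\tau}}S_{T_0+\tau,a_{T_0+\tau}}$.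
   Formalization: δ ≤ 1 is added: for large δ SSMW learns too slowly and the claim fails (δ>1 forces constant θ, so δ=1 applies). The m0 bound is for K ≥ 2, fixed δ: exponent c/δ with absolute c once the base exceeds a δ-dependent bound, else a δ-dependent constant; a uniform one is impossible. *)

theory Defs
  imports "HOL-Probability.Probability" "HOL-Library.Landau_Symbols"
begin

text \<open>The queues are the elements of a finite type \<open>'k\<close>, so \<open>K = CARD('k)\<close>. Time slots are natural
  numbers starting at 1; index 0 is only used for the initial queue vector and for the information
  available before slot 1.\<close>

section \<open>Vectors, simplices, Bregman divergence\<close>

definition norm1 :: "real ^ 'k \<Rightarrow> real" where
  "norm1 v = (\<Sum>i\<in>UNIV. \<bar>v $ i\<bar>)"

definition prob_simplex :: "(real ^ 'k) set" where
  "prob_simplex = {v. (\<forall>i. 0 \<le> v $ i) \<and> (\<Sum>i\<in>UNIV. v $ i) = 1}"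

definition trunc_simplex :: "real \<Rightarrow> (real ^ 'k) set" where
  "trunc_simplex \<beta> = {v \<in> prob_simplex. \<forall>i. \<beta> \<le> v $ i}"

definition neg_entropy :: "real ^ 'k \<Rightarrow> real" where
  "neg_entropy v = (\<Sum>i\<in>UNIV. v $ i * ln (v $ i) - v $ i)"

text \<open>The term \<open>\<langle>\<nabla>\<Psi>(x), y - x\<rangle>\<close> is the derivative of \<open>\<Psi>\<close> at \<open>x\<close> in direction \<open>y - x\<close>. Below, \<open>x\<close> always
  has positive coordinates, where \<open>neg_entropy\<close> is differentiable.\<close>
definition bregman :: "(real ^ 'k \<Rightarrow> real) \<Rightarrow> real ^ 'k \<Rightarrow> real ^ 'k \<Rightarrow> real" where
  "bregman \<Psi> y x = \<Psi> y - \<Psi> x - frechet_derivative \<Psi> (at x) (y - x)"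

section \<open>Queueing model\<close>

primrec queue :: "(nat \<Rightarrow> real ^ 'k) \<Rightarrow> (nat \<Rightarrow> real ^ 'k) \<Rightarrow> (nat \<Rightarrow> 'k) \<Rightarrow> nat \<Rightarrow> real ^ 'k" where
  "queue A S a 0 = 0"
| "queue A S a (Suc t) =
     (\<chi> i. max (queue A S a t $ i + A (Suc t) $ i - S (Suc t) $ i * of_bool (i = a (Suc t))) 0)"

definition mean :: "(real ^ 'k) measure \<Rightarrow> real ^ 'k" where
  "mean D = (\<integral>v. v \<partial>D)"

text \<open>\<open>LA t\<close> and \<open>LS t\<close> are the arrival and service distributions; \<open>F t\<close> is everything that has happened
  up to the end of slot \<open>t\<close>, including the scheduler's own randomization. That the scheduler chooses
  \<open>a t\<close> from the past and its own randomization only is the assumption \<open>nonanticipating\<close>: the pair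
  \<open>(A t, S t)\<close> is independent of the sigma-algebra generated by \<open>F (t - 1)\<close> and \<open>a t\<close>.\<close>
locale queueing_system = prob_space P + filtration "space P" F
  for P :: "'w measure" and F :: "nat \<Rightarrow> 'w measure" +
  fixes M :: real
    and LA LS :: "nat \<Rightarrow> (real ^ 'k) measure"
    and A S :: "nat \<Rightarrow> 'w \<Rightarrow> real ^ 'k"
    and a :: "nat \<Rightarrow> 'w \<Rightarrow> 'k"
  assumes M_pos: "0 < M"
    and LA_bounded: "\<And>t. 1 \<le> t \<Longrightarrow> AE v in LA t. \<forall>i. v $ i \<in> {0..M}"
    and LS_bounded: "\<And>t. 1 \<le> t \<Longrightarrow> AE v in LS t. \<forall>i. v $ i \<in> {0..M}"
    and A_law: "\<And>t. 1 \<le> t \<Longrightarrow> distr P borel (A t) = LA t"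
    and S_law: "\<And>t. 1 \<le> t \<Longrightarrow> distr P borel (S t) = LS t"
    and A_S_indep: "indep_vars (\<lambda>_. borel) (case_sum A S) ({1..} <+> {1..})"
    and F_subalgebra: "\<And>t. subalgebra P (F t)"
    and A_adapted: "\<And>t. 1 \<le> t \<Longrightarrow> A t \<in> borel_measurable (F t)"
    and S_adapted: "\<And>t. 1 \<le> t \<Longrightarrow> S t \<in> borel_measurable (F t)"
    and a_adapted: "\<And>t. 1 \<le> t \<Longrightarrow> a t \<in> measurable (F t) (count_space UNIV)"
    and nonanticipating: "\<And>t. 1 \<le> t \<Longrightarrow>
      indep_set
        (sigma_sets (space P) (sets (F (t - 1)) \<union> {a t -` I \<inter> space P | I. True}))
        {(\<lambda>\<omega>. (A t \<omega>, S t \<omega>)) -` B \<inter> space P | B. B \<in> sets borel}"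

definition queue_proc ::
  "(nat \<Rightarrow> 'w \<Rightarrow> real ^ 'k) \<Rightarrow> (nat \<Rightarrow> 'w \<Rightarrow> real ^ 'k) \<Rightarrow> (nat \<Rightarrow> 'w \<Rightarrow> 'k) \<Rightarrow> nat \<Rightarrow> 'w \<Rightarrow> real ^ 'k" where
  "queue_proc A S a t \<omega> = queue (\<lambda>s. A s \<omega>) (\<lambda>s. S s \<omega>) (\<lambda>s. a s \<omega>) t"

definition queue_stable :: "'w measure \<Rightarrow> (nat \<Rightarrow> 'w \<Rightarrow> real ^ 'k) \<Rightarrow> bool" where
  "queue_stable P Q \<longleftrightarrow>
     (\<lambda>T. 1 / real T * (\<Sum>t<T. \<Sum>i\<in>UNIV. \<integral>\<omega>. Q t \<omega> $ i \<partial>P)) \<in> O(\<lambda>_. 1)"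

section \<open>Assumptions on the reference policy\<close>

text \<open>The intervals are required to be finite: an infinite sequence of nonempty intervals partitioning
  the positive integers contains no infinite interval.\<close>
definition interval_partition :: "(nat \<Rightarrow> nat set) \<Rightarrow> bool" where
  "interval_partition W \<longleftrightarrow>
     (\<forall>i. \<exists>l r. l \<le> r \<and> W i = {l..r}) \<and> disjoint_family W \<and> (\<Union>i. W i) = {1..}"

definition piecewise_stabilizable ::
  "real \<Rightarrow> real \<Rightarrow> (nat \<Rightarrow> real ^ 'k) \<Rightarrow> (nat \<Rightarrow> real ^ 'k) \<Rightarrow> (nat \<Rightarrow> real ^ 'k) \<Rightarrow> bool" where
  "piecewise_stabilizable C\<^sub>W \<epsilon> \<theta> lam sig \<longleftrightarrow>
     0 \<le> C\<^sub>W \<and> 0 < \<epsilon> \<and> (\<forall>t\<ge>1. \<theta> t \<in> prob_simplex) \<and>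
     (\<exists>W. interval_partition W \<and>
        (\<forall>T\<ge>1. (\<Sum>i | Min (W i) < T. (real (card (W i)) - 1)\<^sup>2) \<le> C\<^sub>W * real T) \<and>
        (\<forall>i j. 1 / real (card (W i)) * (\<Sum>t\<in>W i. \<theta> t $ j * sig t $ j)
              \<ge> \<epsilon> + 1 / real (card (W i)) * (\<Sum>t\<in>W i. lam t $ j)))"

text \<open>For \<open>\<delta> > 1\<close> the condition says that \<open>\<theta>\<close> is constant, so it then also holds with exponent 1. But
  \<open>\<delta>\<close> is also an input of SSMW, whose learning rate is too small to learn within an epoch if \<open>\<delta>\<close> is
  large; the theorem therefore takes \<open>\<delta> \<le> 1\<close>.\<close>
definition reference_stationary :: "real \<Rightarrow> real \<Rightarrow> (nat \<Rightarrow> real ^ 'k) \<Rightarrow> bool" where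
  "reference_stationary \<delta> C\<^sub>V \<theta> \<longleftrightarrow>
     0 < \<delta> \<and> 0 < C\<^sub>V \<and>
     (\<forall>T\<^sub>0. \<forall>T\<ge>1. (\<Sum>t = T\<^sub>0 + 1..T\<^sub>0 + T - 1. norm1 (\<theta> (t + 1) - \<theta> t)) \<le> C\<^sub>V * real T powr (1 - \<delta>))"

section \<open>The algorithms\<close>

text \<open>Sample-path relation of \<open>n\<close> rounds of EXP3.S+ between parameters \<open>\<beta>, \<eta>, \<gamma>, e\<close>, iterates \<open>x\<close>
  (with \<open>x 1\<close> the initial point), sampling distributions \<open>p\<close>, actions \<open>act\<close> and feedback \<open>g\<close>. That
  \<open>act \<tau>\<close> is sampled from \<open>p \<tau>\<close> is a property of the law and is stated in \<open>ssmw_run\<close>. The iterate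
  after the last round is never used and not constrained.\<close>
definition exp3s_plus ::
  "nat \<Rightarrow> (nat \<Rightarrow> real) \<Rightarrow> (nat \<Rightarrow> real) \<Rightarrow> (nat \<Rightarrow> real) \<Rightarrow> (nat \<Rightarrow> real ^ 'k) \<Rightarrow>
   (nat \<Rightarrow> real ^ 'k) \<Rightarrow> (nat \<Rightarrow> real ^ 'k) \<Rightarrow> (nat \<Rightarrow> 'k) \<Rightarrow> (nat \<Rightarrow> real) \<Rightarrow> bool" where
  "exp3s_plus n \<beta> \<eta> \<gamma> e x p act g \<longleftrightarrow>
     (\<forall>\<tau>\<in>{1..n}. p \<tau> = (1 - \<gamma> \<tau>) *\<^sub>R x \<tau> + \<gamma> \<tau> *\<^sub>R e \<tau>) \<and>
     (\<forall>\<tau>\<in>{1..<n}.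
        let g_est = axis (act \<tau>) (g \<tau> / p \<tau> $ act \<tau>) in
        is_arg_min (\<lambda>x'. - \<eta> \<tau> *\<^sub>R g_est \<bullet> x' + bregman neg_entropy x' (x \<tau>))
          (\<lambda>x'. x' \<in> trunc_simplex (\<beta> \<tau>)) (x (\<tau> + 1)))"

definition epoch_len :: "real \<Rightarrow> real ^ 'k \<Rightarrow> nat" where
  "epoch_len M q = max (nat \<lceil>infnorm q / (2 * M)\<rceil>) 1"

text \<open>\<open>epoch_start M Q n\<close> is the last slot decided before the \<open>n\<close>-th epoch (counted from 0) on the queue
  trajectory \<open>Q\<close>.\<close>
primrec epoch_start :: "real \<Rightarrow> (nat \<Rightarrow> real ^ 'k) \<Rightarrow> nat \<Rightarrow> nat" where
  "epoch_start M Q 0 = 0"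
| "epoch_start M Q (Suc n) = epoch_start M Q n + epoch_len M (Q (epoch_start M Q n))"

definition ssmw_path ::
  "real \<Rightarrow> real \<Rightarrow> (nat \<Rightarrow> real ^ 'k) \<Rightarrow> (nat \<Rightarrow> real ^ 'k) \<Rightarrow> (nat \<Rightarrow> 'k) \<Rightarrow>
   (nat \<Rightarrow> real ^ 'k) \<Rightarrow> (nat \<Rightarrow> real ^ 'k) \<Rightarrow> (nat \<Rightarrow> real ^ 'k) \<Rightarrow> bool" where
  "ssmw_path M \<delta> S Q a x e p \<longleftrightarrow>
     (\<forall>n. let T\<^sub>0 = epoch_start M Q n;
              m = epoch_len M (Q T\<^sub>0);
              K = real CARD('k);
              \<beta> = 1 / (real m)\<^sup>2 / K;
              \<eta> = 1 / (6 * M\<^sup>2 * K * real m powr (1 + \<delta> / 2))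
          in x (T\<^sub>0 + 1) \<in> trunc_simplex \<beta> \<and>
             (\<forall>\<tau>\<in>{1..m}. e (T\<^sub>0 + \<tau>) \<in> prob_simplex \<and>
                (Q (T\<^sub>0 + \<tau> - 1) \<noteq> 0 \<longrightarrow>
                   e (T\<^sub>0 + \<tau>) = (1 / norm1 (Q (T\<^sub>0 + \<tau> - 1))) *\<^sub>R Q (T\<^sub>0 + \<tau> - 1))) \<and>
             exp3s_plus m (\<lambda>_. \<beta>) (\<lambda>_. \<eta>) (\<lambda>\<tau>. M * \<eta> * norm1 (Q (T\<^sub>0 + \<tau> - 1)))
               (\<lambda>\<tau>. e (T\<^sub>0 + \<tau>)) (\<lambda>\<tau>. x (T\<^sub>0 + \<tau>)) (\<lambda>\<tau>. p (T\<^sub>0 + \<tau>)) (\<lambda>\<tau>. a (T\<^sub>0 + \<tau>))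
               (\<lambda>\<tau>. Q (T\<^sub>0 + \<tau> - 1) $ a (T\<^sub>0 + \<tau>) * S (T\<^sub>0 + \<tau>) $ a (T\<^sub>0 + \<tau>)))"

text \<open>The free choices of the algorithm (initial points and \<open>e t\<close> at an empty queue vector) may depend on
  the past but not on the future, hence the predictability of \<open>x\<close> and \<open>e\<close>.\<close>
locale ssmw_run = queueing_system P F M LA LS A S a
  for P :: "'w measure" and F M
    and LA LS :: "nat \<Rightarrow> (real ^ 'k) measure" and A S a +
  fixes \<delta> :: real
    and x e p :: "nat \<Rightarrow> 'w \<Rightarrow> real ^ 'k"
  assumes x_predictable: "\<And>t. 1 \<le> t \<Longrightarrow> x t \<in> borel_measurable (F (t - 1))"
    and e_predictable: "\<And>t. 1 \<le> t \<Longrightarrow> e t \<in> borel_measurable (F (t - 1))"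
    and path: "\<And>\<omega>. \<omega> \<in> space P \<Longrightarrow>
      ssmw_path M \<delta> (\<lambda>t. S t \<omega>) (\<lambda>t. queue_proc A S a t \<omega>) (\<lambda>t. a t \<omega>)
        (\<lambda>t. x t \<omega>) (\<lambda>t. e t \<omega>) (\<lambda>t. p t \<omega>)"
    and sampled: "\<And>t i. 1 \<le> t \<Longrightarrow>
      AE \<omega> in P. real_cond_exp P (F (t - 1)) (indicat_real {\<omega>. a t \<omega> = i}) \<omega> = p t \<omega> $ i"

section \<open>The threshold in the bound\<close>

definition f_SSMW :: "nat \<Rightarrow> real \<Rightarrow> real \<Rightarrow> real \<Rightarrow> nat \<Rightarrow> real" where
  "f_SSMW K M C\<^sub>V \<delta> m =
     88 * (1 + C\<^sub>V) * M * real K * real m powr (- \<delta> / 2) * (2 * ln (real m) + ln (real K))"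

definition m0_set :: "nat \<Rightarrow> real \<Rightarrow> real \<Rightarrow> real \<Rightarrow> real \<Rightarrow> nat set" where
  "m0_set K M C\<^sub>V \<delta> \<epsilon> = {m. 2 \<le> m \<and> (\<forall>m'\<ge>m. f_SSMW K M C\<^sub>V \<delta> m' \<le> \<epsilon> / 2)}"

definition m0 :: "nat \<Rightarrow> real \<Rightarrow> real \<Rightarrow> real \<Rightarrow> real \<Rightarrow> nat" where
  "m0 K M C\<^sub>V \<delta> \<epsilon> = Inf (m0_set K M C\<^sub>V \<delta> \<epsilon>)"

definition m0_base :: "nat \<Rightarrow> real \<Rightarrow> real \<Rightarrow> real \<Rightarrow> real" where
  "m0_base K M C\<^sub>V \<epsilon> = (1 + C\<^sub>V) * M * real K * ln (real K) / \<epsilon>"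

text \<open>The claim \<open>m0 \<le> m0_base ^ O(1/\<delta>)\<close>. No single constant \<open>c\<close> gives \<open>m0 \<le> m0_base powr (c / \<delta>)\<close> for
  all parameters: for a fixed base, \<open>m0\<close> is at least \<open>(1/\<delta>) powr (2/\<delta>)\<close> as \<open>\<delta> \<rightarrow> 0\<close>, and \<open>m0 \<ge> 2\<close> while the
  right-hand side tends to 1 as \<open>\<delta> \<rightarrow> \<infinity>\<close>. So \<open>\<delta>\<close> is fixed as the other parameters vary: the constant \<open>c\<close>
  is absolute once the base is large enough in terms of \<open>\<delta>\<close>, and for all parameters there is a constant
  \<open>d\<close> depending on \<open>\<delta>\<close> only. If \<open>K = 1\<close> the base is 0, so the bound needs \<open>K \<ge> 2\<close>. Piecewise
  stabilizability forces \<open>\<epsilon> \<le> M\<close>, which keeps the base above 1.\<close>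
definition m0_growth :: bool where
  "m0_growth \<longleftrightarrow>
     (\<exists>c>0. \<forall>\<delta>>0. \<exists>b d. \<forall>K\<ge>2. \<forall>M>0. \<forall>C\<^sub>V>0. \<forall>\<epsilon>>0. \<epsilon> \<le> M \<longrightarrow>
        real (m0 K M C\<^sub>V \<delta> \<epsilon>) \<le> m0_base K M C\<^sub>V \<epsilon> powr (d / \<delta>) \<and>
        (b \<le> m0_base K M C\<^sub>V \<epsilon> \<longrightarrow>
           real (m0 K M C\<^sub>V \<delta> \<epsilon>) \<le> m0_base K M C\<^sub>V \<epsilon> powr (c / \<delta>)))"

end

theory Submission
  imports Defs
begin

text \<open>
  The proof is a quadratic Lyapunov drift argument in which the missing knowledge of the service rates
  is paid for by a bandit regret bound. One slot changes \<open>\<parallel>Q\<parallel>\<^sup>2 / 2\<close> by at most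
  \<open>\<langle>Q, A\<rangle> - Q\<^sub>a S\<^sub>a + K M\<^sup>2 / 2\<close>. If the scheduler served according to the reference policy \<open>\<theta>\<close>, piecewise
  stabilizability would make the sum of these drifts at most \<open>-\<epsilon> \<Sum> \<parallel>Q\<parallel>\<^sub>1\<close> plus a term linear in the
  horizon: inside a window the queues move by at most \<open>M\<close> per slot, so replacing them by their value at
  the start of the window costs the square of the window length
  (\<open>window_slack\<close>, \<open>piecewise_stabilizable_slack\<close>). As the average condition holds only for whole windows,
  the horizon \<open>T\<close> is first prolonged to the end \<open>T' \<le> 2 T + 1\<close> of the window of slot \<open>T + 1\<close>; this is
  where \<open>T \<ge> 4 / C\<^sub>W + C\<^sub>W\<close> enters.

  SSMW differs from \<open>\<theta>\<close> by the regret of EXP3.S+ with gains \<open>Q\<^sub>i S\<^sub>i\<close>. In an epoch of length \<open>m\<close> all queues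
  are at most \<open>3 M m\<close>, and entropic mirror descent against a moving comparator
  (\<open>mirror_descent_tracking_regret\<close>) has regret of order \<open>M m\<^sup>2 f(m)\<close>, also over an
  initial part of the epoch (\<open>long_epoch_charge\<close>). For \<open>m \<ge> m0\<close> this is at most \<open>\<epsilon> M m\<^sup>2 / 8\<close>. On the other
  hand an epoch of length \<open>m \<ge> 2\<close> starts with some queue above \<open>2 M (m - 1)\<close>. Hence
  \<open>\<parallel>Q\<parallel>\<^sub>1 \<ge> M m / 2\<close> throughout this epoch, and also during the \<open>m\<close> slots that end with its starting point. So a
  complete epoch pays for its regret by its own queue lengths, and the last, possibly truncated epoch pays by
  the slots before it (\<open>charge_total\<close>). Together the long epochs use up at most half of the drift
  \<open>\<epsilon> \<Sum> \<parallel>Q\<parallel>\<^sub>1\<close>; short epochs cost at most \<open>3 M\<^sup>2 m0\<close> per slot.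

  Epochs are random, but no stopping times are needed. All of the above holds on every path, at the
  price of an additive \<open>noise\<close> term per slot that collects the deviations of arrivals, services and choices
  from their conditional means (\<open>drift_step\<close>). Whether a slot lies in a long epoch is known before the slot,
  so each noise term has expectation 0 (\<open>noise_mean_zero\<close>), and only one expectation has to be taken, of
  the inequality for the whole horizon (\<open>expected_queue_sum_le\<close>).

  Stability follows by applying the bound with a positive constant above \<open>C\<^sub>W\<close>. The claims about \<open>m0\<close> are
  independent of the queueing model: \<open>f(m) \<le> \<epsilon> / 2\<close> holds as soon as \<open>m powr (\<delta> / 4)\<close> exceeds the base of the
  growth bound times a constant over \<open>\<delta>\<close> (\<open>f_SSMW_le\<close>).
\<close>

section \<open>Entropic mirror descent against a moving comparator\<close>

text \<open>The Bregman divergence of the negative entropy on positive vectors (generalized Kullback-Leibler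
  divergence); see \<open>bregman_neg_entropy\<close>.\<close>
definition rel_ent :: "real ^ 'k \<Rightarrow> real ^ 'k \<Rightarrow> real" where
  "rel_ent u v = (\<Sum>i\<in>UNIV. u $ i * ln (u $ i / v $ i) - u $ i + v $ i)"

lemma neg_entropy_has_derivative:
  fixes v :: "real ^ 'k"
  assumes "\<And>i. 0 < v $ i"
  shows "(neg_entropy has_derivative (\<lambda>h. \<Sum>i\<in>UNIV. h $ i * ln (v $ i))) (at v)"
proof -
  have "((\<lambda>v. v $ i * ln (v $ i) - v $ i) has_derivative (\<lambda>h. h $ i * ln (v $ i))) (at v)" for i
    using assms[of i]
    by (auto intro!: derivative_eq_intros bounded_linear.has_derivative[OF bounded_linear_vec_nth]
        simp: fun_eq_iff field_simps)
  then show ?thesis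
    unfolding neg_entropy_def by (intro has_derivative_sum)
qed

lemma bregman_neg_entropy:
  fixes u v :: "real ^ 'k"
  assumes "\<And>i. 0 < u $ i" "\<And>i. 0 < v $ i"
  shows "bregman neg_entropy u v = rel_ent u v"
proof -
  have "frechet_derivative neg_entropy (at v) = (\<lambda>h. \<Sum>i\<in>UNIV. h $ i * ln (v $ i))"
    using frechet_derivative_at[OF neg_entropy_has_derivative[OF assms(2)]] by simp
  then show ?thesis
    unfolding bregman_def neg_entropy_def rel_ent_def
    by (simp add: sum_subtractf[symmetric] ln_div assms[THEN order_less_imp_not_eq2] algebra_simps)
qed

lemma rel_ent_term_nonneg:
  fixes y z :: real
  assumes "0 < y" "0 < z"
  shows "0 \<le> y * ln (y / z) - y + z"
proof -
  have "ln (z / y) \<le> z / y - 1"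
    using assms by (intro ln_le_minus_one) auto
  then have "y * ln (z / y) \<le> y * (z / y - 1)"
    using assms by (intro mult_left_mono) auto
  also have "\<dots> = z - y" using assms by (simp add: field_simps)
  finally show ?thesis using assms by (simp add: ln_div algebra_simps)
qed

lemma trunc_simplexD:
  assumes "v \<in> trunc_simplex \<beta>"
  shows "\<beta> \<le> v $ i" "0 \<le> v $ i" "v $ i \<le> 1" "(\<Sum>i\<in>UNIV. v $ i) = 1"
proof -
  show "\<beta> \<le> v $ i" "0 \<le> v $ i" "(\<Sum>i\<in>UNIV. v $ i) = 1"
    using assms by (auto simp: trunc_simplex_def prob_simplex_def)
  then show "v $ i \<le> 1"
    using assms member_le_sum[of i UNIV "\<lambda>i. v $ i"] by (auto simp: trunc_simplex_def prob_simplex_def)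
qed

lemma convex_trunc_simplex: "convex (trunc_simplex \<beta> :: (real ^ 'k) set)"
proof (rule convexI)
  fix u v :: "real ^ 'k" and s t :: real
  assume u: "u \<in> trunc_simplex \<beta>" and v: "v \<in> trunc_simplex \<beta>" and st: "0 \<le> s" "0 \<le> t" "s + t = 1"
  have "\<beta> = s * \<beta> + t * \<beta>" using st by (simp add: distrib_right[symmetric])
  then have "\<beta> \<le> s * u $ i + t * v $ i" for i
    using trunc_simplexD(1)[OF u, of i] trunc_simplexD(1)[OF v, of i] st
    by (metis add_mono mult_left_mono)
  moreover have "(\<Sum>i\<in>UNIV. s * u $ i + t * v $ i) = 1"
    using trunc_simplexD(4)[OF u] trunc_simplexD(4)[OF v] st
    by (simp add: sum.distrib sum_distrib_left[symmetric])
  ultimately show "s *\<^sub>R u + t *\<^sub>R v \<in> trunc_simplex \<beta>"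
    using trunc_simplexD(2)[OF u] trunc_simplexD(2)[OF v] st
    by (auto simp: trunc_simplex_def prob_simplex_def)
qed

text \<open>First-order optimality of the minimizer \<open>x'\<close> in direction \<open>u - x'\<close>, rewritten by the three-point identity
  of the Bregman divergence. The gradient exists because the coordinates in the truncated simplex stay
  above \<open>\<beta> > 0\<close>.\<close>
lemma mirror_step:
  fixes x x' u g :: "real ^ 'k"
  assumes \<beta>: "0 < \<beta>" and x: "x \<in> trunc_simplex \<beta>" and u: "u \<in> trunc_simplex \<beta>"
    and arg: "is_arg_min (\<lambda>y. - \<eta> *\<^sub>R g \<bullet> y + bregman neg_entropy y x) (\<lambda>y. y \<in> trunc_simplex \<beta>) x'"
  shows "\<eta> * (g \<bullet> (u - x')) \<le> rel_ent u x - rel_ent u x' - rel_ent x' x"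
proof -
  have x': "x' \<in> trunc_simplex \<beta>" using arg by (simp add: is_arg_min_def)
  have xpos: "0 < x $ i" for i using trunc_simplexD(1)[OF x, of i] \<beta> by simp
  have x'pos: "0 < x' $ i" for i using trunc_simplexD(1)[OF x', of i] \<beta> by simp
  have upos: "0 < u $ i" for i using trunc_simplexD(1)[OF u, of i] \<beta> by simp
  define y where "y s = x' + s *\<^sub>R (u - x')" for s
  define \<phi> where "\<phi> s = - \<eta> * (g \<bullet> y s) + rel_ent (y s) x" for s
  \<comment> \<open>The objective is followed along the segment from \<open>x'\<close> to \<open>u\<close>; \<open>D\<close> is its slope at \<open>x'\<close>.\<close>
  define D where "D = - \<eta> * (g \<bullet> (u - x')) + (\<Sum>i\<in>UNIV. (u $ i - x' $ i) * ln (x' $ i / x $ i))"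
  have y_mem: "y s \<in> trunc_simplex \<beta>" if "0 \<le> s" "s \<le> 1" for s
  proof -
    have "y s = (1 - s) *\<^sub>R x' + s *\<^sub>R u" by (simp add: y_def algebra_simps)
    then show ?thesis using convexD[OF convex_trunc_simplex x' u, of "1 - s" s] that by simp
  qed
  have \<phi>_min: "\<phi> 0 \<le> \<phi> s" if "0 \<le> s" "s \<le> 1" for s
  proof -
    have pos: "0 < y s $ i" for i using trunc_simplexD(1)[OF y_mem[OF that], of i] \<beta> by simp
    have "\<not> (- \<eta> *\<^sub>R g \<bullet> y s + bregman neg_entropy (y s) x < - \<eta> *\<^sub>R g \<bullet> x' + bregman neg_entropy x' x)"
      using arg y_mem[OF that] by (auto simp: is_arg_min_def)
    moreover have "y 0 = x'" by (simp add: y_def)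
    ultimately show ?thesis
      by (simp add: \<phi>_def bregman_neg_entropy pos xpos x'pos)
  qed
  have deriv_term: "((\<lambda>s. y s $ i * ln (y s $ i / x $ i) - y s $ i + x $ i) has_real_derivative
      (u $ i - x' $ i) * ln (x' $ i / x $ i)) (at 0)" for i
    unfolding y_def using xpos[of i] x'pos[of i]
    by (auto intro!: derivative_eq_intros simp: field_simps)
  have "((\<lambda>s. - \<eta> * (g \<bullet> y s)) has_real_derivative - \<eta> * (g \<bullet> (u - x'))) (at 0)"
    unfolding y_def inner_add_right inner_scaleR_right by (auto intro!: derivative_eq_intros)
  moreover have "((\<lambda>s. rel_ent (y s) x) has_real_derivative
      (\<Sum>i\<in>UNIV. (u $ i - x' $ i) * ln (x' $ i / x $ i))) (at 0)"
    unfolding rel_ent_def by (intro DERIV_sum deriv_term)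
  ultimately have deriv: "(\<phi> has_real_derivative D) (at 0)"
    unfolding \<phi>_def D_def by (rule DERIV_add)
  have "0 \<le> D"
  proof (rule ccontr)
    assume "\<not> 0 \<le> D"
    then obtain d where d: "d > 0" "\<And>h. 0 < h \<Longrightarrow> h < d \<Longrightarrow> \<phi> h < \<phi> 0"
      using DERIV_neg_dec_right[OF deriv] by auto
    have "\<phi> (min (d/2) 1) < \<phi> 0" using d(1) by (intro d(2)) auto
    moreover have "\<phi> 0 \<le> \<phi> (min (d/2) 1)" using d(1) by (intro \<phi>_min) auto
    ultimately show False by simp
  qed
  moreover have "rel_ent u x - rel_ent u x' - rel_ent x' x
      = (\<Sum>i\<in>UNIV. (u $ i - x' $ i) * ln (x' $ i / x $ i))"
    unfolding rel_ent_def sum_subtractf[symmetric]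
    by (intro sum.cong refl) (simp add: ln_div xpos[THEN order_less_imp_not_eq2] x'pos[THEN order_less_imp_not_eq2] upos[THEN order_less_imp_not_eq2] algebra_simps)
  ultimately show ?thesis by (simp add: D_def)
qed

text \<open>The second-order cost of one step. The left-hand side, as a function of \<open>y\<close>, is largest at
  \<open>y\<^sub>a = x\<^sub>a exp (\<eta> v)\<close> with the other coordinates equal to those of \<open>x\<close>, where it is \<open>x\<^sub>a (exp z - 1 - z)\<close> for
  \<open>z = \<eta> v\<close>. The condition \<open>z \<le> 1\<close> is what lets this be bounded by \<open>x\<^sub>a z\<^sup>2\<close>.\<close>
lemma local_norm_bound:
  fixes x y :: "real ^ 'k"
  assumes x: "\<And>i. 0 < x $ i" and y: "\<And>i. 0 < y $ i" and z: "0 \<le> \<eta> * v" "\<eta> * v \<le> 1"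
  shows "\<eta> * (axis a v \<bullet> (y - x)) - rel_ent y x \<le> (\<eta> * v)\<^sup>2 * x $ a"
proof -
  define z where "z = \<eta> * v"
  have "0 \<le> y $ a * ln (y $ a / (x $ a * exp z)) - y $ a + x $ a * exp z"
    by (intro rel_ent_term_nonneg) (auto simp: x y)
  then have "z * (y $ a - x $ a) - (y $ a * ln (y $ a / x $ a) - y $ a + x $ a)
      \<le> x $ a * (exp z - 1 - z)"
    using x[of a] y[of a] by (simp add: ln_div ln_mult algebra_simps)
  also have "\<dots> \<le> x $ a * z\<^sup>2"
    using exp_bound[of z] z x[of a] by (intro mult_left_mono) (auto simp: z_def)
  finally have 1: "z * (y $ a - x $ a) - (y $ a * ln (y $ a / x $ a) - y $ a + x $ a) \<le> x $ a * z\<^sup>2" .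
  have "y $ a * ln (y $ a / x $ a) - y $ a + x $ a \<le> rel_ent y x"
    unfolding rel_ent_def by (rule member_le_sum) (auto intro!: rel_ent_term_nonneg x y)
  then show ?thesis using 1 by (simp add: z_def inner_axis' algebra_simps)
qed

text \<open>The price of moving the comparator from \<open>u\<close> to \<open>u'\<close>: by convexity the difference is at most the gradient
  \<open>ln (u'\<^sub>i / x\<^sub>i)\<close> at \<open>u'\<close> applied to \<open>u' - u\<close>, and truncation bounds that gradient by \<open>ln (1 / \<beta>)\<close>.\<close>
lemma rel_ent_diff_le:
  fixes u u' x :: "real ^ 'k"
  assumes \<beta>: "0 < \<beta>" and x: "x \<in> trunc_simplex \<beta>" and u: "u \<in> trunc_simplex \<beta>" and u': "u' \<in> trunc_simplex \<beta>"
  shows "rel_ent u' x - rel_ent u x \<le> ln (1 / \<beta>) * norm1 (u' - u)"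
proof -
  have xpos: "0 < x $ i" for i using trunc_simplexD(1)[OF x, of i] \<beta> by simp
  have upos: "0 < u $ i" for i using trunc_simplexD(1)[OF u, of i] \<beta> by simp
  have u'pos: "0 < u' $ i" for i using trunc_simplexD(1)[OF u', of i] \<beta> by simp
  have term_le: "(u' $ i * ln (u' $ i / x $ i) - u' $ i + x $ i) - (u $ i * ln (u $ i / x $ i) - u $ i + x $ i)
      \<le> ln (1 / \<beta>) * \<bar>(u' - u) $ i\<bar>" for i
  proof -
    have "ln \<beta> \<le> ln (u' $ i)" "ln (u' $ i) \<le> 0" "ln \<beta> \<le> ln (x $ i)" "ln (x $ i) \<le> 0"
      using trunc_simplexD(1,3)[OF x, of i] trunc_simplexD(1,3)[OF u', of i] \<beta> by auto
    then have "\<bar>ln (u' $ i) - ln (x $ i)\<bar> \<le> ln (1 / \<beta>)" using \<beta> by (simp add: ln_div)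
    then have "\<bar>u' $ i - u $ i\<bar> * \<bar>ln (u' $ i) - ln (x $ i)\<bar> \<le> \<bar>u' $ i - u $ i\<bar> * ln (1 / \<beta>)"
      by (intro mult_left_mono) auto
    then have "(u' $ i - u $ i) * (ln (u' $ i) - ln (x $ i)) \<le> \<bar>u' $ i - u $ i\<bar> * ln (1 / \<beta>)"
      unfolding abs_mult[symmetric] by linarith
    moreover have "0 \<le> u $ i * ln (u $ i / u' $ i) - u $ i + u' $ i"
      by (intro rel_ent_term_nonneg upos u'pos)
    ultimately show ?thesis
      by (simp add: ln_div xpos[THEN order_less_imp_not_eq2] upos[THEN order_less_imp_not_eq2]
        u'pos[THEN order_less_imp_not_eq2] algebra_simps)
  qed
  show ?thesis
    unfolding rel_ent_def norm1_def sum_subtractf[symmetric] sum_distrib_left by (intro sum_mono term_le)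
qed

lemma rel_ent_le:
  fixes u x :: "real ^ 'k"
  assumes \<beta>: "0 < \<beta>" and x: "x \<in> trunc_simplex \<beta>" and u: "u \<in> trunc_simplex \<beta>"
  shows "rel_ent u x \<le> ln (1 / \<beta>)"
proof -
  have "u $ i * ln (u $ i / x $ i) \<le> u $ i * ln (1 / \<beta>)" for i
    using trunc_simplexD(1-3)[OF x, of i] trunc_simplexD(1-3)[OF u, of i] \<beta>
    by (intro mult_left_mono) (auto intro!: frac_le)
  then have "(\<Sum>i\<in>UNIV. u $ i * ln (u $ i / x $ i)) \<le> (\<Sum>i\<in>UNIV. u $ i * ln (1 / \<beta>))"
    by (intro sum_mono)
  then show ?thesis
    unfolding rel_ent_def
    using trunc_simplexD(4)[OF x] trunc_simplexD(4)[OF u]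
    by (simp add: sum.distrib sum_subtractf sum_distrib_right[symmetric])
qed

text \<open>Regret against a moving comparator \<open>u\<close>. The potential \<open>rel_ent (u j) (x j)\<close> telescopes up to the cost of
  moving \<open>u\<close>. In the last counted round the next iterate need not be optimal, since
  \<open>local_norm_bound\<close> can be applied with the comparator itself in place of the next iterate. This is why the
  bound holds for every initial part of an epoch.\<close>
lemma mirror_descent_tracking_regret:
  fixes x u :: "nat \<Rightarrow> real ^ 'k" and b :: "nat \<Rightarrow> 'k" and v :: "nat \<Rightarrow> real"
  assumes \<beta>: "0 < \<beta>" and \<eta>: "0 < \<eta>"
    and x: "\<And>j. j < m \<Longrightarrow> x j \<in> trunc_simplex \<beta>" and u: "\<And>j. j < m \<Longrightarrow> u j \<in> trunc_simplex \<beta>"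
    and v: "\<And>j. j < m \<Longrightarrow> 0 \<le> \<eta> * v j" "\<And>j. j < m \<Longrightarrow> \<eta> * v j \<le> 1"
    and arg: "\<And>j. Suc j < m \<Longrightarrow> is_arg_min (\<lambda>y. - \<eta> *\<^sub>R axis (b j) (v j) \<bullet> y + bregman neg_entropy y (x j))
        (\<lambda>y. y \<in> trunc_simplex \<beta>) (x (Suc j))"
    and k: "k < m"
  shows "(\<Sum>j<Suc k. axis (b j) (v j) \<bullet> (u j - x j) - \<eta> * (v j)\<^sup>2 * x j $ b j)
      \<le> ln (1 / \<beta>) / \<eta> * (1 + (\<Sum>j<k. norm1 (u (Suc j) - u j)))"
proof -
  define r where "r j = \<eta> * (axis (b j) (v j) \<bullet> (u j - x j)) - (\<eta> * v j)\<^sup>2 * x j $ b j" for j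
  have xpos: "0 < x j $ i" if "j < m" for i j using trunc_simplexD(1)[OF x[OF that], of i] \<beta> by simp
  have upos: "0 < u j $ i" if "j < m" for i j using trunc_simplexD(1)[OF u[OF that], of i] \<beta> by simp
  have step: "r j \<le> rel_ent (u j) (x j) - rel_ent (u j) (x (Suc j))" if j: "Suc j < m" for j
  proof -
    have j': "j < m" using j by simp
    have "\<eta> * (axis (b j) (v j) \<bullet> (u j - x (Suc j)))
        \<le> rel_ent (u j) (x j) - rel_ent (u j) (x (Suc j)) - rel_ent (x (Suc j)) (x j)"
      by (rule mirror_step[OF \<beta> x[OF j'] u[OF j'] arg[OF j]])
    moreover have "\<eta> * (axis (b j) (v j) \<bullet> (x (Suc j) - x j)) - rel_ent (x (Suc j)) (x j)
        \<le> (\<eta> * v j)\<^sup>2 * x j $ b j"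
      by (intro local_norm_bound xpos v j j')
    ultimately show ?thesis by (simp add: r_def inner_diff_right algebra_simps)
  qed
  have last: "r j \<le> rel_ent (u j) (x j)" if j: "j < m" for j
    using local_norm_bound[OF xpos[OF j] upos[OF j] v(1)[OF j] v(2)[OF j], of "b j"] by (simp add: r_def)
  \<comment> \<open>The potential of the current round is kept on the left to start the induction step.\<close>
  have "(\<Sum>j<k. r j) + rel_ent (u k) (x k) \<le> ln (1 / \<beta>) * (1 + (\<Sum>j<k. norm1 (u (Suc j) - u j)))"
    using k
  proof (induction k)
    case 0
    then show ?case using rel_ent_le[OF \<beta> x u] by simp
  next
    case (Suc k)
    have "rel_ent (u (Suc k)) (x (Suc k)) - rel_ent (u k) (x (Suc k)) \<le> ln (1 / \<beta>) * norm1 (u (Suc k) - u k)"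
      using Suc.prems by (intro rel_ent_diff_le \<beta> x u) auto
    then show ?case using Suc step[OF Suc.prems] by (simp add: algebra_simps)
  qed
  then have "(\<Sum>j<Suc k. r j) \<le> ln (1 / \<beta>) * (1 + (\<Sum>j<k. norm1 (u (Suc j) - u j)))"
    using last[OF k] by simp
  moreover have "(\<Sum>j<Suc k. r j) = \<eta> * (\<Sum>j<Suc k. axis (b j) (v j) \<bullet> (u j - x j) - \<eta> * (v j)\<^sup>2 * x j $ b j)"
    unfolding sum_distrib_left by (intro sum.cong refl) (simp add: r_def power2_eq_square algebra_simps)
  ultimately show ?thesis using \<eta> by (simp add: field_simps del: sum.lessThan_Suc)
qed

section \<open>The threshold epoch length\<close>

text \<open>Half of the power \<open>m powr (\<delta> / 2)\<close> absorbs the logarithm, through \<open>ln m \<le> (4 / \<delta>) m powr (\<delta> / 4)\<close>, and the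
  other half absorbs the constants. The upper bound \<open>L\<close> on \<open>ln K\<close> is kept apart from \<open>ln K\<close> so that the case
  \<open>K = 1\<close>, where \<open>ln K\<close> vanishes, is covered as well.\<close>
lemma f_SSMW_le:
  fixes \<delta> M C\<^sub>V \<epsilon> :: real and K m :: nat
  assumes \<delta>: "0 < \<delta>" and M: "0 < M" and C: "0 < C\<^sub>V" and \<epsilon>: "0 < \<epsilon>" and L: "ln (real K) \<le> L" "1/2 \<le> L" and K: "K \<ge> 1"
    and m: "2 \<le> m" and big: "4224 / \<delta> * ((1 + C\<^sub>V) * M * real K * L / \<epsilon>) \<le> real m powr (\<delta> / 4)"
  shows "f_SSMW K M C\<^sub>V \<delta> m \<le> \<epsilon> / 2"
proof -
  define Y where "Y = (1 + C\<^sub>V) * M * real K / \<epsilon>"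
  have Y: "Y \<ge> 0" using assms by (simp add: Y_def)
  have ln2: "1/2 \<le> ln (real m)"
  proof -
    have "1/2 \<le> ln (2::real)" using ln2_ge_two_thirds by simp
    also have "\<dots> \<le> ln (real m)" using m by simp
    finally show ?thesis .
  qed
  have "ln (real m) * (\<delta> / 4) = ln (real m powr (\<delta> / 4))" using m by (simp add: ln_powr)
  also have "\<dots> \<le> real m powr (\<delta> / 4)" using m
    by (intro ln_bound) auto
  finally have lnm: "ln (real m) \<le> 4 / \<delta> * real m powr (\<delta> / 4)" using \<delta> by (simp add: field_simps)
  have "2 * ln (real m) + ln (real K) \<le> 4 * L * ln (real m) + 2 * L * ln (real m)"
  proof -
    have "1/2 * ln (real m) \<le> L * ln (real m)" using L ln2 by (intro mult_right_mono) auto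
    moreover have "L * (1/2) \<le> L * ln (real m)" using L ln2 by (intro mult_left_mono) auto
    ultimately show ?thesis using L by linarith
  qed
  also have "\<dots> = 6 * L * ln (real m)" by simp
  also have "\<dots> \<le> 6 * L * (4 / \<delta> * real m powr (\<delta> / 4))" using L lnm by (intro mult_left_mono) auto
  finally have "176 * Y * (2 * ln (real m) + ln (real K)) \<le> 176 * Y * (6 * L * (4 / \<delta> * real m powr (\<delta> / 4)))"
    using Y by (intro mult_left_mono) auto
  also have "\<dots> = 4224 / \<delta> * (Y * L) * real m powr (\<delta> / 4)" by simp
  also have "\<dots> \<le> real m powr (\<delta> / 4) * real m powr (\<delta> / 4)"
    using big by (intro mult_right_mono) (auto simp: Y_def field_simps)
  also have "\<dots> = real m powr (\<delta> / 2)" by (simp add: powr_add[symmetric])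
  finally have "176 * Y * (2 * ln (real m) + ln (real K)) * real m powr (- \<delta> / 2)
      \<le> real m powr (\<delta> / 2) * real m powr (- \<delta> / 2)"
    by (intro mult_right_mono) auto
  also have "\<dots> = 1" using m by (simp add: powr_add[symmetric])
  finally show ?thesis using \<epsilon> by (simp add: f_SSMW_def Y_def field_simps)
qed

lemma m0_set_nonempty_and_bound:
  fixes \<delta> M C\<^sub>V \<epsilon> B :: real and K :: nat
  assumes \<delta>: "0 < \<delta>" and M: "0 < M" and C: "0 < C\<^sub>V" and \<epsilon>: "0 < \<epsilon>"
    and L: "ln (real K) \<le> L" "1/2 \<le> L" and K: "K \<ge> 1"
    and B: "B = (4224 / \<delta> * ((1 + C\<^sub>V) * M * real K * L / \<epsilon>)) powr (4 / \<delta>)"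
  shows "m0_set K M C\<^sub>V \<delta> \<epsilon> \<noteq> {}" "real (m0 K M C\<^sub>V \<delta> \<epsilon>) \<le> B + 3"
proof -
  define Z where "Z = 4224 / \<delta> * ((1 + C\<^sub>V) * M * real K * L / \<epsilon>)"
  have Z: "0 < Z" using assms by (simp add: Z_def)
  have B0: "0 \<le> B" by (simp add: B)
  define n where "n = nat \<lceil>B\<rceil> + 2"
  have n: "B \<le> real n" "real n \<le> B + 3" "2 \<le> n"
    using B0 by (auto simp: n_def) linarith+
  have "f_SSMW K M C\<^sub>V \<delta> m \<le> \<epsilon> / 2" if "n \<le> m" for m
  proof (rule f_SSMW_le[OF \<delta> M C \<epsilon> L K])
    show "2 \<le> m" using that n by simp
    have "Z = B powr (\<delta> / 4)" using Z \<delta> unfolding B Z_def[symmetric] by (simp add: powr_powr)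
    also have "\<dots> \<le> real m powr (\<delta> / 4)" using that n B0 \<delta> by (intro powr_mono2) auto
    finally show "4224 / \<delta> * ((1 + C\<^sub>V) * M * real K * L / \<epsilon>) \<le> real m powr (\<delta> / 4)"
      by (simp add: Z_def)
  qed
  then have mem: "n \<in> m0_set K M C\<^sub>V \<delta> \<epsilon>" using n by (auto simp: m0_set_def)
  then show "m0_set K M C\<^sub>V \<delta> \<epsilon> \<noteq> {}" by auto
  have "m0 K M C\<^sub>V \<delta> \<epsilon> \<le> n" unfolding m0_def using mem by (rule cInf_lower) simp
  then show "real (m0 K M C\<^sub>V \<delta> \<epsilon>) \<le> B + 3" using n by linarith
qed

lemma m0_set_nonempty:
  assumes "0 < \<delta>" "0 < M" "0 < C\<^sub>V" "0 < \<epsilon>" "1 \<le> K"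
  shows "m0_set K M C\<^sub>V \<delta> \<epsilon> \<noteq> {}"
  by (rule m0_set_nonempty_and_bound(1)[where L = "max (ln (real K)) 1", OF assms(1-4)]) (use assms in auto)

text \<open>Both growth claims come from \<open>m0 \<le> (4224 X / \<delta>) powr (4 / \<delta>) + 3\<close> by writing the numbers \<open>4224 / \<delta>\<close>
  and \<open>4\<close> as powers of the base \<open>X\<close>. The exponents \<open>j\<close> and \<open>l\<close> may depend on \<open>\<delta>\<close> for an arbitrary base above
  1, while \<open>j = 1\<close> and \<open>l = 1 / \<delta>\<close> do once the base is large.\<close>
lemma m0_le_base_powr:
  fixes \<delta> M C\<^sub>V \<epsilon> j l :: real and K :: nat
  assumes \<delta>: "0 < \<delta>" and M: "0 < M" and C: "0 < C\<^sub>V" and \<epsilon>: "0 < \<epsilon>" and K: "2 \<le> K"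
    and X: "X = m0_base K M C\<^sub>V \<epsilon>" "1 \<le> X" and j: "4224 / \<delta> \<le> X powr j" and l: "4 \<le> X powr l" "0 \<le> j"
  shows "real (m0 K M C\<^sub>V \<delta> \<epsilon>) \<le> X powr ((j + 1) * (4 / \<delta>) + l)"
proof -
  have "1/2 \<le> ln (2::real)" using ln2_ge_two_thirds by simp
  also have "\<dots> \<le> ln (real K)" using K by simp
  finally have lnK: "1/2 \<le> ln (real K)" .
  define Y where "Y = X powr ((j + 1) * (4 / \<delta>))"
  have "real (m0 K M C\<^sub>V \<delta> \<epsilon>) \<le> (4224 / \<delta> * X) powr (4 / \<delta>) + 3"
    using m0_set_nonempty_and_bound(2)[OF \<delta> M C \<epsilon> order_refl lnK _ refl] K X
    by (simp add: m0_base_def)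
  also have "(4224 / \<delta> * X) powr (4 / \<delta>) \<le> (X powr j * X) powr (4 / \<delta>)"
    using j X(2) \<delta> by (intro powr_mono2 mult_right_mono) auto
  also have "(X powr j * X) powr (4 / \<delta>) = Y"
  proof -
    have "(j + 1) * (4 / \<delta>) = j * (4 / \<delta>) + 4 / \<delta>" by (simp add: distrib_right del: times_divide_eq_right)
    then show ?thesis using X(2) by (simp only: Y_def powr_add) (simp add: powr_powr powr_mult)
  qed
  also have "Y + 3 \<le> Y * 4"
    using X(2) \<delta> l by (auto simp: Y_def intro!: ge_one_powr_ge_zero)
  also have "\<dots> \<le> Y * X powr l" using l by (intro mult_left_mono) (auto simp: Y_def)
  finally show ?thesis by (simp add: Y_def powr_add)
qed

lemma m0_growth: m0_growth
  unfolding m0_growth_def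
proof (rule exI[of _ "9::real"], intro conjI allI impI)
  fix \<delta> :: real assume \<delta>: "0 < \<delta>"
  define b where "b = max 1 (max (4224 / \<delta>) (4 powr \<delta>))"
  define j where "j = max 0 (log (4/3) (4224 / \<delta>))"
  define l where "l = log (4/3::real) 4"
  have j: "0 \<le> j" "4224 / \<delta> \<le> (4/3) powr j"
  proof -
    have "4224 / \<delta> = (4/3) powr (log (4/3) (4224 / \<delta>))" using \<delta> by (subst powr_log_cancel) auto
    also have "\<dots> \<le> (4/3) powr j" by (intro powr_mono) (auto simp: j_def)
    finally show "4224 / \<delta> \<le> (4/3) powr j" .
  qed (simp add: j_def)
  have l: "0 \<le> l" "(4/3) powr l = 4" by (auto simp: l_def)
  have bounds: "real (m0 K M C\<^sub>V \<delta> \<epsilon>) \<le> m0_base K M C\<^sub>V \<epsilon> powr ((4 * (j + 1) + l * \<delta>) / \<delta>) \<and>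
      (b \<le> m0_base K M C\<^sub>V \<epsilon> \<longrightarrow> real (m0 K M C\<^sub>V \<delta> \<epsilon>) \<le> m0_base K M C\<^sub>V \<epsilon> powr (9 / \<delta>))"
    if K: "2 \<le> K" and M: "0 < M" and C: "0 < C\<^sub>V" and \<epsilon>: "0 < \<epsilon>" "\<epsilon> \<le> M" for K M C\<^sub>V \<epsilon>
  proof -
    define X where "X = m0_base K M C\<^sub>V \<epsilon>"
    \<comment> \<open>The base is bounded away from 1, because \<open>\<epsilon> \<le> M\<close> and \<open>K \<ge> 2\<close>.\<close>
    have "4/3 \<le> 2 * ln (2::real)" using ln2_ge_two_thirds by simp
    also have "\<dots> \<le> real K * ln (real K)" using K by (intro mult_mono) auto
    also have "\<dots> \<le> ((1 + C\<^sub>V) * (M / \<epsilon>)) * (real K * ln (real K))"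
    proof -
      have "1 * 1 \<le> (1 + C\<^sub>V) * (M / \<epsilon>)" using C \<epsilon> by (intro mult_mono) auto
      then have "1 * (real K * ln (real K)) \<le> ((1 + C\<^sub>V) * (M / \<epsilon>)) * (real K * ln (real K))"
        using K by (intro mult_right_mono) auto
      then show ?thesis by simp
    qed
    also have "\<dots> = X" by (simp add: X_def m0_base_def)
    finally have X: "4/3 \<le> X" .
    have "(4/3) powr j \<le> X powr j" "(4/3) powr l \<le> X powr l"
      using X j(1) l(1) by (simp_all add: powr_mono2)
    then have "real (m0 K M C\<^sub>V \<delta> \<epsilon>) \<le> X powr ((j + 1) * (4 / \<delta>) + l)"
      using X j l by (intro m0_le_base_powr[OF \<delta> M C \<epsilon>(1) K X_def]) auto
    also have "(j + 1) * (4 / \<delta>) + l = (4 * (j + 1) + l * \<delta>) / \<delta>" using \<delta> by (simp add: field_simps)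
    finally have 1: "real (m0 K M C\<^sub>V \<delta> \<epsilon>) \<le> X powr ((4 * (j + 1) + l * \<delta>) / \<delta>)" .
    \<comment> \<open>The exponent is \<open>8 / \<delta>\<close> from \<open>j = 1\<close> and \<open>1 / \<delta>\<close> from \<open>4 \<le> X powr (1 / \<delta>)\<close>.\<close>
    have 2: "real (m0 K M C\<^sub>V \<delta> \<epsilon>) \<le> X powr (9 / \<delta>)" if b: "b \<le> X"
    proof -
      have "(4::real) = (4 powr \<delta>) powr (1 / \<delta>)" using \<delta> by (simp add: powr_powr)
      also have "\<dots> \<le> X powr (1 / \<delta>)" using b \<delta> by (intro powr_mono2) (auto simp: b_def)
      finally have "real (m0 K M C\<^sub>V \<delta> \<epsilon>) \<le> X powr ((1 + 1) * (4 / \<delta>) + 1 / \<delta>)"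
        using X b by (intro m0_le_base_powr[OF \<delta> M C \<epsilon>(1) K X_def]) (auto simp: b_def)
      then show ?thesis by (simp add: add_divide_distrib[symmetric])
    qed
    show ?thesis using 1 2 unfolding X_def by blast
  qed
  show "\<exists>b d. \<forall>K\<ge>2. \<forall>M>0. \<forall>C\<^sub>V>0. \<forall>\<epsilon>>0. \<epsilon> \<le> M \<longrightarrow>
      real (m0 K M C\<^sub>V \<delta> \<epsilon>) \<le> m0_base K M C\<^sub>V \<epsilon> powr (d / \<delta>) \<and>
      (b \<le> m0_base K M C\<^sub>V \<epsilon> \<longrightarrow> real (m0 K M C\<^sub>V \<delta> \<epsilon>) \<le> m0_base K M C\<^sub>V \<epsilon> powr (9 / \<delta>))"
    by (rule exI[of _ b], rule exI[of _ "4 * (j + 1) + l * \<delta>"]) (intro allI impI bounds)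
qed simp

section \<open>Drift under the reference policy\<close>

text \<open>Within one window a single queue \<open>q\<close> is compared with its value at the start of the window. For the
  constant queue \<open>q 0\<close> the sum is nonnegative by the average condition; the first slot has no error,
  and each of the other \<open>k\<close> slots has error at most \<open>M k\<close> in the queue and \<open>M + \<epsilon>\<close> in the rate.\<close>
lemma window_slack:
  fixes q y :: "nat \<Rightarrow> real"
  assumes lip: "\<And>j. \<bar>q (Suc j) - q j\<bar> \<le> M" and y: "\<And>j. j \<le> k \<Longrightarrow> \<bar>y j\<bar> \<le> M"
    and \<epsilon>: "0 \<le> \<epsilon>" and q: "0 \<le> q 0" and avg: "\<epsilon> * real (Suc k) \<le> (\<Sum>j<Suc k. y j)"
  shows "- (M\<^sup>2 + \<epsilon> * M) * (real k)\<^sup>2 \<le> (\<Sum>j<Suc k. q j * (y j - \<epsilon>))"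
proof -
  have M: "0 \<le> M" using lip[of 0] by linarith
  have near: "\<bar>q j - q 0\<bar> \<le> M * real j" for j
  proof (induction j)
    case (Suc j)
    then show ?case using lip[of j] by (simp add: algebra_simps)
  qed simp
  have far: "- (M\<^sup>2 + \<epsilon> * M) * real k \<le> (q (Suc j) - q 0) * (y (Suc j) - \<epsilon>)" if j: "j < k" for j
  proof -
    have "\<bar>(q (Suc j) - q 0) * (y (Suc j) - \<epsilon>)\<bar> \<le> (M * real k) * (M + \<epsilon>)"
      unfolding abs_mult
    proof (rule mult_mono)
      have "M * real (Suc j) \<le> M * real k" using j M by (intro mult_left_mono) auto
      then show "\<bar>q (Suc j) - q 0\<bar> \<le> M * real k" using near[of "Suc j"] by linarith
      show "\<bar>y (Suc j) - \<epsilon>\<bar> \<le> M + \<epsilon>" using y[of "Suc j"] j \<epsilon> by simp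
    qed (use M in auto)
    then show ?thesis by (simp add: power2_eq_square algebra_simps abs_le_iff)
  qed
  have "real k * (- (M\<^sup>2 + \<epsilon> * M) * real k) \<le> (\<Sum>j<k. (q (Suc j) - q 0) * (y (Suc j) - \<epsilon>))"
    using sum_bounded_below[of "{..<k}" "- (M\<^sup>2 + \<epsilon> * M) * real k" "\<lambda>j. (q (Suc j) - q 0) * (y (Suc j) - \<epsilon>)"] far
    by simp
  also have "\<dots> = (\<Sum>j<Suc k. (q j - q 0) * (y j - \<epsilon>))" by (simp add: sum.lessThan_Suc_shift del: sum.lessThan_Suc)
  finally have "- (M\<^sup>2 + \<epsilon> * M) * (real k)\<^sup>2 \<le> (\<Sum>j<Suc k. (q j - q 0) * (y j - \<epsilon>))"
    by (simp add: power2_eq_square algebra_simps)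
  moreover have "0 \<le> q 0 * ((\<Sum>j<Suc k. y j) - \<epsilon> * real (Suc k))" using q avg by simp
  moreover have "q 0 * ((\<Sum>j<Suc k. y j) - \<epsilon> * real (Suc k)) = (\<Sum>j<Suc k. q 0 * (y j - \<epsilon>))"
    unfolding sum_distrib_left[symmetric] sum_subtractf by simp
  moreover have "(\<Sum>j<Suc k. q j * (y j - \<epsilon>)) = (\<Sum>j<Suc k. (q j - q 0) * (y j - \<epsilon>)) + (\<Sum>j<Suc k. q 0 * (y j - \<epsilon>))"
    unfolding sum.distrib[symmetric] by (simp only: distrib_right[symmetric] diff_add_cancel)
  ultimately show ?thesis by linarith
qed

text \<open>\<open>T'\<close> is the end of the window that contains \<open>T + 1\<close>, so that \<open>{1..T'}\<close> is a union of complete windows. That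
  window satisfies \<open>(|W| - 1)\<^sup>2 \<le> C\<^sub>W (T + 2) < (T + 1)\<^sup>2\<close>, which gives \<open>T' \<le> 2 T + 1\<close>.\<close>
lemma piecewise_stabilizable_slack:
  fixes \<theta> lam sig :: "nat \<Rightarrow> real ^ 'k" and M C\<^sub>W \<epsilon> :: real
  assumes stab: "piecewise_stabilizable C\<^sub>W \<epsilon> \<theta> lam sig" and C\<^sub>W: "0 < C\<^sub>W" and T: "4 / C\<^sub>W + C\<^sub>W \<le> real T"
    and lam: "\<And>t i. 1 \<le> t \<Longrightarrow> 0 \<le> lam t $ i \<and> lam t $ i \<le> M"
    and sig: "\<And>t i. 1 \<le> t \<Longrightarrow> 0 \<le> sig t $ i \<and> sig t $ i \<le> M"
  obtains T' where "T < T'" "T' \<le> 2 * T + 1"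
    "\<And>Q :: nat \<Rightarrow> real ^ 'k. (\<And>t i. 0 \<le> Q t $ i) \<Longrightarrow> (\<And>t i. \<bar>Q (Suc t) $ i - Q t $ i\<bar> \<le> M) \<Longrightarrow>
      (\<Sum>t<T'. \<epsilon> * norm1 (Q t)) - real CARD('k) * (M\<^sup>2 + \<epsilon> * M) * (C\<^sub>W * (real T' + 1))
      \<le> (\<Sum>t<T'. \<Sum>i\<in>UNIV. Q t $ i * (\<theta> (Suc t) $ i * sig (Suc t) $ i - lam (Suc t) $ i))"
proof -
  have \<epsilon>: "0 < \<epsilon>" and \<theta>: "\<And>t. 1 \<le> t \<Longrightarrow> \<theta> t \<in> prob_simplex"
    using stab by (auto simp: piecewise_stabilizable_def)
  obtain W where W: "interval_partition W"
    and small: "\<And>T. 1 \<le> T \<Longrightarrow> (\<Sum>i | Min (W i) < T. (real (card (W i)) - 1)\<^sup>2) \<le> C\<^sub>W * real T"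
    and serve: "\<And>i j. \<epsilon> + 1 / real (card (W i)) * (\<Sum>t\<in>W i. lam t $ j)
        \<le> 1 / real (card (W i)) * (\<Sum>t\<in>W i. \<theta> t $ j * sig t $ j)"
    using stab unfolding piecewise_stabilizable_def by blast
  have "\<forall>i. \<exists>l r. l \<le> r \<and> W i = {l..r}" using W by (simp add: interval_partition_def)
  then obtain l r where lr: "\<And>i. l i \<le> r i" "\<And>i. W i = {l i..r i}" by metis
  have disj: "i = j" if "t \<in> W i" "t \<in> W j" for i j t
    using W that unfolding interval_partition_def disjoint_family_on_def by blast
  have UW: "(\<Union>i. W i) = {1..}" using W by (simp add: interval_partition_def)
  have l1: "1 \<le> l i" for i
  proof -
    have "l i \<in> W i" using lr by simp
    then have "l i \<in> {1..}" using UW by blast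
    then show ?thesis by simp
  qed
  have MinW: "Min (W i) = l i" for i unfolding lr(2) using lr(1)[of i] by (intro Min_eqI) auto
  have cardW: "card (W i) = Suc (r i - l i)" for i using lr(1)[of i] by (simp add: lr(2) Suc_diff_le)
  have inj_l: "inj_on l I" for I
    using lr disj by (intro inj_onI) (metis atLeastAtMost_iff order_refl)
  have finI: "finite {i. l i < n}" for n
    by (rule inj_on_finite[OF inj_l, of _ "{..<n}"]) auto
  have small': "(\<Sum>i | l i < T. (real (r i - l i))\<^sup>2) \<le> C\<^sub>W * real T" if "1 \<le> T" for T
    using small[OF that] by (simp add: MinW cardW)
  have "Suc T \<in> (\<Union>i. W i)" unfolding UW by simp
  then obtain k where k: "Suc T \<in> W k" by blast
  define T' where "T' = r k"
  define I where "I = {i. l i < Suc T'}"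
  have "T < T'" using k by (simp add: T'_def lr(2))
  moreover have "T' \<le> 2 * T + 1"
  proof -
    have "C\<^sub>W \<le> real T" using T C\<^sub>W by (meson add_increasing divide_nonneg_pos order_trans zero_le_numeral order_refl)
    have "(real (r k - l k))\<^sup>2 \<le> (\<Sum>i | l i < T + 2. (real (r i - l i))\<^sup>2)"
      using k by (intro member_le_sum finI) (auto simp: lr(2))
    also have "\<dots> \<le> C\<^sub>W * real (T + 2)" by (rule small') simp
    also have "\<dots> \<le> real T * real (T + 2)" using \<open>C\<^sub>W \<le> real T\<close> by (intro mult_right_mono) auto
    also have "\<dots> < (real (T + 1))\<^sup>2" by (simp add: power2_eq_square algebra_simps)
    finally have "r k - l k < T + 1" using power2_less_imp_less[of "real (r k - l k)" "real (T + 1)"] by simp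
    then show ?thesis using k unfolding T'_def lr(2) atLeastAtMost_iff by linarith
  qed
  moreover have "(\<Sum>t<T'. \<epsilon> * norm1 (Q t)) - real CARD('k) * (M\<^sup>2 + \<epsilon> * M) * (C\<^sub>W * (real T' + 1))
      \<le> (\<Sum>t<T'. \<Sum>i\<in>UNIV. Q t $ i * (\<theta> (Suc t) $ i * sig (Suc t) $ i - lam (Suc t) $ i))"
    if Q: "\<And>t i. 0 \<le> Q t $ i" "\<And>t i. \<bar>Q (Suc t) $ i - Q t $ i\<bar> \<le> M" for Q :: "nat \<Rightarrow> real ^ 'k"
  proof -
    have M: "0 \<le> M" using lam[of 1 undefined] by simp
    define z where "z i t = Q (t - 1) $ i * (\<theta> t $ i * sig t $ i - lam t $ i - \<epsilon>)" for i t
    have cover: "{1..T'} = (\<Union>i\<in>I. W i)"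
    proof (intro equalityI subsetI)
      fix t assume t: "t \<in> {1..T'}"
      then have "t \<in> (\<Union>i. W i)" unfolding UW by simp
      then obtain i where i: "t \<in> W i" by blast
      then have "i \<in> I" using t by (simp add: I_def lr(2))
      then show "t \<in> (\<Union>i\<in>I. W i)" using i by blast
    next
      fix t assume "t \<in> (\<Union>i\<in>I. W i)"
      then obtain i where i: "t \<in> W i" "l i \<le> T'" by (auto simp: I_def)
      have "r i \<le> T'"
      proof (rule ccontr)
        assume "\<not> r i \<le> T'"
        then have "T' \<in> W i" using i by (simp add: lr(2))
        moreover have "T' \<in> W k" by (simp add: lr T'_def)
        ultimately have "i = k" by (rule disj)
        then show False using \<open>\<not> r i \<le> T'\<close> by (simp add: T'_def)
      qed
      then show "t \<in> {1..T'}" using i l1[of i] by (auto simp: lr(2))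
    qed
    \<comment> \<open>Shift the window to start at 0 and apply the estimate for a single queue.\<close>
    have window: "- (M\<^sup>2 + \<epsilon> * M) * (real (r i - l i))\<^sup>2 \<le> (\<Sum>t\<in>W i. z j t)" for i j
    proof -
      define y where "y n = \<theta> (l i + n) $ j * sig (l i + n) $ j - lam (l i + n) $ j" for n
      have shift: "(\<Sum>t\<in>W i. h t) = (\<Sum>n<Suc (r i - l i). h (l i + n))" for h :: "nat \<Rightarrow> real"
        unfolding lr(2)
        by (rule sum.reindex_bij_witness[of _ "\<lambda>n. l i + n" "\<lambda>t. t - l i"]) (use lr(1)[of i] in auto)
      have "\<bar>y n\<bar> \<le> M" for n
      proof -
        have 1: "1 \<le> l i + n" using l1[of i] by simp
        have "0 \<le> \<theta> (l i + n) $ j" using \<theta>[OF 1] by (simp add: prob_simplex_def)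
        moreover have "\<theta> (l i + n) $ j \<le> 1"
          using \<theta>[OF 1] member_le_sum[of j UNIV "\<lambda>j. \<theta> (l i + n) $ j"] by (simp add: prob_simplex_def)
        ultimately have "0 \<le> \<theta> (l i + n) $ j * sig (l i + n) $ j" "\<theta> (l i + n) $ j * sig (l i + n) $ j \<le> 1 * M"
          using sig[OF 1, of j] mult_mono[of "\<theta> (l i + n) $ j" 1 "sig (l i + n) $ j" M] by auto
        then show ?thesis using lam[OF 1, of j] unfolding y_def by linarith
      qed
      moreover have "\<bar>Q (l i - 1 + Suc n) $ j - Q (l i - 1 + n) $ j\<bar> \<le> M" for n using Q(2)[of "l i - 1 + n" j] by simp
      moreover have "\<epsilon> * real (Suc (r i - l i)) \<le> (\<Sum>n<Suc (r i - l i). y n)"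
      proof -
        have rescale: "\<epsilon> * c \<le> Y - X" if "\<epsilon> + 1 / c * X \<le> 1 / c * Y" "0 < c" for c X Y :: real
          using mult_left_mono[OF that(1), of c] that(2) by (simp add: distrib_left mult.commute)
        show ?thesis
          using rescale[OF serve[of i j]] unfolding cardW shift y_def sum_subtractf by simp
      qed
      ultimately have "- (M\<^sup>2 + \<epsilon> * M) * (real (r i - l i))\<^sup>2
          \<le> (\<Sum>n<Suc (r i - l i). Q (l i - 1 + n) $ j * (y n - \<epsilon>))"
        using \<epsilon> Q(1) by (intro window_slack) auto
      also have "\<dots> = (\<Sum>t\<in>W i. z j t)"
        unfolding shift by (intro sum.cong refl) (use l1[of i] in \<open>simp add: z_def y_def\<close>)
      finally show ?thesis .
    qed
    have "(M\<^sup>2 + \<epsilon> * M) * (\<Sum>i\<in>I. (real (r i - l i))\<^sup>2) \<le> (M\<^sup>2 + \<epsilon> * M) * (C\<^sub>W * real (Suc T'))"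
      using small'[of "Suc T'"] M \<epsilon> unfolding I_def by (intro mult_left_mono) auto
    have bound_j: "- ((M\<^sup>2 + \<epsilon> * M) * (C\<^sub>W * (real T' + 1))) \<le> (\<Sum>t<T'. z j (Suc t))" for j
    proof -
      have "- ((M\<^sup>2 + \<epsilon> * M) * (C\<^sub>W * (real T' + 1))) \<le> (\<Sum>i\<in>I. - (M\<^sup>2 + \<epsilon> * M) * (real (r i - l i))\<^sup>2)"
        using \<open>(M\<^sup>2 + \<epsilon> * M) * (\<Sum>i\<in>I. (real (r i - l i))\<^sup>2) \<le> _\<close>
        unfolding mult_minus_left sum_negf sum_distrib_left[symmetric] by (simp only: of_nat_Suc add.commute neg_le_iff_le)
      also have "\<dots> \<le> (\<Sum>i\<in>I. \<Sum>t\<in>W i. z j t)" by (intro sum_mono window)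
      also have "\<dots> = (\<Sum>t\<in>{1..T'}. z j t)"
        unfolding cover
      proof (rule sum.UNION_disjoint[symmetric])
        show "finite I" unfolding I_def by (rule finI)
        show "\<forall>i\<in>I. finite (W i)" by (simp add: lr(2))
        show "\<forall>i\<in>I. \<forall>j\<in>I. i \<noteq> j \<longrightarrow> W i \<inter> W j = {}" using disj by blast
      qed
      also have "\<dots> = (\<Sum>t<T'. z j (Suc t))" by (simp add: sum.atLeast1_atMost_eq)
      finally show ?thesis .
    qed
    have "(\<Sum>j\<in>(UNIV::'k set). - ((M\<^sup>2 + \<epsilon> * M) * (C\<^sub>W * (real T' + 1)))) \<le> (\<Sum>j\<in>UNIV. \<Sum>t<T'. z j (Suc t))"
      by (intro sum_mono bound_j)
    also have "\<dots> = (\<Sum>t<T'. \<Sum>j\<in>UNIV. z j (Suc t))" by (rule sum.swap)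
    also have "\<dots> = (\<Sum>t<T'. (\<Sum>i\<in>UNIV. Q t $ i * (\<theta> (Suc t) $ i * sig (Suc t) $ i - lam (Suc t) $ i)) - \<epsilon> * norm1 (Q t))"
      unfolding z_def norm1_def by (intro sum.cong refl)
        (simp add: sum_distrib_left sum_subtractf[symmetric] Q(1) algebra_simps)
    finally show ?thesis by (simp add: sum_subtractf sum.distrib algebra_simps)
  qed
  ultimately show ?thesis by (rule that)
qed

section \<open>Means and independence in the queueing model\<close>

lemma borel_measurable_vecI:
  fixes f :: "'a \<Rightarrow> real ^ 'k"
  assumes "\<And>i. (\<lambda>\<omega>. f \<omega> $ i) \<in> borel_measurable N"
  shows "f \<in> borel_measurable N"
  unfolding borel_measurable_euclidean_space[of f]
proof
  fix b :: "real ^ 'k" assume "b \<in> Basis"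
  then obtain i where "b = axis i 1" by (auto simp: Basis_vec_def)
  then show "(\<lambda>\<omega>. f \<omega> \<bullet> b) \<in> borel_measurable N" using assms[of i] by (simp add: inner_axis)
qed

lemma borel_measurable_vec_nth: "(\<lambda>v :: real ^ 'k. v $ i) \<in> borel_measurable borel"
  by (intro borel_measurable_continuous_onI continuous_intros)

lemma (in prob_space) integral_vec_nth_bounded:
  fixes f :: "'a \<Rightarrow> real ^ 'k"
  assumes f: "f \<in> borel_measurable M" and b: "AE \<omega> in M. \<forall>i. f \<omega> $ i \<in> {0..B}"
  shows "(\<integral>\<omega>. f \<omega> \<partial>M) $ i = (\<integral>\<omega>. f \<omega> $ i \<partial>M)" "(\<integral>\<omega>. f \<omega> $ i \<partial>M) \<in> {0..B}"
proof -
  have "AE \<omega> in M. norm (f \<omega>) \<le> real CARD('k) * B"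
  proof (rule AE_mp[OF b], rule AE_I2, rule impI)
    fix \<omega> assume "\<forall>i. f \<omega> $ i \<in> {0..B}"
    then have "(\<Sum>i\<in>UNIV. \<bar>f \<omega> $ i\<bar>) \<le> real CARD('k) * B"
      using sum_bounded_above[of UNIV "\<lambda>i. \<bar>f \<omega> $ i\<bar>" B] by simp
    then show "norm (f \<omega>) \<le> real CARD('k) * B" using norm_le_l1_cart[of "f \<omega>"] by linarith
  qed
  then have int: "integrable M f" using f by (rule integrable_const_bound)
  show "(\<integral>\<omega>. f \<omega> \<partial>M) $ i = (\<integral>\<omega>. f \<omega> $ i \<partial>M)"
    using integral_bounded_linear[OF bounded_linear_vec_nth int, of i] by simp
  have int_i: "integrable M (\<lambda>\<omega>. f \<omega> $ i)"
    by (rule integrable_bounded_linear[OF bounded_linear_vec_nth int])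
  have "(\<integral>\<omega>. f \<omega> $ i \<partial>M) \<le> (\<integral>\<omega>. B \<partial>M)"
    using b by (intro integral_mono_AE int_i) auto
  moreover have "0 \<le> (\<integral>\<omega>. f \<omega> $ i \<partial>M)"
    using b by (intro integral_nonneg_AE) auto
  ultimately show "(\<integral>\<omega>. f \<omega> $ i \<partial>M) \<in> {0..B}" by (simp add: prob_space)
qed

context queueing_system
begin

lemma A_measurable: "1 \<le> t \<Longrightarrow> A t \<in> borel_measurable P"
  and S_measurable: "1 \<le> t \<Longrightarrow> S t \<in> borel_measurable P"
  and a_measurable: "1 \<le> t \<Longrightarrow> a t \<in> measurable P (count_space UNIV)"
  using measurable_from_subalg[OF F_subalgebra A_adapted] measurable_from_subalg[OF F_subalgebra S_adapted]
    measurable_from_subalg[OF F_subalgebra a_adapted] by auto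

lemma A_bounded:
  assumes "1 \<le> t"
  shows "AE \<omega> in P. \<forall>i. A t \<omega> $ i \<in> {0..M}"
  by (rule AE_distrD[OF A_measurable[OF assms]], unfold A_law[OF assms]) (rule LA_bounded[OF assms])

lemma S_bounded:
  assumes "1 \<le> t"
  shows "AE \<omega> in P. \<forall>i. S t \<omega> $ i \<in> {0..M}"
  by (rule AE_distrD[OF S_measurable[OF assms]], unfold S_law[OF assms]) (rule LS_bounded[OF assms])

lemma mean_distr:
  assumes "f \<in> borel_measurable P" "distr P borel f = D"
  shows "mean D = (\<integral>\<omega>. f \<omega> \<partial>P)"
  unfolding mean_def assms(2)[symmetric] using assms(1) by (subst integral_distr) auto

lemma mean_arrival:
  assumes "1 \<le> t"
  shows "mean (LA t) $ i = (\<integral>\<omega>. A t \<omega> $ i \<partial>P)" "mean (LA t) $ i \<in> {0..M}"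
  using integral_vec_nth_bounded[OF A_measurable[OF assms] A_bounded[OF assms], of i]
    mean_distr[OF A_measurable[OF assms] A_law[OF assms]] by simp_all

lemma mean_service:
  assumes "1 \<le> t"
  shows "mean (LS t) $ i = (\<integral>\<omega>. S t \<omega> $ i \<partial>P)" "mean (LS t) $ i \<in> {0..M}"
  using integral_vec_nth_bounded[OF S_measurable[OF assms] S_bounded[OF assms], of i]
    mean_distr[OF S_measurable[OF assms] S_law[OF assms]] by simp_all

lemma measurable_F_mono:
  assumes "f \<in> measurable (F s) N" "s \<le> t"
  shows "f \<in> measurable (F t) N"
  by (rule measurable_from_subalg[OF _ assms(1)])
    (simp add: subalgebra_def space_F sets_F_mono assms(2))

text \<open>What is known in slot \<open>t + 1\<close> once the queue to be served has been chosen, but before arrivals and services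
  are drawn.\<close>
definition decision_info :: "nat \<Rightarrow> 'w measure" where
  "decision_info t = sigma (space P) (sets (F t) \<union> {a (Suc t) -` I \<inter> space P | I. True})"

lemma decision_info_sets:
  "sets (decision_info t) = sigma_sets (space P) (sets (F t) \<union> {a (Suc t) -` I \<inter> space P | I. True})"
  and space_decision_info: "space (decision_info t) = space P"
  using sets.sets_into_space[of _ "F t"] space_F[of t]
  by (auto simp: decision_info_def intro!: sets_measure_of space_measure_of)

lemma F_decision_info:
  assumes "f \<in> measurable (F t) N"
  shows "f \<in> measurable (decision_info t) N"
proof (rule measurable_from_subalg[OF _ assms])
  show "subalgebra (decision_info t) (F t)"
    unfolding subalgebra_def decision_info_sets space_decision_info by (auto simp: space_F)
qed

lemma a_decision_info: "a (Suc t) \<in> measurable (decision_info t) (count_space UNIV)"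
proof (rule measurableI)
  show "a (Suc t) -` I \<inter> space (decision_info t) \<in> sets (decision_info t)" for I
    unfolding decision_info_sets space_decision_info by auto
qed simp

lemma decision_info_subalgebra: "subalgebra P (decision_info t)"
proof -
  have "sigma_sets (space P) (sets (F t) \<union> {a (Suc t) -` I \<inter> space P | I. True}) \<subseteq> sets P"
  proof (rule sets.sigma_sets_subset)
    show "sets (F t) \<union> {a (Suc t) -` I \<inter> space P | I. True} \<subseteq> sets P"
      using F_subalgebra[of t] measurable_sets[OF a_measurable[of "Suc t"]] by (auto simp: subalgebra_def)
  qed
  then show ?thesis by (simp add: subalgebra_def decision_info_sets space_decision_info)
qed

text \<open>The form of the nonanticipation assumption that is used: a quantity fixed by the past and the current
  choice is uncorrelated with any function of the current arrivals and services.\<close>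
lemma decision_indep:
  fixes g :: "(real ^ 'k) \<times> (real ^ 'k) \<Rightarrow> real" and Z :: "'w \<Rightarrow> real"
  assumes Z: "Z \<in> borel_measurable (decision_info t)" and g: "g \<in> borel_measurable borel"
    and int: "integrable P Z" "integrable P (\<lambda>\<omega>. g (A (Suc t) \<omega>, S (Suc t) \<omega>))"
  shows "(\<integral>\<omega>. Z \<omega> * g (A (Suc t) \<omega>, S (Suc t) \<omega>) \<partial>P) = (\<integral>\<omega>. Z \<omega> \<partial>P) * (\<integral>\<omega>. g (A (Suc t) \<omega>, S (Suc t) \<omega>) \<partial>P)"
    and "integrable P (\<lambda>\<omega>. Z \<omega> * g (A (Suc t) \<omega>, S (Suc t) \<omega>))"
proof -
  define AS where "AS \<omega> = (A (Suc t) \<omega>, S (Suc t) \<omega>)" for \<omega>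
  have AS: "AS \<in> borel_measurable P"
    unfolding AS_def using A_measurable[of "Suc t"] S_measurable[of "Suc t"] by measurable
  have Zm: "Z \<in> borel_measurable P" by (rule measurable_from_subalg[OF decision_info_subalgebra Z])
  have gm: "(\<lambda>\<omega>. g (AS \<omega>)) \<in> borel_measurable P" by (rule measurable_compose[OF AS g])
  have vim: "{AS -` B \<inter> space P | B. B \<in> sets borel} = sets (vimage_algebra (space P) AS borel)"
    by (subst sets_vimage_algebra2) auto
  have ind: "indep_set (sets (decision_info t)) (sets (vimage_algebra (space P) AS borel))"
    using nonanticipating[of "Suc t"] unfolding decision_info_sets vim[symmetric] AS_def by simp
  have "indep_var borel Z borel (\<lambda>\<omega>. g (AS \<omega>))"
    unfolding indep_var_eq
  proof (intro conjI Zm gm)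
    have 1: "sigma_sets (space P) {Z -` B \<inter> space P | B. B \<in> sets borel} \<subseteq> sets (decision_info t)"
      unfolding space_decision_info[of t, symmetric]
      by (rule sets.sigma_sets_subset) (use measurable_sets[OF Z] in auto)
    \<comment> \<open>Functions of the pair generate a smaller sigma-algebra than the pair itself.\<close>
    have "(\<lambda>\<omega>. g (AS \<omega>)) -` B \<inter> space P \<in> sets (vimage_algebra (space P) AS borel)" if "B \<in> sets borel" for B
    proof -
      have "(\<lambda>\<omega>. g (AS \<omega>)) -` B \<inter> space P = AS -` (g -` B) \<inter> space P" by auto
      moreover have "g -` B \<in> sets borel" using measurable_sets[OF g that] by simp
      ultimately show ?thesis unfolding vim[symmetric] by blast
    qed
    then have 2: "sigma_sets (space P) {(\<lambda>\<omega>. g (AS \<omega>)) -` B \<inter> space P | B. B \<in> sets borel}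
        \<subseteq> sets (vimage_algebra (space P) AS borel)"
      using sets.sigma_sets_subset[of "{(\<lambda>\<omega>. g (AS \<omega>)) -` B \<inter> space P | B. B \<in> sets borel}" "vimage_algebra (space P) AS borel"]
      by auto
    show "indep_set (sigma_sets (space P) {Z -` B \<inter> space P | B. B \<in> sets borel})
        (sigma_sets (space P) {(\<lambda>\<omega>. g (AS \<omega>)) -` B \<inter> space P | B. B \<in> sets borel})"
      using ind 1 2 unfolding indep_sets2_eq by blast
  qed
  from indep_var_lebesgue_integral[OF this int(1)] indep_var_integrable[OF this int(1)] int(2)
  show "(\<integral>\<omega>. Z \<omega> * g (A (Suc t) \<omega>, S (Suc t) \<omega>) \<partial>P) = (\<integral>\<omega>. Z \<omega> \<partial>P) * (\<integral>\<omega>. g (A (Suc t) \<omega>, S (Suc t) \<omega>) \<partial>P)"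
    "integrable P (\<lambda>\<omega>. Z \<omega> * g (A (Suc t) \<omega>, S (Suc t) \<omega>))"
    by (simp_all add: AS_def)
qed

end

section \<open>Epochs on a sample path\<close>

lemma prob_simplex_average_le:
  assumes "w \<in> prob_simplex" "\<And>i. c i \<le> (B::real)"
  shows "(\<Sum>i\<in>UNIV. w $ i * c i) \<le> B"
proof -
  have "(\<Sum>i\<in>UNIV. w $ i * c i) \<le> (\<Sum>i\<in>UNIV. w $ i * B)"
    using assms by (intro sum_mono mult_left_mono) (auto simp: prob_simplex_def)
  also have "\<dots> = B" using assms by (simp add: sum_distrib_right[symmetric] prob_simplex_def)
  finally show ?thesis .
qed

lemma prob_simplex_average_nonneg:
  assumes "w \<in> prob_simplex" "\<And>i. 0 \<le> (c i::real)"
  shows "0 \<le> (\<Sum>i\<in>UNIV. w $ i * c i)"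
  using assms by (intro sum_nonneg mult_nonneg_nonneg) (auto simp: prob_simplex_def)

lemma infnorm_attained:
  fixes v :: "real ^ 'k"
  obtains i where "infnorm v = \<bar>v $ i\<bar>"
proof -
  have "infnorm v = Max ((\<lambda>i. \<bar>v $ i\<bar>) ` UNIV)"
    unfolding infnorm_cart by (subst cSup_eq_Max) (auto simp: full_SetCompr_eq)
  moreover have "Max ((\<lambda>i. \<bar>v $ i\<bar>) ` UNIV) \<in> (\<lambda>i. \<bar>v $ i\<bar>) ` UNIV" by (intro Max_in) auto
  ultimately obtain i where "infnorm v = \<bar>v $ i\<bar>" by (metis imageE)
  then show ?thesis by (rule that)
qed

text \<open>The start of the epoch that serves slot \<open>t + 1\<close>, by recursion over slots instead of epochs. Along a random
  path this makes it, and hence the epoch length, measurable with respect to the information before slot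
  \<open>t + 1\<close>.\<close>
primrec epoch_of :: "real \<Rightarrow> (nat \<Rightarrow> real ^ 'k) \<Rightarrow> nat \<Rightarrow> nat" where
  "epoch_of M q 0 = 0"
| "epoch_of M q (Suc t) =
     (if Suc t = epoch_of M q t + epoch_len M (q (epoch_of M q t)) then Suc t else epoch_of M q t)"

lemma epoch_len_pos: "0 < epoch_len M v"
  by (simp add: epoch_len_def)

lemma epoch_of_within_epoch:
  "j < epoch_len M (q (epoch_start M q n)) \<Longrightarrow> epoch_of M q (epoch_start M q n + j) = epoch_start M q n"
proof (induction n arbitrary: j)
  case 0
  then show ?case by (induction j) auto
next
  case (Suc n)
  define s where "s = epoch_start M q n"
  define m where "m = epoch_len M (q s)"
  have s': "epoch_start M q (Suc n) = Suc (s + (m - 1))"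
    using epoch_len_pos[of M "q s"] by (simp add: s_def m_def)
  have 0: "epoch_of M q (epoch_start M q (Suc n)) = epoch_start M q (Suc n)"
  proof -
    have m: "0 < m" using epoch_len_pos by (simp add: m_def)
    then have "epoch_of M q (s + (m - 1)) = s" using Suc.IH[of "m - 1"] by (simp add: s_def m_def)
    then show ?thesis using m unfolding s' epoch_of.simps by (simp add: m_def[symmetric])
  qed
  show ?case using Suc.prems 0 by (induction j) auto
qed

lemma obtain_epoch:
  obtains n j where "t = epoch_start M q n + j" "j < epoch_len M (q (epoch_start M q n))"
proof -
  have "\<exists>n j. t = epoch_start M q n + j \<and> j < epoch_len M (q (epoch_start M q n))"
  proof (induction t)
    case 0
    show ?case by (intro exI[of _ 0]) (simp add: epoch_len_pos)
  next
    case (Suc t)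
    then obtain n j where nj: "t = epoch_start M q n + j" "j < epoch_len M (q (epoch_start M q n))" by blast
    show ?case
    proof (cases "Suc j < epoch_len M (q (epoch_start M q n))")
      case True
      then show ?thesis using nj by (intro exI[of _ n] exI[of _ "Suc j"]) simp
    next
      case False
      then have "Suc j = epoch_len M (q (epoch_start M q n))" using nj by simp
      then have "Suc t = epoch_start M q (Suc n) + 0" using nj by simp
      then show ?thesis using epoch_len_pos by blast
    qed
  qed
  then show ?thesis using that by blast
qed

lemma epoch_of_le: "epoch_of M q t \<le> t"
  by (induction t) auto

lemma epoch_len_bounds:
  assumes "0 < M"
  shows "infnorm v \<le> 2 * M * real (epoch_len M v)"
    "2 \<le> epoch_len M v \<Longrightarrow> 2 * M * (real (epoch_len M v) - 1) < infnorm v"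
proof -
  have "infnorm v / (2 * M) \<le> real (epoch_len M v)"
    unfolding epoch_len_def by linarith
  then show "infnorm v \<le> 2 * M * real (epoch_len M v)" using assms by (simp add: field_simps)
  assume "2 \<le> epoch_len M v"
  then have "real (epoch_len M v) - 1 < infnorm v / (2 * M)"
    unfolding epoch_len_def by linarith
  then show "2 * M * (real (epoch_len M v) - 1) < infnorm v" using assms by (simp add: field_simps)
qed

context ssmw_run
begin

abbreviation Q :: "nat \<Rightarrow> 'w \<Rightarrow> real ^ 'k" where "Q \<equiv> queue_proc A S a"

text \<open>The almost sure event on which all path inequalities are proved.\<close>
definition bounded_inputs :: "'w \<Rightarrow> bool" where
  "bounded_inputs \<omega> \<longleftrightarrow> \<omega> \<in> space P \<and> (\<forall>t i. A (Suc t) \<omega> $ i \<in> {0..M} \<and> S (Suc t) \<omega> $ i \<in> {0..M})"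

text \<open>From here on the index \<open>t\<close> refers to slot \<open>t + 1\<close>: the following quantities belong to that slot and are
  determined by what happened up to the end of slot \<open>t\<close>, except \<open>gain_est\<close>, the importance-weighted estimate
  computed in slot \<open>t + 1\<close>. They are, in the notation of EXP3.S+, the epoch length \<open>m\<close>, \<open>\<eta>\<close>, \<open>\<beta>\<close>, \<open>\<gamma>\<close> and the
  nonzero entry of the gain estimate.\<close>
definition cur_len :: "nat \<Rightarrow> 'w \<Rightarrow> nat" where
  "cur_len t \<omega> = epoch_len M (Q (epoch_of M (\<lambda>s. Q s \<omega>) t) \<omega>)"

definition lrate :: "nat \<Rightarrow> 'w \<Rightarrow> real" where
  "lrate t \<omega> = 1 / (6 * M\<^sup>2 * real CARD('k) * real (cur_len t \<omega>) powr (1 + \<delta> / 2))"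

definition floor_prob :: "nat \<Rightarrow> 'w \<Rightarrow> real" where
  "floor_prob t \<omega> = 1 / (real (cur_len t \<omega>))\<^sup>2 / real CARD('k)"

definition explore :: "nat \<Rightarrow> 'w \<Rightarrow> real" where
  "explore t \<omega> = M * lrate t \<omega> * norm1 (Q t \<omega>)"

definition gain_est :: "nat \<Rightarrow> 'w \<Rightarrow> real" where
  "gain_est t \<omega> = Q t \<omega> $ a (Suc t) \<omega> * S (Suc t) \<omega> $ a (Suc t) \<omega> / p (Suc t) \<omega> $ a (Suc t) \<omega>"

lemma card_ge_1: "1 \<le> real CARD('k)"
proof -
  have "0 < CARD('k)" by simp
  then show ?thesis by linarith
qed

lemma cur_len_pos: "1 \<le> cur_len t \<omega>"
  using epoch_len_pos unfolding cur_len_def by (metis Suc_leI One_nat_def)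

lemma lrate_pos: "0 < lrate t \<omega>"
  using cur_len_pos[of t \<omega>] M_pos card_ge_1 by (simp add: lrate_def)

lemma floor_prob_pos: "0 < floor_prob t \<omega>"
  using cur_len_pos[of t \<omega>] card_ge_1 by (simp add: floor_prob_def)

lemma Q_0: "Q 0 \<omega> = 0"
  by (simp add: queue_proc_def)

lemma Q_Suc: "Q (Suc t) \<omega> $ i
    = max (Q t \<omega> $ i + A (Suc t) \<omega> $ i - S (Suc t) \<omega> $ i * of_bool (i = a (Suc t) \<omega>)) 0"
  by (simp add: queue_proc_def)

lemma Q_nonneg: "0 \<le> Q t \<omega> $ i"
  by (cases t) (simp_all add: Q_0 Q_Suc)

lemma norm1_Q: "norm1 (Q t \<omega>) = (\<Sum>i\<in>UNIV. Q t \<omega> $ i)"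
  by (simp add: norm1_def Q_nonneg)

lemma Q_le_norm1: "Q t \<omega> $ i \<le> norm1 (Q t \<omega>)"
  unfolding norm1_Q by (rule member_le_sum) (auto simp: Q_nonneg)

lemma cur_len_in_epoch:
  assumes "j < epoch_len M (Q (epoch_start M (\<lambda>s. Q s \<omega>) n) \<omega>)"
  shows "cur_len (epoch_start M (\<lambda>s. Q s \<omega>) n + j) \<omega> = epoch_len M (Q (epoch_start M (\<lambda>s. Q s \<omega>) n) \<omega>)"
  using epoch_of_within_epoch[where q = "\<lambda>s. Q s \<omega>"] assms by (simp add: cur_len_def)

lemma Q_step: "bounded_inputs \<omega> \<Longrightarrow> \<bar>Q (Suc t) \<omega> $ i - Q t \<omega> $ i\<bar> \<le> M"
  unfolding Q_Suc bounded_inputs_def using Q_nonneg[of t \<omega> i] by (auto simp: max_def) (smt (verit) atLeastAtMost_iff)+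

lemma Q_near: "bounded_inputs \<omega> \<Longrightarrow> \<bar>Q (t + j) \<omega> $ i - Q t \<omega> $ i\<bar> \<le> M * real j"
proof (induction j)
  case (Suc j)
  then show ?case using Q_step[of \<omega> "t + j" i] by (simp add: algebra_simps)
qed simp

lemma Q_le: "bounded_inputs \<omega> \<Longrightarrow> Q t \<omega> $ i \<le> M * real t"
  using Q_near[of \<omega> 0 t i] by (simp add: Q_0)

text \<open>Queues grow by at most \<open>M\<close> per slot, so epochs cannot be long early on. This makes all coefficients of a
  fixed slot bounded, hence integrable.\<close>
lemma cur_len_le:
  assumes "bounded_inputs \<omega>"
  shows "cur_len t \<omega> \<le> t + 1"
proof -
  define s where "s = epoch_of M (\<lambda>s. Q s \<omega>) t"
  have s: "s \<le> t" unfolding s_def by (rule epoch_of_le)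
  obtain i where "infnorm (Q s \<omega>) = \<bar>Q s \<omega> $ i\<bar>" by (rule infnorm_attained)
  then have "infnorm (Q s \<omega>) \<le> M * real s" using Q_le[OF assms, of s i] Q_nonneg[of s \<omega> i] by simp
  also have "\<dots> \<le> M * real s * 2" using M_pos by simp
  finally have "infnorm (Q s \<omega>) / (2 * M) \<le> real s" using M_pos by (simp add: field_simps)
  then have "\<lceil>infnorm (Q s \<omega>) / (2 * M)\<rceil> \<le> int s" by linarith
  then have "epoch_len M (Q s \<omega>) \<le> max s 1" unfolding epoch_len_def by linarith
  then show ?thesis using s by (simp add: cur_len_def s_def)
qed

lemma Q_le_cur_len:
  assumes "bounded_inputs \<omega>"
  shows "Q t \<omega> $ i \<le> 3 * M * real (cur_len t \<omega>)"
proof -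
  obtain n j where nj: "t = epoch_start M (\<lambda>s. Q s \<omega>) n + j"
    "j < epoch_len M (Q (epoch_start M (\<lambda>s. Q s \<omega>) n) \<omega>)" by (rule obtain_epoch)
  define s where "s = epoch_start M (\<lambda>s. Q s \<omega>) n"
  have m: "cur_len t \<omega> = epoch_len M (Q s \<omega>)" using cur_len_in_epoch nj by (simp add: s_def)
  have "Q t \<omega> $ i \<le> Q s \<omega> $ i + M * real j"
    using Q_near[OF assms, of s j i] by (simp add: nj s_def)
  also have "\<dots> \<le> infnorm (Q s \<omega>) + M * real (cur_len t \<omega>)"
    using component_le_infnorm_cart[of "Q s \<omega>" i] nj(2) m M_pos
    by (intro add_mono) (auto simp: s_def)
  also have "\<dots> \<le> 3 * M * real (cur_len t \<omega>)" using epoch_len_bounds(1)[OF M_pos, of "Q s \<omega>"] m by simp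
  finally show ?thesis .
qed

lemma slot_in_epoch:
  assumes "\<omega> \<in> space P" and j: "j < epoch_len M (Q (epoch_start M (\<lambda>s. Q s \<omega>) n) \<omega>)"
  defines "t \<equiv> epoch_start M (\<lambda>s. Q s \<omega>) n + j"
  shows "x (Suc t) \<omega> \<in> trunc_simplex (floor_prob t \<omega>)" "e (Suc t) \<omega> \<in> prob_simplex"
    "Q t \<omega> \<noteq> 0 \<Longrightarrow> e (Suc t) \<omega> = (1 / norm1 (Q t \<omega>)) *\<^sub>R Q t \<omega>"
    "p (Suc t) \<omega> = (1 - explore t \<omega>) *\<^sub>R x (Suc t) \<omega> + explore t \<omega> *\<^sub>R e (Suc t) \<omega>"
    "Suc j < cur_len t \<omega> \<Longrightarrow> is_arg_min
        (\<lambda>y. - lrate t \<omega> *\<^sub>R axis (a (Suc t) \<omega>) (gain_est t \<omega>) \<bullet> y + bregman neg_entropy y (x (Suc t) \<omega>))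
        (\<lambda>y. y \<in> trunc_simplex (floor_prob t \<omega>)) (x (Suc (Suc t)) \<omega>)"
proof -
  define s where "s = epoch_start M (\<lambda>s. Q s \<omega>) n"
  define m where "m = epoch_len M (Q s \<omega>)"
  have jm: "j < m" using j by (simp add: m_def s_def)
  have t: "t = s + j" by (simp add: t_def s_def)
  have cur_len: "cur_len (s + i) \<omega> = m" if "i < m" for i
    using cur_len_in_epoch that by (simp add: m_def s_def)
  note run = path[OF \<open>\<omega> \<in> space P\<close>, unfolded ssmw_path_def Let_def, rule_format, of n, folded s_def, folded m_def]
  have lr: "lrate (s + i) \<omega> = 1 / (6 * M\<^sup>2 * real CARD('k) * real m powr (1 + \<delta> / 2))"
    and fp: "floor_prob (s + i) \<omega> = 1 / (real m)\<^sup>2 / real CARD('k)" if "i < m" for i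
    using cur_len[OF that] by (simp_all add: lrate_def floor_prob_def)
  have e: "e (s + \<tau>) \<omega> \<in> prob_simplex"
      "Q (s + \<tau> - 1) \<omega> \<noteq> 0 \<Longrightarrow> e (s + \<tau>) \<omega> = (1 / norm1 (Q (s + \<tau> - 1) \<omega>)) *\<^sub>R Q (s + \<tau> - 1) \<omega>"
    if "\<tau> \<in> {1..m}" for \<tau> using run that by blast+
  have pe: "p (s + \<tau>) \<omega> = (1 - M * (1 / (6 * M\<^sup>2 * real CARD('k) * real m powr (1 + \<delta> / 2))) * norm1 (Q (s + \<tau> - 1) \<omega>)) *\<^sub>R x (s + \<tau>) \<omega>
      + (M * (1 / (6 * M\<^sup>2 * real CARD('k) * real m powr (1 + \<delta> / 2))) * norm1 (Q (s + \<tau> - 1) \<omega>)) *\<^sub>R e (s + \<tau>) \<omega>"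
    if "\<tau> \<in> {1..m}" for \<tau> using run that unfolding exp3s_plus_def by blast
  have am: "is_arg_min
      (\<lambda>y. - (1 / (6 * M\<^sup>2 * real CARD('k) * real m powr (1 + \<delta> / 2))) *\<^sub>R
        axis (a (s + \<tau>) \<omega>) (Q (s + \<tau> - 1) \<omega> $ a (s + \<tau>) \<omega> * S (s + \<tau>) \<omega> $ a (s + \<tau>) \<omega> / p (s + \<tau>) \<omega> $ a (s + \<tau>) \<omega>) \<bullet> y
         + bregman neg_entropy y (x (s + \<tau>) \<omega>))
      (\<lambda>y. y \<in> trunc_simplex (1 / (real m)\<^sup>2 / real CARD('k))) (x (s + (\<tau> + 1)) \<omega>)"
    if "\<tau> \<in> {1..<m}" for \<tau> using run that unfolding exp3s_plus_def Let_def by blast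
  have arg: "is_arg_min
        (\<lambda>y. - lrate (s + i) \<omega> *\<^sub>R axis (a (Suc (s + i)) \<omega>) (gain_est (s + i) \<omega>) \<bullet> y + bregman neg_entropy y (x (Suc (s + i)) \<omega>))
        (\<lambda>y. y \<in> trunc_simplex (floor_prob (s + i) \<omega>)) (x (Suc (Suc (s + i))) \<omega>)" if i: "Suc i < m" for i
  proof -
    have "i < m" using i by simp
    then show ?thesis using am[of "Suc i"] i by (simp add: lr fp gain_est_def)
  qed
  show "x (Suc t) \<omega> \<in> trunc_simplex (floor_prob t \<omega>)"
  proof (cases j)
    case 0
    then show ?thesis using conjunct1[OF run] fp[OF jm] by (simp add: t)
  next
    case (Suc i)
    have "i < m" "j < m" using Suc jm by auto
    then show ?thesis using arg[of i] Suc jm fp[of i] fp[of j] by (simp add: t is_arg_min_def)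
  qed
  show "e (Suc t) \<omega> \<in> prob_simplex" using e(1)[of "Suc j"] jm by (simp add: t)
  show "e (Suc t) \<omega> = (1 / norm1 (Q t \<omega>)) *\<^sub>R Q t \<omega>" if "Q t \<omega> \<noteq> 0" using e(2)[of "Suc j"] jm that by (simp add: t)
  show "p (Suc t) \<omega> = (1 - explore t \<omega>) *\<^sub>R x (Suc t) \<omega> + explore t \<omega> *\<^sub>R e (Suc t) \<omega>"
    using pe[of "Suc j"] jm lr[OF jm] by (simp add: t explore_def)
  show "is_arg_min
        (\<lambda>y. - lrate t \<omega> *\<^sub>R axis (a (Suc t) \<omega>) (gain_est t \<omega>) \<bullet> y + bregman neg_entropy y (x (Suc t) \<omega>))
        (\<lambda>y. y \<in> trunc_simplex (floor_prob t \<omega>)) (x (Suc (Suc t)) \<omega>)" if "Suc j < cur_len t \<omega>"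
    using arg[of j] that cur_len[OF jm] by (simp add: t)
qed

lemma slot:
  assumes "\<omega> \<in> space P"
  shows "x (Suc t) \<omega> \<in> trunc_simplex (floor_prob t \<omega>)" "e (Suc t) \<omega> \<in> prob_simplex"
    "Q t \<omega> \<noteq> 0 \<Longrightarrow> e (Suc t) \<omega> = (1 / norm1 (Q t \<omega>)) *\<^sub>R Q t \<omega>"
    "p (Suc t) \<omega> = (1 - explore t \<omega>) *\<^sub>R x (Suc t) \<omega> + explore t \<omega> *\<^sub>R e (Suc t) \<omega>"
proof -
  obtain n j where nj: "t = epoch_start M (\<lambda>s. Q s \<omega>) n + j"
    "j < epoch_len M (Q (epoch_start M (\<lambda>s. Q s \<omega>) n) \<omega>)" by (rule obtain_epoch)
  show "x (Suc t) \<omega> \<in> trunc_simplex (floor_prob t \<omega>)" "e (Suc t) \<omega> \<in> prob_simplex"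
    "Q t \<omega> \<noteq> 0 \<Longrightarrow> e (Suc t) \<omega> = (1 / norm1 (Q t \<omega>)) *\<^sub>R Q t \<omega>"
    "p (Suc t) \<omega> = (1 - explore t \<omega>) *\<^sub>R x (Suc t) \<omega> + explore t \<omega> *\<^sub>R e (Suc t) \<omega>"
    unfolding nj(1) by (fact slot_in_epoch[OF assms nj(2)])+
qed

end

section \<open>Regret within epochs and its payment by queue lengths\<close>

text \<open>\<open>N\<close> stands for \<open>m0\<close>; only its two defining properties matter.\<close>
locale ssmw_analysis = ssmw_run P F M LA LS A S a \<delta> x e p
  for P :: "'w measure" and F M and LA LS :: "nat \<Rightarrow> (real ^ 'k) measure" and A S a \<delta> x e p +
  fixes \<theta> :: "nat \<Rightarrow> real ^ 'k" and C\<^sub>V \<epsilon> :: real and N :: nat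
  assumes ref_simplex: "\<And>t. 1 \<le> t \<Longrightarrow> \<theta> t \<in> prob_simplex"
    and ref_stationary: "reference_stationary \<delta> C\<^sub>V \<theta>"
    and delta_le_1: "\<delta> \<le> 1"
    and eps_pos: "0 < \<epsilon>"
    and threshold_ge_2: "2 \<le> N"
    and threshold: "\<And>m. N \<le> m \<Longrightarrow> f_SSMW CARD('k) M C\<^sub>V \<delta> m \<le> \<epsilon> / 2"
begin

lemma delta_pos: "0 < \<delta>" and C\<^sub>V_pos: "0 < C\<^sub>V"
  using ref_stationary by (auto simp: reference_stationary_def)

text \<open>The reference policy pushed into the truncated simplex, where the mirror descent bound applies.\<close>
definition comparator :: "nat \<Rightarrow> 'w \<Rightarrow> real ^ 'k" where
  "comparator t \<omega> = (\<chi> i. (1 - 1 / (real (cur_len t \<omega>))\<^sup>2) * \<theta> (Suc t) $ i + floor_prob t \<omega>)"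

definition gain :: "nat \<Rightarrow> 'w \<Rightarrow> real ^ 'k" where
  "gain t \<omega> = (\<chi> i. Q t \<omega> $ i * mean (LS (Suc t)) $ i)"

definition est_regret :: "nat \<Rightarrow> 'w \<Rightarrow> real" where
  "est_regret t \<omega> = axis (a (Suc t) \<omega>) (gain_est t \<omega>) \<bullet> (comparator t \<omega> - x (Suc t) \<omega>)
     - lrate t \<omega> * (gain_est t \<omega>)\<^sup>2 * x (Suc t) \<omega> $ a (Suc t) \<omega>"

text \<open>The costs of a slot other than mirror descent on the estimates: the expected second-order term (bounded
  using \<open>x \<le> 2 p\<close>), the truncation of the reference policy, and forced exploration.\<close>
definition overhead :: "nat \<Rightarrow> 'w \<Rightarrow> real" where
  "overhead t \<omega> = 2 * lrate t \<omega> * M\<^sup>2 * (\<Sum>i\<in>UNIV. (Q t \<omega> $ i)\<^sup>2)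
     + gain t \<omega> \<bullet> (\<theta> (Suc t) - comparator t \<omega>) + explore t \<omega> * (gain t \<omega> \<bullet> (x (Suc t) \<omega> - e (Suc t) \<omega>))"

text \<open>A bound on the regret \<open>\<langle>gain, \<theta> - p\<rangle>\<close> of slot \<open>t + 1\<close>, up to noise of mean zero (see \<open>charge_ge\<close>). In short
  epochs the learning rate gives no useful bound, and the regret itself is used.\<close>
definition charge :: "nat \<Rightarrow> 'w \<Rightarrow> real" where
  "charge t \<omega> = (if N \<le> cur_len t \<omega> then est_regret t \<omega> + overhead t \<omega>
     else gain t \<omega> \<bullet> (\<theta> (Suc t) - p (Suc t) \<omega>))"

lemma card_mult_floor_prob: "real CARD('k) * floor_prob t \<omega> = 1 / (real (cur_len t \<omega>))\<^sup>2"
  using card_ge_1 by (simp add: floor_prob_def)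

lemma comparator_mem: "comparator t \<omega> \<in> trunc_simplex (floor_prob t \<omega>)"
proof -
  have "1 / (real (cur_len t \<omega>))\<^sup>2 \<le> 1" using cur_len_pos[of t \<omega>] by simp
  then have "0 \<le> (1 - 1 / (real (cur_len t \<omega>))\<^sup>2) * \<theta> (Suc t) $ i" for i
    using ref_simplex[of "Suc t"] by (simp add: prob_simplex_def)
  moreover have "(\<Sum>i\<in>UNIV. comparator t \<omega> $ i) = 1"
    using ref_simplex[of "Suc t"] card_mult_floor_prob[of t \<omega>]
    by (simp add: comparator_def sum.distrib sum_distrib_left[symmetric] prob_simplex_def)
  ultimately show ?thesis
    using floor_prob_pos[of t \<omega>] by (auto simp: trunc_simplex_def prob_simplex_def comparator_def intro: add_nonneg_nonneg)
qed

text \<open>The queues of an epoch are at most \<open>3 M m\<close>, which is what the constant 6 in the learning rate is made for.\<close>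
lemma explore_bounds:
  assumes "bounded_inputs \<omega>"
  shows "0 \<le> explore t \<omega>" "explore t \<omega> \<le> 1 / 2"
proof -
  define m where "m = real (cur_len t \<omega>)"
  have m: "1 \<le> m" using cur_len_pos[of t \<omega>] by (simp add: m_def)
  have n: "norm1 (Q t \<omega>) \<le> real CARD('k) * (3 * M * m)"
    unfolding norm1_Q using sum_bounded_above[of UNIV "\<lambda>i. Q t \<omega> $ i" "3 * M * m"] Q_le_cur_len[OF assms] by (simp add: m_def)
  show "0 \<le> explore t \<omega>"
    using M_pos lrate_pos[of t \<omega>] by (simp add: explore_def norm1_def sum_nonneg)
  have "explore t \<omega> \<le> M * lrate t \<omega> * (real CARD('k) * (3 * M * m))"
    unfolding explore_def using n M_pos lrate_pos[of t \<omega>] by (intro mult_left_mono) auto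
  also have "\<dots> = m / (2 * m powr (1 + \<delta> / 2))"
    using M_pos card_ge_1 m by (simp add: lrate_def m_def[symmetric] field_simps power2_eq_square)
  also have "\<dots> \<le> 1 / 2"
  proof -
    have "m powr 1 \<le> m powr (1 + \<delta> / 2)" using m delta_pos by (intro powr_mono) auto
    then show ?thesis using m by (simp add: field_simps)
  qed
  finally show "explore t \<omega> \<le> 1 / 2" .
qed

lemma p_bounds:
  assumes "bounded_inputs \<omega>"
  shows "p (Suc t) \<omega> \<in> prob_simplex" "x (Suc t) \<omega> $ i \<le> 2 * p (Suc t) \<omega> $ i" "0 < p (Suc t) \<omega> $ i"
    "M * lrate t \<omega> * Q t \<omega> $ i \<le> p (Suc t) \<omega> $ i"
proof -
  have sp: "\<omega> \<in> space P" using assms by (simp add: bounded_inputs_def)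
  note \<gamma> = explore_bounds[OF assms, of t]
  have x: "0 < x (Suc t) \<omega> $ i" "(\<Sum>i\<in>UNIV. x (Suc t) \<omega> $ i) = 1" for i
    using trunc_simplexD[OF slot(1)[OF sp, of t]] floor_prob_pos[of t \<omega>] by (auto intro: less_le_trans)
  have e: "0 \<le> e (Suc t) \<omega> $ i" "(\<Sum>i\<in>UNIV. e (Suc t) \<omega> $ i) = 1" for i
    using slot(2)[OF sp, of t] by (auto simp: prob_simplex_def)
  have p: "p (Suc t) \<omega> $ i = (1 - explore t \<omega>) * x (Suc t) \<omega> $ i + explore t \<omega> * e (Suc t) \<omega> $ i" for i
    by (simp add: slot(4)[OF sp])
  have half: "1 / 2 * x (Suc t) \<omega> $ i \<le> (1 - explore t \<omega>) * x (Suc t) \<omega> $ i" for i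
    using \<gamma> x(1)[of i] by (intro mult_right_mono) auto
  have \<gamma>e: "0 \<le> explore t \<omega> * e (Suc t) \<omega> $ i" for i using \<gamma> e by simp
  show 2: "x (Suc t) \<omega> $ i \<le> 2 * p (Suc t) \<omega> $ i" for i
    using half[of i] \<gamma>e[of i] by (simp add: p)
  show 3: "0 < p (Suc t) \<omega> $ i" for i using 2[of i] x(1)[of i] by simp
  show "p (Suc t) \<omega> \<in> prob_simplex"
    using 3 x(2) e(2) by (auto simp: prob_simplex_def less_imp_le) (simp add: p sum.distrib sum_distrib_left[symmetric])
  have "M * lrate t \<omega> * Q t \<omega> $ i \<le> explore t \<omega> * e (Suc t) \<omega> $ i"
  proof (cases "Q t \<omega> = 0")
    case False
    then obtain j where "Q t \<omega> $ j \<noteq> 0" by (auto simp: vec_eq_iff)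
    then have "0 < norm1 (Q t \<omega>)" using Q_nonneg[of t \<omega> j] Q_le_norm1[of t \<omega> j] by simp
    then show ?thesis using slot(3)[OF sp False] by (simp add: explore_def)
  qed (use \<gamma>e in simp)
  then show "M * lrate t \<omega> * Q t \<omega> $ i \<le> p (Suc t) \<omega> $ i"
    using half[of i] x(1)[of i] unfolding p by linarith
qed

text \<open>Exploration proportional to the queue lengths gives \<open>p\<^sub>i \<ge> M \<eta> Q\<^sub>i\<close>, which is exactly what keeps
  \<open>\<eta>\<close> times the estimate \<open>Q\<^sub>i S\<^sub>i / p\<^sub>i\<close> at most 1.\<close>
lemma gain_est_bounds:
  assumes "bounded_inputs \<omega>"
  shows "0 \<le> lrate t \<omega> * gain_est t \<omega>" "lrate t \<omega> * gain_est t \<omega> \<le> 1"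
proof -
  define i where "i = a (Suc t) \<omega>"
  have S: "0 \<le> S (Suc t) \<omega> $ i" "S (Suc t) \<omega> $ i \<le> M" using assms by (auto simp: bounded_inputs_def)
  have pp: "0 < p (Suc t) \<omega> $ i" by (rule p_bounds[OF assms])
  show "0 \<le> lrate t \<omega> * gain_est t \<omega>"
    using S pp lrate_pos[of t \<omega>] Q_nonneg[of t \<omega> i] by (simp add: gain_est_def i_def)
  have "lrate t \<omega> * Q t \<omega> $ i * S (Suc t) \<omega> $ i \<le> lrate t \<omega> * Q t \<omega> $ i * M"
    using S lrate_pos[of t \<omega>] Q_nonneg[of t \<omega> i] by (intro mult_left_mono) auto
  also have "\<dots> \<le> p (Suc t) \<omega> $ i" using p_bounds(4)[OF assms, of t i] by (simp add: mult_ac)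
  finally show "lrate t \<omega> * gain_est t \<omega> \<le> 1"
    using pp by (simp add: gain_est_def i_def)
qed

lemma gain_bounds:
  assumes "bounded_inputs \<omega>"
  shows "0 \<le> gain t \<omega> $ i" "gain t \<omega> $ i \<le> 3 * M\<^sup>2 * real (cur_len t \<omega>)"
proof -
  have \<sigma>: "0 \<le> mean (LS (Suc t)) $ i" "mean (LS (Suc t)) $ i \<le> M" using mean_service[of "Suc t" i] by auto
  show "0 \<le> gain t \<omega> $ i" using \<sigma> Q_nonneg[of t \<omega> i] by (simp add: gain_def)
  have "gain t \<omega> $ i \<le> (3 * M * real (cur_len t \<omega>)) * M"
    unfolding gain_def vec_lambda_beta
    using \<sigma> Q_nonneg[of t \<omega> i] Q_le_cur_len[OF assms, of t i] M_pos by (intro mult_mono) auto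
  then show "gain t \<omega> $ i \<le> 3 * M\<^sup>2 * real (cur_len t \<omega>)" by (simp add: power2_eq_square mult_ac)
qed

lemma gain_average_bounds:
  assumes "bounded_inputs \<omega>" "w \<in> prob_simplex"
  shows "0 \<le> gain t \<omega> \<bullet> w" "gain t \<omega> \<bullet> w \<le> 3 * M\<^sup>2 * real (cur_len t \<omega>)"
proof -
  have *: "gain t \<omega> \<bullet> w = (\<Sum>i\<in>UNIV. w $ i * gain t \<omega> $ i)"
    by (simp add: inner_vec_def mult.commute)
  show "0 \<le> gain t \<omega> \<bullet> w" unfolding * using assms gain_bounds by (intro prob_simplex_average_nonneg)
  show "gain t \<omega> \<bullet> w \<le> 3 * M\<^sup>2 * real (cur_len t \<omega>)"
    unfolding * using assms gain_bounds by (intro prob_simplex_average_le)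
qed

text \<open>Each of the three parts is at most a multiple of \<open>M\<^sup>2 m powr (1 - \<delta> / 2)\<close>, because
  \<open>6 M\<^sup>2 K \<eta> m\<^sup>2 = m powr (1 - \<delta> / 2)\<close>.\<close>
lemma overhead_le:
  assumes b: "bounded_inputs \<omega>"
  shows "overhead t \<omega> \<le> 15 / 2 * M\<^sup>2 * real (cur_len t \<omega>) powr (1 - \<delta> / 2)"
proof -
  define m where "m = real (cur_len t \<omega>)"
  define R where "R = m powr (1 - \<delta> / 2)"
  have m: "1 \<le> m" using cur_len_pos[of t \<omega>] by (simp add: m_def)
  have sp: "\<omega> \<in> space P" using b by (simp add: bounded_inputs_def)
  have R1: "1 \<le> R" unfolding R_def using m delta_le_1 delta_pos by (intro ge_one_powr_ge_zero) auto
  have "m powr (1 + \<delta> / 2) * R = m\<^sup>2" using m by (simp add: R_def powr_add[symmetric])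
  then have \<eta>: "6 * M\<^sup>2 * real CARD('k) * (m\<^sup>2 * lrate t \<omega>) = R"
    using M_pos card_ge_1 m by (simp add: lrate_def m_def[symmetric] field_simps)
  have Qm: "Q t \<omega> $ i \<le> 3 * M * m" for i using Q_le_cur_len[OF b] by (simp add: m_def)
  have "(Q t \<omega> $ i)\<^sup>2 \<le> (3 * M * m)\<^sup>2" for i using Qm Q_nonneg by (intro power_mono) auto
  then have "(\<Sum>i\<in>UNIV. (Q t \<omega> $ i)\<^sup>2) \<le> real CARD('k) * (3 * M * m)\<^sup>2"
    using sum_bounded_above[of UNIV "\<lambda>i. (Q t \<omega> $ i)\<^sup>2" "(3 * M * m)\<^sup>2"] by simp
  then have "2 * lrate t \<omega> * M\<^sup>2 * (\<Sum>i\<in>UNIV. (Q t \<omega> $ i)\<^sup>2) \<le> 2 * lrate t \<omega> * M\<^sup>2 * (real CARD('k) * (3 * M * m)\<^sup>2)"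
    using lrate_pos[of t \<omega>] by (intro mult_left_mono) auto
  also have "\<dots> = 3 * M\<^sup>2 * (6 * M\<^sup>2 * real CARD('k) * (m\<^sup>2 * lrate t \<omega>))" by (simp add: power2_eq_square)
  finally have 1: "2 * lrate t \<omega> * M\<^sup>2 * (\<Sum>i\<in>UNIV. (Q t \<omega> $ i)\<^sup>2) \<le> 3 * M\<^sup>2 * R" unfolding \<eta> .
  have 2: "gain t \<omega> \<bullet> (\<theta> (Suc t) - comparator t \<omega>) \<le> 3 * M\<^sup>2 * R"
  proof -
    have "gain t \<omega> $ i * (\<theta> (Suc t) $ i - comparator t \<omega> $ i) \<le> 1 / m\<^sup>2 * (\<theta> (Suc t) $ i * gain t \<omega> $ i)" for i
      using gain_bounds(1)[OF b, of t i] floor_prob_pos[of t \<omega>]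
      by (simp add: comparator_def m_def[symmetric] algebra_simps)
    then have "gain t \<omega> \<bullet> (\<theta> (Suc t) - comparator t \<omega>) \<le> (\<Sum>i\<in>UNIV. 1 / m\<^sup>2 * (\<theta> (Suc t) $ i * gain t \<omega> $ i))"
      unfolding inner_vec_def by (intro sum_mono) simp
    also have "\<dots> = 1 / m\<^sup>2 * (gain t \<omega> \<bullet> \<theta> (Suc t))" by (simp add: sum_distrib_left inner_vec_def mult_ac)
    also have "\<dots> \<le> 1 / m\<^sup>2 * (3 * M\<^sup>2 * m)"
      using gain_average_bounds(2)[OF b ref_simplex, of "Suc t" t] by (intro mult_left_mono) (auto simp: m_def)
    also have "\<dots> = 3 * M\<^sup>2 * (1 / m)" using m by (simp add: power2_eq_square)
    also have "\<dots> \<le> 3 * M\<^sup>2 * R"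
    proof -
      have "1 / m \<le> R" using m R1 by (simp add: field_simps mult_ge1_I)
      then show ?thesis by (intro mult_left_mono) auto
    qed
    finally show ?thesis .
  qed
  have 3: "explore t \<omega> * (gain t \<omega> \<bullet> (x (Suc t) \<omega> - e (Suc t) \<omega>)) \<le> 3 / 2 * M\<^sup>2 * R"
  proof -
    have x: "x (Suc t) \<omega> \<in> prob_simplex" using slot(1)[OF sp, of t] by (simp add: trunc_simplex_def)
    have "gain t \<omega> \<bullet> (x (Suc t) \<omega> - e (Suc t) \<omega>) \<le> 3 * M\<^sup>2 * m"
      using gain_average_bounds(2)[OF b x, of t] gain_average_bounds(1)[OF b slot(2)[OF sp, of t], of t]
      by (simp add: inner_diff_right m_def)
    then have "explore t \<omega> * (gain t \<omega> \<bullet> (x (Suc t) \<omega> - e (Suc t) \<omega>)) \<le> explore t \<omega> * (3 * M\<^sup>2 * m)"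
      using explore_bounds[OF b] by (intro mult_left_mono) auto
    also have "\<dots> \<le> (M * lrate t \<omega> * (real CARD('k) * (3 * M * m))) * (3 * M\<^sup>2 * m)"
    proof (rule mult_right_mono)
      have "norm1 (Q t \<omega>) \<le> real CARD('k) * (3 * M * m)"
        unfolding norm1_Q using sum_bounded_above[of UNIV "\<lambda>i. Q t \<omega> $ i" "3 * M * m"] Qm by simp
      then show "explore t \<omega> \<le> M * lrate t \<omega> * (real CARD('k) * (3 * M * m))"
        unfolding explore_def using M_pos lrate_pos[of t \<omega>] by (intro mult_left_mono) auto
    qed (use m in simp)
    also have "\<dots> = 3 / 2 * M\<^sup>2 * (6 * M\<^sup>2 * real CARD('k) * (m\<^sup>2 * lrate t \<omega>))" by (simp add: power2_eq_square)
    finally show ?thesis unfolding \<eta> .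
  qed
  show ?thesis using 1 2 3 by (simp add: overhead_def R_def m_def[symmetric])
qed

lemma short_epoch_charge:
  assumes b: "bounded_inputs \<omega>" and "cur_len t \<omega> < N"
  shows "charge t \<omega> \<le> 3 * M\<^sup>2 * real N"
proof -
  have "charge t \<omega> = gain t \<omega> \<bullet> \<theta> (Suc t) - gain t \<omega> \<bullet> p (Suc t) \<omega>"
    using assms by (simp add: charge_def inner_diff_right)
  also have "\<dots> \<le> 3 * M\<^sup>2 * real (cur_len t \<omega>)"
    using gain_average_bounds(2)[OF b ref_simplex, of "Suc t" t] gain_average_bounds(1)[OF b p_bounds(1)[OF b], of t t]
    by simp
  also have "\<dots> \<le> 3 * M\<^sup>2 * real N" using assms by (intro mult_left_mono) auto
  finally show ?thesis .
qed

text \<open>The comparator moves by at most \<open>C\<^sub>V m powr (1 - \<delta>)\<close> in the epoch, so mirror descent contributes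
  \<open>ln (K m\<^sup>2) / \<eta>\<close> times \<open>1 + C\<^sub>V m powr (1 - \<delta>)\<close>, which is of order
  \<open>m powr (2 - \<delta> / 2) ln (K m\<^sup>2)\<close>. Here \<open>\<delta> \<le> 1\<close> is used for \<open>m powr (1 + \<delta> / 2) \<le> m powr (2 - \<delta> / 2)\<close>. The
  overhead has the same order. The total constant is below 22, a quarter of the constant 88 in \<open>f\<close>.\<close>
lemma long_epoch_charge:
  fixes n :: nat
  assumes b: "bounded_inputs \<omega>"
  defines "s \<equiv> epoch_start M (\<lambda>s. Q s \<omega>) n"
  defines "m \<equiv> epoch_len M (Q s \<omega>)"
  assumes k: "k < m" and N: "N \<le> m"
  shows "(\<Sum>j<Suc k. charge (s + j) \<omega>) \<le> \<epsilon> / 8 * M * (real m)\<^sup>2"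
proof -
  define \<beta> where "\<beta> = 1 / (real m)\<^sup>2 / real CARD('k)"
  define \<eta> where "\<eta> = 1 / (6 * M\<^sup>2 * real CARD('k) * real m powr (1 + \<delta> / 2))"
  define R where "R = real m powr (1 - \<delta> / 2)"
  define L where "L = 2 * ln (real m) + ln (real CARD('k))"
  have m2: "2 \<le> real m" using N threshold_ge_2 by simp
  have sp: "\<omega> \<in> space P" using b by (simp add: bounded_inputs_def)
  have cur_len: "cur_len (s + j) \<omega> = m" if "j < m" for j using cur_len_in_epoch that by (simp add: m_def s_def)
  have fp: "floor_prob (s + j) \<omega> = \<beta>" and lr: "lrate (s + j) \<omega> = \<eta>" if "j < m" for j
    using cur_len[OF that] by (simp_all add: floor_prob_def lrate_def \<beta>_def \<eta>_def)
  have \<beta>_pos: "0 < \<beta>" using floor_prob_pos fp[OF k] by metis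
  have \<eta>_pos: "0 < \<eta>" using lrate_pos lr[OF k] by metis
  have regret: "(\<Sum>j<Suc k. axis (a (Suc (s + j)) \<omega>) (gain_est (s + j) \<omega>) \<bullet> (comparator (s + j) \<omega> - x (Suc (s + j)) \<omega>)
        - \<eta> * (gain_est (s + j) \<omega>)\<^sup>2 * x (Suc (s + j)) \<omega> $ a (Suc (s + j)) \<omega>)
      \<le> ln (1 / \<beta>) / \<eta> * (1 + (\<Sum>j<k. norm1 (comparator (s + Suc j) \<omega> - comparator (s + j) \<omega>)))"
  proof (rule mirror_descent_tracking_regret[where m = m, OF \<beta>_pos \<eta>_pos _ _ _ _ _ k])
    fix j assume j: "j < m"
    show "x (Suc (s + j)) \<omega> \<in> trunc_simplex \<beta>" using slot(1)[OF sp, of "s + j"] fp[OF j] by simp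
    show "comparator (s + j) \<omega> \<in> trunc_simplex \<beta>" using comparator_mem[of "s + j" \<omega>] fp[OF j] by simp
    show "0 \<le> \<eta> * gain_est (s + j) \<omega>" "\<eta> * gain_est (s + j) \<omega> \<le> 1" using gain_est_bounds[OF b, of "s + j"] lr[OF j] by simp_all
  next
    fix j assume j: "Suc j < m"
    then have j': "j < m" by simp
    show "is_arg_min (\<lambda>y. - \<eta> *\<^sub>R axis (a (Suc (s + j)) \<omega>) (gain_est (s + j) \<omega>) \<bullet> y + bregman neg_entropy y (x (Suc (s + j)) \<omega>))
        (\<lambda>y. y \<in> trunc_simplex \<beta>) (x (Suc (s + Suc j)) \<omega>)"
      using slot_in_epoch(5)[OF sp, of j n] j j' cur_len[OF j'] fp[OF j'] lr[OF j'] by (simp add: m_def s_def)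
  qed
  have regret_eq: "(\<Sum>j<Suc k. axis (a (Suc (s + j)) \<omega>) (gain_est (s + j) \<omega>) \<bullet> (comparator (s + j) \<omega> - x (Suc (s + j)) \<omega>)
        - \<eta> * (gain_est (s + j) \<omega>)\<^sup>2 * x (Suc (s + j)) \<omega> $ a (Suc (s + j)) \<omega>) = (\<Sum>j<Suc k. est_regret (s + j) \<omega>)"
    by (intro sum.cong refl) (use k lr in \<open>simp add: est_regret_def\<close>)
  have drift: "(\<Sum>j<k. norm1 (comparator (s + Suc j) \<omega> - comparator (s + j) \<omega>)) \<le> C\<^sub>V * real m powr (1 - \<delta>)"
  proof -
    have "norm1 (comparator (s + Suc j) \<omega> - comparator (s + j) \<omega>) \<le> norm1 (\<theta> (Suc (s + Suc j)) - \<theta> (Suc (s + j)))" if "j < k" for j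
    proof -
      have jm: "Suc j < m" "j < m" using that k by auto
      have "comparator (s + Suc j) \<omega> - comparator (s + j) \<omega> = (1 - 1 / (real m)\<^sup>2) *\<^sub>R (\<theta> (Suc (s + Suc j)) - \<theta> (Suc (s + j)))"
        unfolding comparator_def cur_len[OF jm(1)] cur_len[OF jm(2)] fp[OF jm(1)] fp[OF jm(2)]
        by (simp add: vec_eq_iff algebra_simps)
      then have "norm1 (comparator (s + Suc j) \<omega> - comparator (s + j) \<omega>) = \<bar>1 - 1 / (real m)\<^sup>2\<bar> * norm1 (\<theta> (Suc (s + Suc j)) - \<theta> (Suc (s + j)))"
        by (simp add: norm1_def abs_mult sum_distrib_left)
      also have "\<dots> \<le> 1 * norm1 (\<theta> (Suc (s + Suc j)) - \<theta> (Suc (s + j)))"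
        using m2 by (intro mult_right_mono) (auto simp: norm1_def sum_nonneg abs_le_iff)
      finally show ?thesis by simp
    qed
    then have "(\<Sum>j<k. norm1 (comparator (s + Suc j) \<omega> - comparator (s + j) \<omega>)) \<le> (\<Sum>j<k. norm1 (\<theta> (Suc (s + Suc j)) - \<theta> (Suc (s + j))))"
      by (intro sum_mono) auto
    also have "\<dots> = (\<Sum>t = s + 1..s + Suc k - 1. norm1 (\<theta> (t + 1) - \<theta> t))"
      by (rule sum.reindex_bij_witness[of _ "\<lambda>t. t - Suc s" "\<lambda>j. Suc (s + j)"]) auto
    also have "\<dots> \<le> C\<^sub>V * real (Suc k) powr (1 - \<delta>)"
      using ref_stationary[unfolded reference_stationary_def, THEN conjunct2, THEN conjunct2, rule_format, of "Suc k" s]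
      by simp
    also have "\<dots> \<le> C\<^sub>V * real m powr (1 - \<delta>)"
      using k C\<^sub>V_pos delta_le_1 by (intro mult_left_mono powr_mono2) auto
    finally show ?thesis .
  qed
  have L: "ln (1 / \<beta>) = L" using m2 card_ge_1 by (simp add: \<beta>_def L_def ln_mult ln_realpow)
  have L1: "1 \<le> L"
  proof -
    have "1 \<le> 2 * ln (2::real)" using ln2_ge_two_thirds by simp
    also have "\<dots> \<le> 2 * ln (real m)" using m2 by simp
    finally show ?thesis using ln_ge_zero[OF card_ge_1] by (simp only: L_def)
  qed
  have mRp: "real m * R = real m powr (2 - \<delta> / 2)"
    using m2 powr_add[of "real m" 1 "1 - \<delta> / 2"] by (simp add: R_def)
  have mR: "real m powr (1 + \<delta> / 2) * real m powr (1 - \<delta>) = real m * R"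
  proof -
    have "1 + \<delta> / 2 + (1 - \<delta>) = 2 - \<delta> / 2" by simp
    then show ?thesis unfolding mRp powr_add[symmetric] by simp
  qed
  have mR': "real m powr (1 + \<delta> / 2) \<le> real m * R"
  proof -
    show ?thesis unfolding mRp using m2 delta_le_1 by (intro powr_mono) auto
  qed
  have "(\<Sum>j<Suc k. est_regret (s + j) \<omega>) \<le> L / \<eta> * (1 + C\<^sub>V * real m powr (1 - \<delta>))"
  proof -
    have "L / \<eta> * (1 + (\<Sum>j<k. norm1 (comparator (s + Suc j) \<omega> - comparator (s + j) \<omega>))) \<le> L / \<eta> * (1 + C\<^sub>V * real m powr (1 - \<delta>))"
      using drift L1 \<eta>_pos by (intro mult_left_mono) auto
    then show ?thesis using regret unfolding regret_eq L by (rule order_trans[rotated])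
  qed
  also have "\<dots> = L * (6 * M\<^sup>2 * real CARD('k)) * (real m powr (1 + \<delta> / 2) + C\<^sub>V * (real m powr (1 + \<delta> / 2) * real m powr (1 - \<delta>)))"
    by (simp add: \<eta>_def algebra_simps)
  also have "\<dots> \<le> L * (6 * M\<^sup>2 * real CARD('k)) * (real m * R + C\<^sub>V * (real m * R))"
    unfolding mR using mR' L1 C\<^sub>V_pos by (intro mult_left_mono add_mono) auto
  finally have 1: "(\<Sum>j<Suc k. est_regret (s + j) \<omega>) \<le> 6 * (M\<^sup>2 * (1 + C\<^sub>V) * real CARD('k) * L * (real m * R))"
    by (simp add: algebra_simps)
  have "(\<Sum>j<Suc k. overhead (s + j) \<omega>) \<le> (\<Sum>j<Suc k. 15 / 2 * M\<^sup>2 * R)"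
  proof (rule sum_mono)
    fix j assume "j \<in> {..<Suc k}"
    then have "j < m" using k by simp
    then show "overhead (s + j) \<omega> \<le> 15 / 2 * M\<^sup>2 * R"
      using overhead_le[OF b, of "s + j"] cur_len by (simp add: R_def)
  qed
  also have "\<dots> = 15 / 2 * M\<^sup>2 * (real (Suc k) * R)" by simp
  also have "\<dots> \<le> 15 / 2 * M\<^sup>2 * (real m * R)" using k by (intro mult_left_mono mult_right_mono) (auto simp: R_def)
  also have "\<dots> = 15 / 2 * (1 * 1 * 1 * (M\<^sup>2 * (real m * R)))" by simp
  also have "\<dots> \<le> 15 / 2 * ((1 + C\<^sub>V) * real CARD('k) * L * (M\<^sup>2 * (real m * R)))"
    using C\<^sub>V_pos card_ge_1 L1 by (intro mult_left_mono mult_right_mono mult_mono) (auto simp: R_def)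
  finally have 2: "(\<Sum>j<Suc k. overhead (s + j) \<omega>) \<le> 15 / 2 * (M\<^sup>2 * (1 + C\<^sub>V) * real CARD('k) * L * (real m * R))"
    by (simp add: mult_ac)
  have "(\<Sum>j<Suc k. charge (s + j) \<omega>) = (\<Sum>j<Suc k. est_regret (s + j) \<omega> + overhead (s + j) \<omega>)"
    by (intro sum.cong refl) (use k cur_len N in \<open>simp add: charge_def\<close>)
  also have "\<dots> \<le> 22 * (M\<^sup>2 * (1 + C\<^sub>V) * real CARD('k) * L * (real m * R))"
  proof -
    have "0 \<le> M\<^sup>2 * (1 + C\<^sub>V) * real CARD('k) * L * (real m * R)" using C\<^sub>V_pos L1 by (simp add: R_def)
    then show ?thesis using 1 2 unfolding sum.distrib by linarith
  qed
  also have "\<dots> = M / 4 * (real m)\<^sup>2 * f_SSMW CARD('k) M C\<^sub>V \<delta> m"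
  proof -
    have "real m * R = (real m)\<^sup>2 * real m powr (- \<delta> / 2)"
      using m2 powr_add[of "real m" 2 "- \<delta> / 2"] by (simp add: mRp)
    then show ?thesis unfolding f_SSMW_def L_def by (simp only:) (simp add: power2_eq_square)
  qed
  also have "\<dots> \<le> M / 4 * (real m)\<^sup>2 * (\<epsilon> / 2)" using threshold[OF N] M_pos by (intro mult_left_mono) auto
  finally show ?thesis by (simp add: mult_ac del: sum.lessThan_Suc)
qed

text \<open>Queue lengths can pay for the second summand in every epoch with \<open>m \<ge> 2\<close>, so the distinction between long
  and short epochs ends here.\<close>
lemma epoch_charge:
  fixes n :: nat
  assumes b: "bounded_inputs \<omega>"
  defines "s \<equiv> epoch_start M (\<lambda>s. Q s \<omega>) n"
  defines "m \<equiv> epoch_len M (Q s \<omega>)"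
  assumes k: "k < m"
  shows "(\<Sum>j<Suc k. charge (s + j) \<omega>)
      \<le> 3 * M\<^sup>2 * real N * real (Suc k) + (if 2 \<le> m then \<epsilon> / 8 * M * (real m)\<^sup>2 else 0)"
proof (cases "N \<le> m")
  case True
  moreover have "0 \<le> 3 * M\<^sup>2 * real N * real (Suc k)" by simp
  ultimately show ?thesis
    using long_epoch_charge[OF b k[unfolded m_def s_def]] threshold_ge_2 unfolding m_def[symmetric] s_def[symmetric]
    by (smt (verit) order_trans)
next
  case False
  have "cur_len (s + j) \<omega> = m" if "j < m" for j using cur_len_in_epoch that by (simp add: m_def s_def)
  then have "(\<Sum>j<Suc k. charge (s + j) \<omega>) \<le> (\<Sum>j<Suc k. 3 * M\<^sup>2 * real N)"
    using False k by (intro sum_mono short_epoch_charge b) auto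
  moreover have "0 \<le> (if 2 \<le> m then \<epsilon> / 8 * M * (real m)\<^sup>2 else 0)" using M_pos eps_pos by simp
  ultimately show ?thesis by (simp add: algebra_simps)
qed

text \<open>An epoch of length \<open>m \<ge> 2\<close> starts with some queue longer than \<open>2 M (m - 1)\<close>. Fewer than \<open>m\<close> slots away, in either
  direction, that queue is longer than \<open>M (m - 1) \<ge> M m / 2\<close>.\<close>
lemma long_queue:
  fixes s :: nat
  assumes b: "bounded_inputs \<omega>"
  defines "m \<equiv> epoch_len M (Q s \<omega>)"
  assumes m: "2 \<le> m"
  shows "m \<le> s" "j < m \<Longrightarrow> M * real m / 2 \<le> norm1 (Q (s + j) \<omega>)"
    "j < m \<Longrightarrow> M * real m / 2 \<le> norm1 (Q (s - j) \<omega>)"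
proof -
  obtain i where i: "infnorm (Q s \<omega>) = \<bar>Q s \<omega> $ i\<bar>" by (rule infnorm_attained)
  then have big: "2 * M * (real m - 1) < Q s \<omega> $ i"
    using epoch_len_bounds(2)[OF M_pos m[unfolded m_def]] Q_nonneg[of s \<omega> i] by (simp add: m_def)
  also have "\<dots> \<le> M * real s" by (rule Q_le[OF b])
  finally have "M * (2 * (real m - 1)) < M * real s" by (simp add: mult_ac)
  then show ms: "m \<le> s" using M_pos m by simp
  have half: "M * real m / 2 \<le> Q t \<omega> $ i" if "Q s \<omega> $ i - M * real j \<le> Q t \<omega> $ i" "j < m" for t j
  proof -
    have "M * real j \<le> M * (real m - 1)" using that M_pos by (intro mult_left_mono) auto
    moreover have "M * (real m / 2) \<le> M * (real m - 1)" using m M_pos by (intro mult_left_mono) auto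
    ultimately show ?thesis using that big by simp
  qed
  show "M * real m / 2 \<le> norm1 (Q (s + j) \<omega>)" if "j < m"
  proof (rule order_trans[OF half Q_le_norm1[of "s + j" \<omega> i]])
    show "Q s \<omega> $ i - M * real j \<le> Q (s + j) \<omega> $ i" using Q_near[OF b, of s j i] by linarith
  qed (rule that)
  show "M * real m / 2 \<le> norm1 (Q (s - j) \<omega>)" if "j < m"
  proof (rule order_trans[OF half Q_le_norm1[of "s - j" \<omega> i]])
    have "\<bar>Q s \<omega> $ i - Q (s - j) \<omega> $ i\<bar> \<le> M * real j" using Q_near[OF b, of "s - j" j i] that ms by simp
    then show "Q s \<omega> $ i - M * real j \<le> Q (s - j) \<omega> $ i" by linarith
  qed (rule that)
qed

text \<open>A complete epoch of length \<open>m\<close> pays \<open>\<epsilon> M m\<^sup>2 / 8\<close> by its own \<open>m\<close> slots, each with total queue length at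
  least \<open>M m / 2\<close>.\<close>
lemma charge_epoch_boundary:
  fixes n :: nat
  assumes b: "bounded_inputs \<omega>"
  defines "s \<equiv> epoch_start M (\<lambda>s. Q s \<omega>)"
  shows "(\<Sum>t<s n. charge t \<omega>) \<le> 3 * M\<^sup>2 * real N * real (s n) + \<epsilon> / 4 * (\<Sum>t<s n. norm1 (Q t \<omega>))"
proof (induction n)
  case 0
  then show ?case by (simp add: s_def)
next
  case (Suc n)
  define m where "m = epoch_len M (Q (s n) \<omega>)"
  have m: "0 < m" unfolding m_def by (rule epoch_len_pos)
  have sS: "s (Suc n) = s n + m" by (simp add: s_def m_def)
  have split: "(\<Sum>t<s n + m. h t) = (\<Sum>t<s n. h t) + (\<Sum>j<m. h (s n + j))" for h :: "nat \<Rightarrow> real"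
    by (induction m) simp_all
  have "(\<Sum>j<m. charge (s n + j) \<omega>) \<le> 3 * M\<^sup>2 * real N * real m + (if 2 \<le> m then \<epsilon> / 8 * M * (real m)\<^sup>2 else 0)"
    using epoch_charge[OF b, of "m - 1" n] m unfolding s_def[symmetric] m_def[symmetric] by simp
  also have "(if 2 \<le> m then \<epsilon> / 8 * M * (real m)\<^sup>2 else 0) \<le> \<epsilon> / 4 * (\<Sum>j<m. norm1 (Q (s n + j) \<omega>))"
  proof (cases "2 \<le> m")
    case True
    have "(\<Sum>j<m. M * real m / 2) \<le> (\<Sum>j<m. norm1 (Q (s n + j) \<omega>))"
      using long_queue(2)[OF b, of "s n"] True by (intro sum_mono) (auto simp: m_def)
    then have "\<epsilon> / 4 * (\<Sum>j<m. M * real m / 2) \<le> \<epsilon> / 4 * (\<Sum>j<m. norm1 (Q (s n + j) \<omega>))"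
      using eps_pos by (intro mult_left_mono) auto
    then show ?thesis using True by (simp add: power2_eq_square)
  next
    case False
    then show ?thesis using eps_pos by (simp add: norm1_def sum_nonneg)
  qed
  finally show ?case using Suc unfolding sS split by (simp add: algebra_simps)
qed

text \<open>The last epoch may be cut off by the horizon after few slots, while its regret bound is still of order
  \<open>m\<^sup>2\<close>. It is paid by the \<open>m\<close> slots up to its start; these have paid for their own epochs already,
  which turns \<open>\<epsilon> / 4\<close> into \<open>\<epsilon> / 2\<close>.\<close>
lemma charge_total:
  assumes b: "bounded_inputs \<omega>"
  shows "(\<Sum>t<T. charge t \<omega>) \<le> 3 * M\<^sup>2 * real N * real T + \<epsilon> / 2 * (\<Sum>t<T. norm1 (Q t \<omega>))"
proof (cases T)
  case 0
  then show ?thesis by simp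
next
  case (Suc t)
  obtain n k where nk: "t = epoch_start M (\<lambda>s. Q s \<omega>) n + k"
    "k < epoch_len M (Q (epoch_start M (\<lambda>s. Q s \<omega>) n) \<omega>)" by (rule obtain_epoch)
  define s where "s = epoch_start M (\<lambda>s. Q s \<omega>) n"
  define m where "m = epoch_len M (Q s \<omega>)"
  have T: "T = s + Suc k" by (simp add: Suc nk s_def)
  have split: "(\<Sum>t<s + l. h t) = (\<Sum>t<s. h t) + (\<Sum>j<l. h (s + j))" for h :: "nat \<Rightarrow> real" and l
    by (induction l) simp_all
  have nn: "0 \<le> norm1 (Q t \<omega>)" for t by (simp add: norm1_def sum_nonneg)
  have "(\<Sum>j<Suc k. charge (s + j) \<omega>) \<le> 3 * M\<^sup>2 * real N * real (Suc k) + (if 2 \<le> m then \<epsilon> / 8 * M * (real m)\<^sup>2 else 0)"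
    unfolding s_def m_def by (rule epoch_charge[OF b nk(2)])
  also have "(if 2 \<le> m then \<epsilon> / 8 * M * (real m)\<^sup>2 else 0) \<le> \<epsilon> / 4 * (\<Sum>t<T. norm1 (Q t \<omega>))"
  proof (cases "2 \<le> m")
    case True
    \<comment> \<open>The slots \<open>s - m + 1, \<dots>, s\<close> exist because \<open>m \<le> s\<close>.\<close>
    have "(\<Sum>j<m. M * real m / 2) \<le> (\<Sum>j<m. norm1 (Q (s - j) \<omega>))"
      using long_queue(3)[OF b, of s] True by (intro sum_mono) (auto simp: m_def)
    also have "\<dots> = (\<Sum>t\<in>(\<lambda>j. s - j) ` {..<m}. norm1 (Q t \<omega>))"
      by (subst sum.reindex) (use long_queue(1)[OF b, of s] True in \<open>auto simp: m_def inj_on_def\<close>)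
    also have "\<dots> \<le> (\<Sum>t<T. norm1 (Q t \<omega>))" by (intro sum_mono2) (auto simp: T nn)
    finally have "\<epsilon> / 4 * (\<Sum>j<m. M * real m / 2) \<le> \<epsilon> / 4 * (\<Sum>t<T. norm1 (Q t \<omega>))"
      using eps_pos by (intro mult_left_mono) auto
    then show ?thesis using True by (simp add: power2_eq_square)
  next
    case False
    then show ?thesis using eps_pos nn by (simp add: sum_nonneg)
  qed
  finally have "(\<Sum>j<Suc k. charge (s + j) \<omega>) \<le> 3 * M\<^sup>2 * real N * real (Suc k) + \<epsilon> / 4 * (\<Sum>t<T. norm1 (Q t \<omega>))"
    by simp
  moreover have "(\<Sum>t<s. charge t \<omega>) \<le> 3 * M\<^sup>2 * real N * real s + \<epsilon> / 4 * (\<Sum>t<s. norm1 (Q t \<omega>))"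
    unfolding s_def by (rule charge_epoch_boundary[OF b])
  moreover have "\<epsilon> / 4 * (\<Sum>t<s. norm1 (Q t \<omega>)) \<le> \<epsilon> / 4 * (\<Sum>t<T. norm1 (Q t \<omega>))"
    using eps_pos nn by (intro mult_left_mono sum_mono2) (auto simp: T)
  moreover have "(\<Sum>t<T. charge t \<omega>) = (\<Sum>t<s. charge t \<omega>) + (\<Sum>j<Suc k. charge (s + j) \<omega>)"
    unfolding T by (rule split)
  ultimately show ?thesis by (simp add: T algebra_simps)
qed

end

section \<open>Noise terms with mean zero\<close>

context ssmw_analysis
begin

lemma AE_bounded_inputs: "AE \<omega> in P. bounded_inputs \<omega>"
proof -
  have "AE \<omega> in P. \<forall>t. \<forall>i. A (Suc t) \<omega> $ i \<in> {0..M}"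
    by (subst AE_all_countable, intro allI A_bounded) simp
  moreover have "AE \<omega> in P. \<forall>t. \<forall>i. S (Suc t) \<omega> $ i \<in> {0..M}"
    by (subst AE_all_countable, intro allI S_bounded) simp
  ultimately show "AE \<omega> in P. bounded_inputs \<omega>" using AE_space
    by eventually_elim (auto simp: bounded_inputs_def)
qed

lemma Q_nth_measurable: "(\<lambda>\<omega>. Q t \<omega> $ i) \<in> borel_measurable (F t)"
proof (induction t arbitrary: i)
  case 0
  then show ?case by (simp add: Q_0)
next
  case (Suc t)
  have [measurable]: "(\<lambda>\<omega>. Q t \<omega> $ i) \<in> borel_measurable (F (Suc t))"
    by (rule measurable_F_mono[OF Suc]) simp
  have [measurable]: "(\<lambda>\<omega>. A (Suc t) \<omega> $ i) \<in> borel_measurable (F (Suc t))"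
    "(\<lambda>\<omega>. S (Suc t) \<omega> $ i) \<in> borel_measurable (F (Suc t))"
    using A_adapted[of "Suc t"] S_adapted[of "Suc t"] by (auto intro: measurable_compose[OF _ borel_measurable_vec_nth])
  have [measurable]: "(\<lambda>\<omega>. of_bool (i = a (Suc t) \<omega>) :: real) \<in> borel_measurable (F (Suc t))"
    by (rule measurable_compose[OF a_adapted]) auto
  show ?case unfolding Q_Suc by measurable
qed

lemma Q_measurable: "Q t \<in> borel_measurable (F t)"
  by (rule borel_measurable_vecI) (rule Q_nth_measurable)

lemma epoch_len_measurable: "epoch_len M \<in> measurable (borel :: (real ^ 'k) measure) (count_space UNIV)"
proof -
  have [measurable]: "(infnorm :: real ^ 'k \<Rightarrow> real) \<in> borel_measurable borel"
    by (intro borel_measurable_continuous_onI continuous_on_infnorm continuous_on_id)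
  show ?thesis unfolding epoch_len_def by measurable
qed

text \<open>The truncation by \<open>t\<close> in the proof makes all members of the countable family measurable with respect to
  \<open>F t\<close>.\<close>
lemma epoch_len_at_measurable:
  assumes s: "s \<in> measurable (F t) (count_space UNIV)" and le: "\<And>\<omega>. s \<omega> \<le> t"
  shows "(\<lambda>\<omega>. epoch_len M (Q (s \<omega>) \<omega>)) \<in> measurable (F t) (count_space UNIV)"
proof -
  have "(\<lambda>\<omega>. epoch_len M (Q (min n t) \<omega>)) \<in> measurable (F t) (count_space UNIV)" for n
    by (rule measurable_compose[OF _ epoch_len_measurable], rule measurable_F_mono[OF Q_measurable]) simp
  from measurable_compose_countable[where f = "\<lambda>n \<omega>. epoch_len M (Q (min n t) \<omega>)" and g = s, OF this s]
  show ?thesis using le by (simp add: min_absorb1)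
qed

lemma epoch_of_measurable: "(\<lambda>\<omega>. epoch_of M (\<lambda>s. Q s \<omega>) t) \<in> measurable (F t) (count_space UNIV)"
proof (induction t)
  case 0
  then show ?case by simp
next
  case (Suc t)
  have [measurable]: "(\<lambda>\<omega>. epoch_of M (\<lambda>s. Q s \<omega>) t) \<in> measurable (F (Suc t)) (count_space UNIV)"
    by (rule measurable_F_mono[OF Suc]) simp
  have [measurable]: "(\<lambda>\<omega>. epoch_len M (Q (epoch_of M (\<lambda>s. Q s \<omega>) t) \<omega>)) \<in> measurable (F (Suc t)) (count_space UNIV)"
    by (rule measurable_F_mono[OF epoch_len_at_measurable[OF Suc epoch_of_le]]) simp
  show ?case unfolding epoch_of.simps by measurable
qed

lemma cur_len_measurable: "cur_len t \<in> measurable (F t) (count_space UNIV)"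
  unfolding cur_len_def by (rule epoch_len_at_measurable[OF epoch_of_measurable epoch_of_le])

lemma function_of_cur_len_measurable: "(\<lambda>\<omega>. h (cur_len t \<omega>)) \<in> borel_measurable (F t)"
  by (rule measurable_compose[OF cur_len_measurable]) simp

lemma lrate_measurable: "lrate t \<in> borel_measurable (F t)"
  unfolding lrate_def by (rule function_of_cur_len_measurable)

lemma comparator_measurable: "(\<lambda>\<omega>. comparator t \<omega> $ i) \<in> borel_measurable (F t)"
  unfolding comparator_def floor_prob_def vec_lambda_beta by (rule function_of_cur_len_measurable)

lemma x_measurable: "(\<lambda>\<omega>. x (Suc t) \<omega> $ i) \<in> borel_measurable (F t)"
  and e_measurable: "(\<lambda>\<omega>. e (Suc t) \<omega> $ i) \<in> borel_measurable (F t)"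
  using x_predictable[of "Suc t"] e_predictable[of "Suc t"]
  by (auto intro: measurable_compose[OF _ borel_measurable_vec_nth])

lemma p_measurable: "(\<lambda>\<omega>. p (Suc t) \<omega> $ i) \<in> borel_measurable (F t)"
proof -
  note [measurable] = lrate_measurable[of t] Q_nth_measurable[of t] x_measurable[of t] e_measurable[of t]
  have "(\<lambda>\<omega>. (1 - explore t \<omega>) * x (Suc t) \<omega> $ i + explore t \<omega> * e (Suc t) \<omega> $ i) \<in> borel_measurable (F t)"
    unfolding explore_def norm1_Q by measurable
  moreover have "p (Suc t) \<omega> $ i = (1 - explore t \<omega>) * x (Suc t) \<omega> $ i + explore t \<omega> * e (Suc t) \<omega> $ i"
    if "\<omega> \<in> space (F t)" for \<omega>
    using slot(4)[of \<omega> t] that by (simp add: space_F)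
  ultimately show ?thesis by (subst measurable_cong) auto
qed

lemma F_integrable:
  assumes "H \<in> borel_measurable (F t)" "\<And>\<omega>. bounded_inputs \<omega> \<Longrightarrow> \<bar>H \<omega>\<bar> \<le> B"
  shows "integrable P (H :: 'w \<Rightarrow> real)"
  using measurable_from_subalg[OF F_subalgebra assms(1)] AE_bounded_inputs assms(2)
  by (intro integrable_const_bound[where B = B]) (auto elim: AE_mp)

lemma served_measurable: "(\<lambda>\<omega>. of_bool (a (Suc t) \<omega> = i) :: real) \<in> borel_measurable P"
  by (rule measurable_compose[OF a_measurable]) auto

lemma expectation_choice:
  assumes H: "H \<in> borel_measurable (F t)" and B: "\<And>\<omega>. bounded_inputs \<omega> \<Longrightarrow> \<bar>H \<omega>\<bar> \<le> B"
  shows "integrable P (\<lambda>\<omega>. H \<omega> * of_bool (a (Suc t) \<omega> = i))"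
    "integrable P (\<lambda>\<omega>. H \<omega> * p (Suc t) \<omega> $ i)"
    "(\<integral>\<omega>. H \<omega> * of_bool (a (Suc t) \<omega> = i) \<partial>P) = (\<integral>\<omega>. H \<omega> * p (Suc t) \<omega> $ i \<partial>P)"
proof -
  interpret fin: finite_measure_subalgebra P "F t"
    by unfold_locales (rule F_subalgebra)
  have HP: "H \<in> borel_measurable P" by (rule measurable_from_subalg[OF F_subalgebra H])
  show int: "integrable P (\<lambda>\<omega>. H \<omega> * of_bool (a (Suc t) \<omega> = i))"
  proof (rule integrable_const_bound[where B = B])
    show "AE \<omega> in P. norm (H \<omega> * of_bool (a (Suc t) \<omega> = i)) \<le> B"
      using AE_bounded_inputs by (rule AE_mp) (use B in \<open>auto intro!: AE_I2 simp: abs_mult intro: order_trans[OF abs_ge_zero]\<close>)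
    show "(\<lambda>\<omega>. H \<omega> * of_bool (a (Suc t) \<omega> = i)) \<in> borel_measurable P"
      by (intro borel_measurable_times HP served_measurable)
  qed
  have ind: "indicat_real {\<omega>. a (Suc t) \<omega> = i} = (\<lambda>\<omega>. of_bool (a (Suc t) \<omega> = i))"
    by (auto simp: fun_eq_iff indicator_def)
  define c where "c = real_cond_exp P (F t) (\<lambda>\<omega>. of_bool (a (Suc t) \<omega> = i))"
  have c: "AE \<omega> in P. c \<omega> = p (Suc t) \<omega> $ i" using sampled[of "Suc t" i] by (simp add: ind c_def)
  \<comment> \<open>\<open>p\<close> is a version of the conditional expectation, so both can be exchanged under the integral.\<close>
  have 1: "integrable P (\<lambda>\<omega>. H \<omega> * c \<omega>)"
    "(\<integral>\<omega>. H \<omega> * c \<omega> \<partial>P) = (\<integral>\<omega>. H \<omega> * of_bool (a (Suc t) \<omega> = i) \<partial>P)"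
    unfolding c_def using fin.real_cond_exp_intg[OF int H served_measurable] by auto
  have pP: "(\<lambda>\<omega>. H \<omega> * p (Suc t) \<omega> $ i) \<in> borel_measurable P"
    by (intro borel_measurable_times HP measurable_from_subalg[OF F_subalgebra p_measurable])
  have cP: "(\<lambda>\<omega>. H \<omega> * c \<omega>) \<in> borel_measurable P" using 1(1) by auto
  have eq: "AE \<omega> in P. H \<omega> * c \<omega> = H \<omega> * p (Suc t) \<omega> $ i" using c by (rule AE_mp) (auto intro!: AE_I2)
  show "integrable P (\<lambda>\<omega>. H \<omega> * p (Suc t) \<omega> $ i)"
    using 1(1) integrable_cong_AE[OF cP pP eq] by simp
  show "(\<integral>\<omega>. H \<omega> * of_bool (a (Suc t) \<omega> = i) \<partial>P) = (\<integral>\<omega>. H \<omega> * p (Suc t) \<omega> $ i \<partial>P)"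
    using 1(2) integral_cong_AE[OF cP pP eq] by simp
qed

lemma input_integrable:
  assumes "g \<in> borel_measurable borel" "\<And>\<omega>. bounded_inputs \<omega> \<Longrightarrow> \<bar>g (A (Suc t) \<omega>, S (Suc t) \<omega>)\<bar> \<le> M"
  shows "integrable P (\<lambda>\<omega>. g (A (Suc t) \<omega>, S (Suc t) \<omega>) :: real)"
proof (rule integrable_const_bound[where B = M])
  show "AE \<omega> in P. norm (g (A (Suc t) \<omega>, S (Suc t) \<omega>)) \<le> M"
    using AE_bounded_inputs by (rule AE_mp) (use assms(2) in \<open>auto intro!: AE_I2\<close>)
  have [measurable]: "A (Suc t) \<in> borel_measurable P" "S (Suc t) \<in> borel_measurable P"
    using A_measurable S_measurable by auto
  show "(\<lambda>\<omega>. g (A (Suc t) \<omega>, S (Suc t) \<omega>)) \<in> borel_measurable P"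
    by (rule measurable_compose[OF _ assms(1)]) measurable
qed

lemma expectation_arrival:
  assumes H: "H \<in> borel_measurable (F t)" and B: "\<And>\<omega>. bounded_inputs \<omega> \<Longrightarrow> \<bar>H \<omega>\<bar> \<le> B"
  shows "integrable P (\<lambda>\<omega>. H \<omega> * A (Suc t) \<omega> $ i)"
    "(\<integral>\<omega>. H \<omega> * A (Suc t) \<omega> $ i \<partial>P) = (\<integral>\<omega>. H \<omega> \<partial>P) * mean (LA (Suc t)) $ i"
proof -
  define g where "g = (\<lambda>v :: (real ^ 'k) \<times> (real ^ 'k). fst v $ i)"
  have g: "g \<in> borel_measurable borel"
    unfolding g_def by (intro borel_measurable_continuous_onI continuous_intros)
  have "integrable P (\<lambda>\<omega>. g (A (Suc t) \<omega>, S (Suc t) \<omega>))"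
    by (rule input_integrable[OF g]) (auto simp: g_def bounded_inputs_def)
  from decision_indep[OF F_decision_info[OF H] g F_integrable[OF H B] this]
  show "integrable P (\<lambda>\<omega>. H \<omega> * A (Suc t) \<omega> $ i)"
    "(\<integral>\<omega>. H \<omega> * A (Suc t) \<omega> $ i \<partial>P) = (\<integral>\<omega>. H \<omega> \<partial>P) * mean (LA (Suc t)) $ i"
    by (simp_all add: g_def mean_arrival(1))
qed

lemma expectation_service:
  assumes H: "H \<in> borel_measurable (F t)" and B: "\<And>\<omega>. bounded_inputs \<omega> \<Longrightarrow> \<bar>H \<omega>\<bar> \<le> B"
  shows "integrable P (\<lambda>\<omega>. H \<omega> * of_bool (a (Suc t) \<omega> = i) * S (Suc t) \<omega> $ i)"
    "(\<integral>\<omega>. H \<omega> * of_bool (a (Suc t) \<omega> = i) * S (Suc t) \<omega> $ i \<partial>P)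
      = (\<integral>\<omega>. H \<omega> * p (Suc t) \<omega> $ i \<partial>P) * mean (LS (Suc t)) $ i"
proof -
  define g where "g = (\<lambda>v :: (real ^ 'k) \<times> (real ^ 'k). snd v $ i)"
  have g: "g \<in> borel_measurable borel"
    unfolding g_def by (intro borel_measurable_continuous_onI continuous_intros)
  have int: "integrable P (\<lambda>\<omega>. g (A (Suc t) \<omega>, S (Suc t) \<omega>))"
    by (rule input_integrable[OF g]) (auto simp: g_def bounded_inputs_def)
  have "(\<lambda>\<omega>. of_bool (a (Suc t) \<omega> = i) :: real) \<in> borel_measurable (decision_info t)"
    by (rule measurable_compose[OF a_decision_info]) auto
  then have "(\<lambda>\<omega>. H \<omega> * of_bool (a (Suc t) \<omega> = i)) \<in> borel_measurable (decision_info t)"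
    by (rule borel_measurable_times[OF F_decision_info[OF H]])
  from decision_indep[OF this g expectation_choice(1)[OF H B] int]
  show "integrable P (\<lambda>\<omega>. H \<omega> * of_bool (a (Suc t) \<omega> = i) * S (Suc t) \<omega> $ i)"
    "(\<integral>\<omega>. H \<omega> * of_bool (a (Suc t) \<omega> = i) * S (Suc t) \<omega> $ i \<partial>P)
      = (\<integral>\<omega>. H \<omega> * p (Suc t) \<omega> $ i \<partial>P) * mean (LS (Suc t)) $ i"
    by (simp_all add: g_def mean_service(1) expectation_choice(3)[OF H B])
qed

text \<open>The coefficients with which the observed services and the choices enter the linear and the second-order
  part of the charge. They are zero in short epochs, where no estimates are used.\<close>
definition lin_coeff :: "nat \<Rightarrow> 'k \<Rightarrow> 'w \<Rightarrow> real" where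
  "lin_coeff t i \<omega> = (if N \<le> cur_len t \<omega> then Q t \<omega> $ i / p (Suc t) \<omega> $ i * (comparator t \<omega> $ i - x (Suc t) \<omega> $ i) else 0)"

definition quad_coeff :: "nat \<Rightarrow> 'k \<Rightarrow> 'w \<Rightarrow> real" where
  "quad_coeff t i \<omega> = (if N \<le> cur_len t \<omega>
     then lrate t \<omega> * M\<^sup>2 * x (Suc t) \<omega> $ i * (Q t \<omega> $ i / p (Suc t) \<omega> $ i)\<^sup>2 else 0)"

text \<open>All deviations from conditional means in the drift of slot \<open>t + 1\<close>: of the arrivals, of the service given
  to the chosen queue (once from the drift, once from the gain estimates), and of the choice itself.\<close>
definition noise :: "nat \<Rightarrow> 'w \<Rightarrow> real" where
  "noise t \<omega> = (\<Sum>i\<in>UNIV. Q t \<omega> $ i * (A (Suc t) \<omega> $ i - mean (LA (Suc t)) $ i)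
     - (Q t \<omega> $ i + lin_coeff t i \<omega>)
         * (of_bool (a (Suc t) \<omega> = i) * S (Suc t) \<omega> $ i - p (Suc t) \<omega> $ i * mean (LS (Suc t)) $ i)
     + quad_coeff t i \<omega> * (of_bool (a (Suc t) \<omega> = i) - p (Suc t) \<omega> $ i))"

lemma inverse_lrate_le:
  assumes "bounded_inputs \<omega>"
  shows "1 / lrate t \<omega> \<le> 6 * M\<^sup>2 * real CARD('k) * real (t + 1) powr (1 + \<delta> / 2)"
proof -
  have "real (cur_len t \<omega>) powr (1 + \<delta> / 2) \<le> real (t + 1) powr (1 + \<delta> / 2)"
    using cur_len_le[OF assms, of t] delta_pos by (intro powr_mono2) auto
  then show ?thesis by (simp add: lrate_def mult_left_mono)
qed

lemma inverse_p_le: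
  assumes "bounded_inputs \<omega>"
  shows "0 \<le> Q t \<omega> $ i / p (Suc t) \<omega> $ i" "Q t \<omega> $ i / p (Suc t) \<omega> $ i \<le> 1 / lrate t \<omega> / M"
  using p_bounds(3,4)[OF assms, of t i] lrate_pos[of t \<omega>] M_pos Q_nonneg[of t \<omega> i]
  by (auto simp: field_simps)

lemma lin_coeff_le:
  assumes "bounded_inputs \<omega>"
  shows "\<bar>lin_coeff t i \<omega>\<bar> \<le> 6 * M\<^sup>2 * real CARD('k) * real (t + 1) powr (1 + \<delta> / 2) / M"
proof -
  have sp: "\<omega> \<in> space P" using assms by (simp add: bounded_inputs_def)
  have "\<bar>Q t \<omega> $ i / p (Suc t) \<omega> $ i * (comparator t \<omega> $ i - x (Suc t) \<omega> $ i)\<bar> \<le> (1 / lrate t \<omega> / M) * 1"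
    unfolding abs_mult
  proof (rule mult_mono)
    show "\<bar>Q t \<omega> $ i / p (Suc t) \<omega> $ i\<bar> \<le> 1 / lrate t \<omega> / M" using inverse_p_le[OF assms, of t i] by simp
    show "\<bar>comparator t \<omega> $ i - x (Suc t) \<omega> $ i\<bar> \<le> 1"
      using trunc_simplexD(2,3)[OF comparator_mem, of t \<omega> i] trunc_simplexD(2,3)[OF slot(1)[OF sp], of t i] by linarith
  qed (use M_pos lrate_pos[of t \<omega>] in auto)
  also have "\<dots> \<le> 6 * M\<^sup>2 * real CARD('k) * real (t + 1) powr (1 + \<delta> / 2) / M"
    using divide_right_mono[OF inverse_lrate_le[OF assms, of t], of M] M_pos by simp
  finally show ?thesis using M_pos by (simp add: lin_coeff_def)
qed

lemma quad_coeff_le: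
  assumes "bounded_inputs \<omega>"
  shows "\<bar>quad_coeff t i \<omega>\<bar> \<le> 6 * M\<^sup>2 * real CARD('k) * real (t + 1) powr (1 + \<delta> / 2)"
proof -
  have sp: "\<omega> \<in> space P" using assms by (simp add: bounded_inputs_def)
  note x = trunc_simplexD(2,3)[OF slot(1)[OF sp], of t i]
  have "lrate t \<omega> * M\<^sup>2 * x (Suc t) \<omega> $ i * (Q t \<omega> $ i / p (Suc t) \<omega> $ i)\<^sup>2
      \<le> lrate t \<omega> * M\<^sup>2 * 1 * (1 / lrate t \<omega> / M)\<^sup>2"
    using x inverse_p_le[OF assms, of t i] lrate_pos[of t \<omega>]
    by (intro mult_mono power_mono mult_left_mono mult_nonneg_nonneg) auto
  also have "\<dots> = 1 / lrate t \<omega>" using lrate_pos[of t \<omega>] M_pos by (simp add: power2_eq_square)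
  also note inverse_lrate_le[OF assms, of t]
  moreover have "0 \<le> lrate t \<omega> * M\<^sup>2 * x (Suc t) \<omega> $ i * (Q t \<omega> $ i / p (Suc t) \<omega> $ i)\<^sup>2"
    using x lrate_pos[of t \<omega>] by simp
  ultimately show ?thesis by (simp add: quad_coeff_def)
qed

lemma lin_coeff_measurable: "lin_coeff t i \<in> borel_measurable (F t)"
  and quad_coeff_measurable: "quad_coeff t i \<in> borel_measurable (F t)"
proof -
  note [measurable] = lrate_measurable[of t] Q_nth_measurable[of t] x_measurable[of t] p_measurable[of t]
    comparator_measurable[of t] cur_len_measurable[of t]
  show "lin_coeff t i \<in> borel_measurable (F t)" unfolding lin_coeff_def by measurable
  show "quad_coeff t i \<in> borel_measurable (F t)" unfolding quad_coeff_def by measurable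
qed

text \<open>Every coefficient is measurable with respect to the past. It is bounded, although it may contain \<open>1 / p\<close>,
  because \<open>Q\<^sub>i / p\<^sub>i \<le> 1 / (M \<eta>)\<close> and the epoch length in \<open>\<eta>\<close> is at most \<open>t + 1\<close>.\<close>
lemma noise_mean_zero: "integrable P (noise t)" "(\<integral>\<omega>. noise t \<omega> \<partial>P) = 0"
proof -
  define H where "H i \<omega> = Q t \<omega> $ i + lin_coeff t i \<omega>" for i \<omega>
  have Qb: "\<bar>Q t \<omega> $ i\<bar> \<le> M * real t" if "bounded_inputs \<omega>" for \<omega> i
    using Q_nonneg[of t \<omega> i] Q_le[OF that, of t i] by simp
  have Hm: "H i \<in> borel_measurable (F t)" for i
    unfolding H_def by (intro borel_measurable_add Q_nth_measurable lin_coeff_measurable)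
  have Hb: "\<bar>H i \<omega>\<bar> \<le> M * real t + 6 * M\<^sup>2 * real CARD('k) * real (t + 1) powr (1 + \<delta> / 2) / M"
    if "bounded_inputs \<omega>" for \<omega> i
    unfolding H_def by (intro order_trans[OF abs_triangle_ineq] add_mono Qb lin_coeff_le that)
  note Qi = F_integrable[OF Q_nth_measurable Qb] expectation_arrival[OF Q_nth_measurable Qb]
  note Hi = expectation_service[OF Hm Hb] expectation_choice[OF Hm Hb]
  note Gi = expectation_choice[OF quad_coeff_measurable quad_coeff_le]
  have eq: "noise t = (\<lambda>\<omega>. \<Sum>i\<in>UNIV. (Q t \<omega> $ i * A (Suc t) \<omega> $ i - Q t \<omega> $ i * mean (LA (Suc t)) $ i)
      - (H i \<omega> * of_bool (a (Suc t) \<omega> = i) * S (Suc t) \<omega> $ i - H i \<omega> * p (Suc t) \<omega> $ i * mean (LS (Suc t)) $ i)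
      + (quad_coeff t i \<omega> * of_bool (a (Suc t) \<omega> = i) - quad_coeff t i \<omega> * p (Suc t) \<omega> $ i))"
    unfolding noise_def H_def[symmetric] by (simp add: right_diff_distrib mult.assoc)
  have int: "integrable P (\<lambda>\<omega>. Q t \<omega> $ i * mean (LA (Suc t)) $ i)"
    "integrable P (\<lambda>\<omega>. H i \<omega> * p (Suc t) \<omega> $ i * mean (LS (Suc t)) $ i)" for i
    using Qi(1)[of i] Hi(4)[of i] by auto
  show "integrable P (noise t)"
    unfolding eq
    by (intro Bochner_Integration.integrable_sum Bochner_Integration.integrable_add Bochner_Integration.integrable_diff Qi(2) int Hi(1) Gi(1,2))
  show "(\<integral>\<omega>. noise t \<omega> \<partial>P) = 0"
    unfolding eq
    by (subst Bochner_Integration.integral_sum)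
      (auto intro!: Bochner_Integration.integrable_add Bochner_Integration.integrable_diff Qi(2) int Hi(1) Gi(1,2) sum.neutral
        simp: Bochner_Integration.integral_add Bochner_Integration.integral_diff Qi int Hi Gi)
qed

end

section \<open>Drift inequality and stability\<close>

context ssmw_analysis
begin

text \<open>The importance-weighted estimate is unbiased, so \<open>\<langle>gain_est, u - x\<rangle>\<close> and \<open>\<langle>gain, u - x\<rangle>\<close> differ by
  noise. In the second-order term, \<open>S\<^sup>2 \<le> M\<^sup>2\<close> first makes the coefficient of the choice known
  beforehand; its mean is then at most the first part of the overhead.\<close>
lemma charge_ge:
  assumes b: "bounded_inputs \<omega>"
  shows "gain t \<omega> \<bullet> (\<theta> (Suc t) - p (Suc t) \<omega>)
    + (\<Sum>i\<in>UNIV. lin_coeff t i \<omega> * (of_bool (a (Suc t) \<omega> = i) * S (Suc t) \<omega> $ i - p (Suc t) \<omega> $ i * mean (LS (Suc t)) $ i))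
    - (\<Sum>i\<in>UNIV. quad_coeff t i \<omega> * (of_bool (a (Suc t) \<omega> = i) - p (Suc t) \<omega> $ i)) \<le> charge t \<omega>"
proof (cases "N \<le> cur_len t \<omega>")
  case False
  then show ?thesis by (simp add: charge_def lin_coeff_def quad_coeff_def)
next
  case True
  define i where "i = a (Suc t) \<omega>"
  have sp: "\<omega> \<in> space P" using b by (simp add: bounded_inputs_def)
  have pos: "0 < p (Suc t) \<omega> $ j" for j by (rule p_bounds(3)[OF b])
  have x: "0 \<le> x (Suc t) \<omega> $ j" for j using trunc_simplexD(2)[OF slot(1)[OF sp]] .
  have lin: "(\<Sum>j\<in>UNIV. lin_coeff t j \<omega> * (of_bool (a (Suc t) \<omega> = j) * S (Suc t) \<omega> $ j - p (Suc t) \<omega> $ j * mean (LS (Suc t)) $ j))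
      = axis i (gain_est t \<omega>) \<bullet> (comparator t \<omega> - x (Suc t) \<omega>) - gain t \<omega> \<bullet> (comparator t \<omega> - x (Suc t) \<omega>)"
  proof -
    have "(\<Sum>j\<in>UNIV. lin_coeff t j \<omega> * (of_bool (a (Suc t) \<omega> = j) * S (Suc t) \<omega> $ j))
        = (\<Sum>j\<in>UNIV. if i = j then lin_coeff t j \<omega> * S (Suc t) \<omega> $ j else 0)"
      by (intro sum.cong refl) (simp add: i_def)
    then have "(\<Sum>j\<in>UNIV. lin_coeff t j \<omega> * (of_bool (a (Suc t) \<omega> = j) * S (Suc t) \<omega> $ j))
        = lin_coeff t i \<omega> * S (Suc t) \<omega> $ i" by simp
    moreover have "lin_coeff t i \<omega> * S (Suc t) \<omega> $ i = axis i (gain_est t \<omega>) \<bullet> (comparator t \<omega> - x (Suc t) \<omega>)"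
      using True by (simp add: lin_coeff_def gain_est_def i_def inner_axis')
    moreover have "(\<Sum>j\<in>UNIV. lin_coeff t j \<omega> * (p (Suc t) \<omega> $ j * mean (LS (Suc t)) $ j))
        = gain t \<omega> \<bullet> (comparator t \<omega> - x (Suc t) \<omega>)"
      unfolding inner_vec_def
      by (intro sum.cong refl) (use True pos in \<open>simp add: lin_coeff_def gain_def less_imp_neq[symmetric]\<close>)
    ultimately show ?thesis by (simp add: right_diff_distrib sum_subtractf)
  qed
  have quad: "(\<Sum>j\<in>UNIV. quad_coeff t j \<omega> * (of_bool (a (Suc t) \<omega> = j) - p (Suc t) \<omega> $ j))
      \<ge> lrate t \<omega> * (gain_est t \<omega>)\<^sup>2 * x (Suc t) \<omega> $ i - 2 * lrate t \<omega> * M\<^sup>2 * (\<Sum>j\<in>UNIV. (Q t \<omega> $ j)\<^sup>2)"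
  proof -
    have "(\<Sum>j\<in>UNIV. quad_coeff t j \<omega> * of_bool (a (Suc t) \<omega> = j)) = (\<Sum>j\<in>UNIV. if i = j then quad_coeff t j \<omega> else 0)"
      by (intro sum.cong refl) (simp add: i_def)
    then have "(\<Sum>j\<in>UNIV. quad_coeff t j \<omega> * of_bool (a (Suc t) \<omega> = j)) = quad_coeff t i \<omega>" by simp
    moreover have "lrate t \<omega> * (gain_est t \<omega>)\<^sup>2 * x (Suc t) \<omega> $ i \<le> quad_coeff t i \<omega>"
    proof -
      have "(S (Suc t) \<omega> $ i)\<^sup>2 \<le> M\<^sup>2" using b by (intro power_mono) (auto simp: bounded_inputs_def)
      then have "lrate t \<omega> * x (Suc t) \<omega> $ i * (Q t \<omega> $ i / p (Suc t) \<omega> $ i)\<^sup>2 * (S (Suc t) \<omega> $ i)\<^sup>2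
          \<le> lrate t \<omega> * x (Suc t) \<omega> $ i * (Q t \<omega> $ i / p (Suc t) \<omega> $ i)\<^sup>2 * M\<^sup>2"
        using lrate_pos[of t \<omega>] x by (intro mult_left_mono) auto
      then show ?thesis using True by (simp add: quad_coeff_def gain_est_def i_def power_mult_distrib power_divide mult_ac)
    qed
    moreover have "(\<Sum>j\<in>UNIV. quad_coeff t j \<omega> * p (Suc t) \<omega> $ j) \<le> (\<Sum>j\<in>UNIV. 2 * lrate t \<omega> * M\<^sup>2 * (Q t \<omega> $ j)\<^sup>2)"
    proof (rule sum_mono)
      fix j
      have "quad_coeff t j \<omega> * p (Suc t) \<omega> $ j = lrate t \<omega> * M\<^sup>2 * (Q t \<omega> $ j)\<^sup>2 * (x (Suc t) \<omega> $ j / p (Suc t) \<omega> $ j)"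
        using True pos[of j] by (simp add: quad_coeff_def power2_eq_square)
      also have "\<dots> \<le> lrate t \<omega> * M\<^sup>2 * (Q t \<omega> $ j)\<^sup>2 * 2"
        using p_bounds(2)[OF b, of t j] pos[of j] lrate_pos[of t \<omega>]
        by (intro mult_left_mono) (auto simp: field_simps)
      finally show "quad_coeff t j \<omega> * p (Suc t) \<omega> $ j \<le> 2 * lrate t \<omega> * M\<^sup>2 * (Q t \<omega> $ j)\<^sup>2" by simp
    qed
    ultimately show ?thesis by (simp add: right_diff_distrib sum_subtractf sum_distrib_left)
  qed
  have p: "gain t \<omega> \<bullet> p (Suc t) \<omega> = gain t \<omega> \<bullet> x (Suc t) \<omega> - explore t \<omega> * (gain t \<omega> \<bullet> (x (Suc t) \<omega> - e (Suc t) \<omega>))"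
    unfolding slot(4)[OF sp] by (simp add: inner_add_right inner_diff_right algebra_simps)
  show ?thesis
    using True quad unfolding lin
    by (simp add: charge_def est_regret_def overhead_def i_def[symmetric] inner_diff_right p)
qed

lemma energy_step:
  assumes b: "bounded_inputs \<omega>"
  shows "(\<Sum>i\<in>UNIV. (Q (Suc t) \<omega> $ i)\<^sup>2) / 2 \<le> (\<Sum>i\<in>UNIV. (Q t \<omega> $ i)\<^sup>2) / 2
    + (\<Sum>i\<in>UNIV. Q t \<omega> $ i * (A (Suc t) \<omega> $ i - of_bool (a (Suc t) \<omega> = i) * S (Suc t) \<omega> $ i)) + real CARD('k) * M\<^sup>2 / 2"
proof -
  have "(Q (Suc t) \<omega> $ i)\<^sup>2 \<le> (Q t \<omega> $ i)\<^sup>2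
      + 2 * (Q t \<omega> $ i * (A (Suc t) \<omega> $ i - of_bool (a (Suc t) \<omega> = i) * S (Suc t) \<omega> $ i)) + M\<^sup>2" for i
  proof -
    define d where "d = A (Suc t) \<omega> $ i - of_bool (a (Suc t) \<omega> = i) * S (Suc t) \<omega> $ i"
    have "0 \<le> A (Suc t) \<omega> $ i" "A (Suc t) \<omega> $ i \<le> M" "0 \<le> S (Suc t) \<omega> $ i" "S (Suc t) \<omega> $ i \<le> M"
      using b by (auto simp: bounded_inputs_def)
    then have "\<bar>d\<bar> \<le> M" by (cases "a (Suc t) \<omega> = i") (simp_all add: d_def)
    then have "d\<^sup>2 \<le> M\<^sup>2" using M_pos by (simp add: abs_le_square_iff[symmetric])
    have "Q (Suc t) \<omega> $ i = max (Q t \<omega> $ i + d) 0" unfolding Q_Suc d_def by (auto simp: algebra_simps)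
    then have "(Q (Suc t) \<omega> $ i)\<^sup>2 \<le> (Q t \<omega> $ i + d)\<^sup>2" by (simp add: max_def)
    also have "\<dots> = (Q t \<omega> $ i)\<^sup>2 + 2 * (Q t \<omega> $ i * d) + d\<^sup>2" by (simp add: power2_sum)
    finally show ?thesis using \<open>d\<^sup>2 \<le> M\<^sup>2\<close> by (simp add: d_def)
  qed
  then have "(\<Sum>i\<in>UNIV. (Q (Suc t) \<omega> $ i)\<^sup>2) \<le> (\<Sum>i\<in>UNIV. (Q t \<omega> $ i)\<^sup>2
      + 2 * (Q t \<omega> $ i * (A (Suc t) \<omega> $ i - of_bool (a (Suc t) \<omega> = i) * S (Suc t) \<omega> $ i)) + M\<^sup>2)"
    by (intro sum_mono)
  then show ?thesis by (simp add: sum.distrib sum_distrib_left[symmetric])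
qed

lemma drift_step:
  assumes b: "bounded_inputs \<omega>"
  shows "(\<Sum>i\<in>UNIV. (Q (Suc t) \<omega> $ i)\<^sup>2) / 2 - (\<Sum>i\<in>UNIV. (Q t \<omega> $ i)\<^sup>2) / 2
      + (\<Sum>i\<in>UNIV. Q t \<omega> $ i * (\<theta> (Suc t) $ i * mean (LS (Suc t)) $ i - mean (LA (Suc t)) $ i))
    \<le> charge t \<omega> + noise t \<omega> + real CARD('k) * M\<^sup>2 / 2"
proof -
  have "(\<Sum>i\<in>UNIV. Q t \<omega> $ i * (A (Suc t) \<omega> $ i - of_bool (a (Suc t) \<omega> = i) * S (Suc t) \<omega> $ i))
      + (\<Sum>i\<in>UNIV. Q t \<omega> $ i * (\<theta> (Suc t) $ i * mean (LS (Suc t)) $ i - mean (LA (Suc t)) $ i))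
    = noise t \<omega> + (gain t \<omega> \<bullet> (\<theta> (Suc t) - p (Suc t) \<omega>)
    + (\<Sum>i\<in>UNIV. lin_coeff t i \<omega> * (of_bool (a (Suc t) \<omega> = i) * S (Suc t) \<omega> $ i - p (Suc t) \<omega> $ i * mean (LS (Suc t)) $ i))
    - (\<Sum>i\<in>UNIV. quad_coeff t i \<omega> * (of_bool (a (Suc t) \<omega> = i) - p (Suc t) \<omega> $ i)))"
    unfolding noise_def inner_vec_def sum.distrib[symmetric] sum_subtractf[symmetric]
    by (intro sum.cong refl) (simp add: gain_def algebra_simps)
  then show ?thesis using energy_step[OF b, of t] charge_ge[OF b, of t] by linarith
qed

text \<open>Summing the drift inequality: the energy telescopes from \<open>0\<close> to something nonnegative, the reference
  policy contributes \<open>-\<epsilon> \<Sum> \<parallel>Q\<parallel>\<^sub>1\<close> up to the window loss \<open>W\<close>, and the charges give back at most half of that.\<close>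
lemma queue_sum_le:
  assumes b: "bounded_inputs \<omega>"
    and slack: "(\<Sum>t<T. \<epsilon> * norm1 (Q t \<omega>)) - W
      \<le> (\<Sum>t<T. \<Sum>i\<in>UNIV. Q t \<omega> $ i * (\<theta> (Suc t) $ i * mean (LS (Suc t)) $ i - mean (LA (Suc t)) $ i))"
  shows "\<epsilon> / 2 * (\<Sum>t<T. norm1 (Q t \<omega>))
    \<le> W + (3 * M\<^sup>2 * real N + real CARD('k) * M\<^sup>2 / 2) * real T + (\<Sum>t<T. noise t \<omega>)"
proof -
  define X where "X t = (\<Sum>i\<in>UNIV. (Q t \<omega> $ i)\<^sup>2) / 2" for t
  define Y where "Y t = (\<Sum>i\<in>UNIV. Q t \<omega> $ i * (\<theta> (Suc t) $ i * mean (LS (Suc t)) $ i - mean (LA (Suc t)) $ i))" for t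
  have "(\<Sum>t<T. X (Suc t) - X t + Y t) \<le> (\<Sum>t<T. charge t \<omega> + noise t \<omega> + real CARD('k) * M\<^sup>2 / 2)"
    unfolding X_def Y_def by (intro sum_mono drift_step b)
  moreover have "(\<Sum>t<T. X (Suc t) - X t) = X T - X 0" by (rule sum_lessThan_telescope)
  moreover have "X 0 = 0" by (simp add: X_def Q_0)
  moreover have "0 \<le> X T" by (simp add: X_def sum_nonneg)
  ultimately have "(\<Sum>t<T. Y t) \<le> (\<Sum>t<T. charge t \<omega>) + (\<Sum>t<T. noise t \<omega>) + real CARD('k) * M\<^sup>2 / 2 * real T"
    by (simp add: sum.distrib mult.commute mult.left_commute)
  then show ?thesis
    using slack charge_total[OF b, of T] unfolding Y_def[symmetric] sum_distrib_left[symmetric]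
    by (simp add: algebra_simps)
qed

lemma norm1_integrable: "integrable P (\<lambda>\<omega>. norm1 (Q t \<omega>))"
proof (rule F_integrable[where t = t and B = "real CARD('k) * (M * real t)"])
  show "(\<lambda>\<omega>. norm1 (Q t \<omega>)) \<in> borel_measurable (F t)"
    unfolding norm1_Q by (intro borel_measurable_sum Q_nth_measurable)
  show "\<bar>norm1 (Q t \<omega>)\<bar> \<le> real CARD('k) * (M * real t)" if "bounded_inputs \<omega>" for \<omega>
    using sum_bounded_above[of UNIV "\<lambda>i. Q t \<omega> $ i" "M * real t"] Q_le[OF that]
    by (simp add: norm1_Q sum_nonneg Q_nonneg)
qed

lemma expected_queue_sum_le:
  assumes slack: "\<And>\<omega>. bounded_inputs \<omega> \<Longrightarrow> (\<Sum>t<T. \<epsilon> * norm1 (Q t \<omega>)) - W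
      \<le> (\<Sum>t<T. \<Sum>i\<in>UNIV. Q t \<omega> $ i * (\<theta> (Suc t) $ i * mean (LS (Suc t)) $ i - mean (LA (Suc t)) $ i))"
  shows "\<epsilon> / 2 * (\<integral>\<omega>. (\<Sum>t<T. norm1 (Q t \<omega>)) \<partial>P)
    \<le> W + (3 * M\<^sup>2 * real N + real CARD('k) * M\<^sup>2 / 2) * real T"
proof -
  define B where "B = W + (3 * M\<^sup>2 * real N + real CARD('k) * M\<^sup>2 / 2) * real T"
  have int: "integrable P (\<lambda>\<omega>. \<Sum>t<T. norm1 (Q t \<omega>))" "integrable P (\<lambda>\<omega>. \<Sum>t<T. noise t \<omega>)"
    using norm1_integrable noise_mean_zero(1) by auto
  have "(\<integral>\<omega>. \<epsilon> / 2 * (\<Sum>t<T. norm1 (Q t \<omega>)) \<partial>P) \<le> (\<integral>\<omega>. B + (\<Sum>t<T. noise t \<omega>) \<partial>P)"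
  proof (rule integral_mono_AE)
    show "AE \<omega> in P. \<epsilon> / 2 * (\<Sum>t<T. norm1 (Q t \<omega>)) \<le> B + (\<Sum>t<T. noise t \<omega>)"
      using AE_bounded_inputs
    proof (rule AE_mp, intro AE_I2 impI)
      fix \<omega> assume b: "bounded_inputs \<omega>"
      show "\<epsilon> / 2 * (\<Sum>t<T. norm1 (Q t \<omega>)) \<le> B + (\<Sum>t<T. noise t \<omega>)"
        unfolding B_def by (rule queue_sum_le[OF b slack[OF b]])
    qed
  qed (use int in auto)
  also have "\<dots> = B + (\<integral>\<omega>. (\<Sum>t<T. noise t \<omega>) \<partial>P)" using int by (simp add: prob_space)
  also have "(\<integral>\<omega>. (\<Sum>t<T. noise t \<omega>) \<partial>P) = 0" using noise_mean_zero by (simp add: Bochner_Integration.integral_sum)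
  finally show ?thesis by (simp add: B_def)
qed

text \<open>From \<open>T \<ge> 4 / C\<^sub>W + C\<^sub>W \<ge> 4\<close> and \<open>T' \<le> 2 T + 1\<close> follows \<open>T' + 1 \<le> (5 / 2) T\<close>; the other factor 2 comes from
  the half of the drift that remains.\<close>
lemma average_queue_length_le:
  assumes stab: "piecewise_stabilizable C\<^sub>W \<epsilon> \<theta> (\<lambda>t. mean (LA t)) (\<lambda>t. mean (LS t))"
    and C: "0 < C\<^sub>W" and T: "4 / C\<^sub>W + C\<^sub>W \<le> real T"
  shows "1 / real T * (\<integral>\<omega>. (\<Sum>t=1..T. norm1 (Q t \<omega>)) \<partial>P)
    \<le> (3 * M\<^sup>2 * real N + real CARD('k) * M\<^sup>2 / 2 + real CARD('k) * (M\<^sup>2 + \<epsilon> * M) * C\<^sub>W) * (5 / \<epsilon>)"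
proof -
  obtain T' where T': "T < T'" "T' \<le> 2 * T + 1"
    and slack: "\<And>Q :: nat \<Rightarrow> real ^ 'k. (\<And>t i. 0 \<le> Q t $ i) \<Longrightarrow> (\<And>t i. \<bar>Q (Suc t) $ i - Q t $ i\<bar> \<le> M) \<Longrightarrow>
      (\<Sum>t<T'. \<epsilon> * norm1 (Q t)) - real CARD('k) * (M\<^sup>2 + \<epsilon> * M) * (C\<^sub>W * (real T' + 1))
      \<le> (\<Sum>t<T'. \<Sum>i\<in>UNIV. Q t $ i * (\<theta> (Suc t) $ i * mean (LS (Suc t)) $ i - mean (LA (Suc t)) $ i))"
    by (rule piecewise_stabilizable_slack[OF stab C T])
      (use mean_arrival(2) mean_service(2) in auto)
  define U where "U = 3 * M\<^sup>2 * real N + real CARD('k) * M\<^sup>2 / 2"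
  define V where "V = real CARD('k) * (M\<^sup>2 + \<epsilon> * M) * C\<^sub>W"
  have UV: "0 \<le> U" "0 \<le> V" using M_pos eps_pos C by (simp_all add: U_def V_def)
  have "4 \<le> 4 / C\<^sub>W + C\<^sub>W"
  proof -
    have "0 \<le> (C\<^sub>W - 2)\<^sup>2" by simp
    then show ?thesis using C by (simp add: field_simps power2_eq_square)
  qed
  then have T4: "4 \<le> real T" using T by linarith
  have nn: "0 \<le> norm1 (Q t \<omega>)" for t \<omega> by (simp add: norm1_def sum_nonneg)
  have "(\<integral>\<omega>. (\<Sum>t=1..T. norm1 (Q t \<omega>)) \<partial>P) \<le> (\<integral>\<omega>. (\<Sum>t<T'. norm1 (Q t \<omega>)) \<partial>P)"
    using T'(1) nn norm1_integrable
    by (intro integral_mono Bochner_Integration.integrable_sum sum_mono2) auto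
  moreover have "\<epsilon> / 2 * (\<integral>\<omega>. (\<Sum>t<T'. norm1 (Q t \<omega>)) \<partial>P)
      \<le> real CARD('k) * (M\<^sup>2 + \<epsilon> * M) * (C\<^sub>W * (real T' + 1)) + U * real T'"
    unfolding U_def by (rule expected_queue_sum_le, rule slack) (use Q_nonneg Q_step in auto)
  moreover have "real CARD('k) * (M\<^sup>2 + \<epsilon> * M) * (C\<^sub>W * (real T' + 1)) + U * real T' \<le> V * (5 / 2 * real T) + U * (5 / 2 * real T)"
  proof -
    have T'_le: "real T' + 1 \<le> 5 / 2 * real T" "real T' \<le> 5 / 2 * real T" using T' T4 by linarith+
    have "V * (real T' + 1) \<le> V * (5 / 2 * real T)" "U * real T' \<le> U * (5 / 2 * real T)"
      by (intro mult_left_mono UV T'_le)+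
    moreover have "real CARD('k) * (M\<^sup>2 + \<epsilon> * M) * (C\<^sub>W * (real T' + 1)) = V * (real T' + 1)"
      by (simp add: V_def mult.assoc)
    ultimately show ?thesis by linarith
  qed
  moreover have "\<epsilon> / 2 * (\<integral>\<omega>. (\<Sum>t=1..T. norm1 (Q t \<omega>)) \<partial>P) \<le> \<epsilon> / 2 * (\<integral>\<omega>. (\<Sum>t<T'. norm1 (Q t \<omega>)) \<partial>P)"
    using calculation(1) eps_pos by (intro mult_left_mono) auto
  ultimately have "\<epsilon> / 2 * (\<integral>\<omega>. (\<Sum>t=1..T. norm1 (Q t \<omega>)) \<partial>P) \<le> V * (5 / 2 * real T) + U * (5 / 2 * real T)"
    by linarith
  then show ?thesis
    using eps_pos T4 unfolding U_def[symmetric] V_def[symmetric] by (simp add: field_simps)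
qed

end

text \<open>Used to deduce stability in the case \<open>C\<^sub>W = 0\<close>, which the explicit bound excludes.\<close>
lemma piecewise_stabilizable_mono:
  assumes "piecewise_stabilizable C \<epsilon> \<theta> lam sig" "C \<le> C'"
  shows "piecewise_stabilizable C' \<epsilon> \<theta> lam sig"
  using assms unfolding piecewise_stabilizable_def
  by (meson mult_right_mono of_nat_0_le_iff order_trans)

theorem theorem6p1:
  fixes P :: "'w measure" and F :: "nat \<Rightarrow> 'w measure"
    and M \<delta> C\<^sub>W C\<^sub>V \<epsilon> :: real
    and LA LS :: "nat \<Rightarrow> (real ^ 'k) measure"
    and A S x e p :: "nat \<Rightarrow> 'w \<Rightarrow> real ^ 'k"
    and a :: "nat \<Rightarrow> 'w \<Rightarrow> 'k"
    and \<theta> :: "nat \<Rightarrow> real ^ 'k"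
  assumes run: "ssmw_run P F M LA LS A S a \<delta> x e p"
    and stabilizable: "piecewise_stabilizable C\<^sub>W \<epsilon> \<theta> (\<lambda>t. mean (LA t)) (\<lambda>t. mean (LS t))"
    and stationary: "reference_stationary \<delta> C\<^sub>V \<theta>"
    and delta_le_1: "\<delta> \<le> 1"
  defines "K \<equiv> CARD('k)"
  shows "(\<forall>T::nat. 0 < C\<^sub>W \<and> 4 / C\<^sub>W + C\<^sub>W \<le> real T \<longrightarrow>
            1 / real T * (\<integral>\<omega>. (\<Sum>t=1..T. norm1 (queue_proc A S a t \<omega>)) \<partial>P)
            \<le> (3 * real K * M\<^sup>2 * real (m0 K M C\<^sub>V \<delta> \<epsilon>) + (real K + 1) * M\<^sup>2 / 2
                 + (real K * M\<^sup>2 + \<epsilon> * real K * M) * C\<^sub>W + 6 * M\<^sup>2) * (10 / \<epsilon>))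
         \<and> queue_stable P (queue_proc A S a)
         \<and> m0_set K M C\<^sub>V \<delta> \<epsilon> \<noteq> {}
         \<and> m0_growth"
proof -
  interpret ssmw_run P F M LA LS A S a \<delta> x e p by (rule run)
  define N where "N = m0 K M C\<^sub>V \<delta> \<epsilon>"
  have \<delta>: "0 < \<delta>" and C\<^sub>V: "0 < C\<^sub>V" using stationary by (auto simp: reference_stationary_def)
  have \<epsilon>: "0 < \<epsilon>" and C\<^sub>W: "0 \<le> C\<^sub>W" using stabilizable by (auto simp: piecewise_stabilizable_def)
  have K: "1 \<le> K" unfolding K_def by (simp add: Suc_leI)
  have nonempty: "m0_set K M C\<^sub>V \<delta> \<epsilon> \<noteq> {}" by (rule m0_set_nonempty[OF \<delta> M_pos C\<^sub>V \<epsilon> K])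
  then have "N \<in> m0_set K M C\<^sub>V \<delta> \<epsilon>" unfolding N_def m0_def by (rule Inf_nat_def1)
  then interpret ssmw_analysis P F M LA LS A S a \<delta> x e p \<theta> C\<^sub>V \<epsilon> N
    using stabilizable stationary delta_le_1 \<epsilon>
    by unfold_locales (auto simp: m0_set_def K_def piecewise_stabilizable_def)
  have "3 * M\<^sup>2 * real N \<le> 3 * M\<^sup>2 * real N * real K"
    using K mult_left_mono[of 1 "real K" "3 * M\<^sup>2 * real N"] by simp
  have bound: "1 / real T * (\<integral>\<omega>. (\<Sum>t=1..T. norm1 (Q t \<omega>)) \<partial>P)
      \<le> (3 * real K * M\<^sup>2 * real N + (real K + 1) * M\<^sup>2 / 2
          + (real K * M\<^sup>2 + \<epsilon> * real K * M) * C\<^sub>W + 6 * M\<^sup>2) * (10 / \<epsilon>)"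
    if "0 < C\<^sub>W" "4 / C\<^sub>W + C\<^sub>W \<le> real T" for T
  proof -
    define U where "U = 3 * M\<^sup>2 * real N + real K * M\<^sup>2 / 2 + real K * (M\<^sup>2 + \<epsilon> * M) * C\<^sub>W"
    have "0 \<le> U" using M_pos \<epsilon> C\<^sub>W by (simp add: U_def)
    have "1 / real T * (\<integral>\<omega>. (\<Sum>t=1..T. norm1 (Q t \<omega>)) \<partial>P) \<le> U * (5 / \<epsilon>)"
      using average_queue_length_le[OF stabilizable that] by (simp add: U_def K_def)
    also have "\<dots> \<le> U * (10 / \<epsilon>)" using \<open>0 \<le> U\<close> \<epsilon> by (intro mult_left_mono divide_right_mono) auto
    also have "\<dots> \<le> (3 * real K * M\<^sup>2 * real N + (real K + 1) * M\<^sup>2 / 2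
          + (real K * M\<^sup>2 + \<epsilon> * real K * M) * C\<^sub>W + 6 * M\<^sup>2) * (10 / \<epsilon>)"
    proof (rule mult_right_mono)
      have "3 * real K * M\<^sup>2 * real N + (real K + 1) * M\<^sup>2 / 2 + (real K * M\<^sup>2 + \<epsilon> * real K * M) * C\<^sub>W + 6 * M\<^sup>2
          = U + (3 * M\<^sup>2 * real N * real K - 3 * M\<^sup>2 * real N) + M\<^sup>2 / 2 + 6 * M\<^sup>2"
        by (simp add: U_def field_simps)
      moreover have "0 \<le> M\<^sup>2" by simp
      ultimately show "U \<le> 3 * real K * M\<^sup>2 * real N + (real K + 1) * M\<^sup>2 / 2
          + (real K * M\<^sup>2 + \<epsilon> * real K * M) * C\<^sub>W + 6 * M\<^sup>2"
        using \<open>3 * M\<^sup>2 * real N \<le> 3 * M\<^sup>2 * real N * real K\<close> by linarith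
    qed (use \<epsilon> in simp)
    finally show ?thesis .
  qed
  have stable: "queue_stable P Q"
  proof -
    \<comment> \<open>A positive constant is needed, also if \<open>C\<^sub>W = 0\<close>.\<close>
    define C where "C = C\<^sub>W + 1"
    have C: "0 < C" using C\<^sub>W by (simp add: C_def)
    have stabC: "piecewise_stabilizable C \<epsilon> \<theta> (\<lambda>t. mean (LA t)) (\<lambda>t. mean (LS t))"
      by (rule piecewise_stabilizable_mono[OF stabilizable]) (simp add: C_def)
    define B where "B = (3 * M\<^sup>2 * real N + real CARD('k) * M\<^sup>2 / 2 + real CARD('k) * (M\<^sup>2 + \<epsilon> * M) * C) * (5 / \<epsilon>)"
    have le: "\<bar>1 / real T * (\<Sum>t<T. \<Sum>i\<in>UNIV. \<integral>\<omega>. Q t \<omega> $ i \<partial>P)\<bar> \<le> B" if T: "4 / C + C \<le> real T" for T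
    proof -
      have nonneg: "0 \<le> (\<integral>\<omega>. Q t \<omega> $ i \<partial>P)" for t i by (intro Bochner_Integration.integral_nonneg Q_nonneg)
      have intQ: "integrable P (\<lambda>\<omega>. Q t \<omega> $ i)" for t i
      proof (rule Bochner_Integration.integrable_bound[OF norm1_integrable[of t]])
        show "(\<lambda>\<omega>. Q t \<omega> $ i) \<in> borel_measurable P"
          by (rule measurable_from_subalg[OF F_subalgebra Q_nth_measurable])
        show "AE \<omega> in P. norm (Q t \<omega> $ i) \<le> norm (norm1 (Q t \<omega>))"
          using Q_le_norm1 Q_nonneg by (intro AE_I2) (simp add: order_trans[OF _ abs_ge_self])
      qed
      have "(\<Sum>t<T. \<Sum>i\<in>UNIV. \<integral>\<omega>. Q t \<omega> $ i \<partial>P) \<le> (\<Sum>t<Suc T. \<Sum>i\<in>UNIV. \<integral>\<omega>. Q t \<omega> $ i \<partial>P)"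
        using nonneg by (simp add: sum_nonneg)
      also have "\<dots> = (\<Sum>t<Suc T. \<integral>\<omega>. norm1 (Q t \<omega>) \<partial>P)"
        unfolding norm1_Q using intQ by simp
      also have "\<dots> = (\<Sum>t=1..T. \<integral>\<omega>. norm1 (Q t \<omega>) \<partial>P)"
        by (simp add: sum.lessThan_Suc_shift sum.atLeast1_atMost_eq Q_0 norm1_def del: sum.lessThan_Suc)
      also have "\<dots> = (\<integral>\<omega>. (\<Sum>t=1..T. norm1 (Q t \<omega>)) \<partial>P)"
        using norm1_integrable by simp
      finally have "1 / real T * (\<Sum>t<T. \<Sum>i\<in>UNIV. \<integral>\<omega>. Q t \<omega> $ i \<partial>P)
          \<le> 1 / real T * (\<integral>\<omega>. (\<Sum>t=1..T. norm1 (Q t \<omega>)) \<partial>P)" by (intro mult_left_mono) auto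
      also have "\<dots> \<le> B" unfolding B_def by (rule average_queue_length_le[OF stabC C T])
      finally show ?thesis using nonneg by (simp add: sum_nonneg)
    qed
    have "eventually (\<lambda>T. 4 / C + C \<le> real T) sequentially"
      using filterlim_real_sequentially by (simp add: filterlim_at_top)
    then show ?thesis
      unfolding queue_stable_def by (intro bigoI[where c = B]) (auto elim!: eventually_mono dest: le)
  qed
  show ?thesis using bound stable nonempty m0_growth unfolding N_def by blast
qed

end
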